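(* Let $\mathsf f$ be an a.s. uniformly bounded additive functional on a uniformly elliptic Markov chain $\mathsf X$. Then there exists an irreducible uniformly bounded additive functional $\mathsf g$ on $\mathsf X$ such that $\mathsf f-\mathsf g$ is center-tight and $$G_{alg}(\mathsf X,\mathsf g)=G_{ess}(\mathsf X,\mathsf g)=G_{ess}(\mathsf X,\mathsf f).$$
   Context: A Markov chain $\mathsf X=\{X_n\}_{n\ge1}$ (possibly inhomogeneous) has complete separable metric state spaces $\mathfrak S_n\ni X_n$ with Borel $\sigma$-algebras, an initial distribution on $\mathfrak S_1$, and transition kernels $\pi_{n,n+1}(x,dy)$, so that $\mathbb P(X_{n+1}\in E\mid X_n,\dots,X_1)=\pi_{n,n+1}(X_n,E)$. It is uniformly elliptic if there are $0<\epsilon_0<1$, Borel probability measures $\mu_n$ on $\mathfrak S_n$ and measurable $p_n:\mathfrak S_n\times\mathfrak S_{n+1}\to[0,\infty)$ such that for all $n\ge1$: (a) $\pi_{n,n+1}(x,dy)=p_n(x,y)\mu_{n+1}(dy)$; (b) $0\le p_n\le1/\epsilon_0$; (c) $\int_{\mathfrak S_{n+1}}p_n(x,y)p_{n+1}(y,z)\mu_{n+1}(dy)>\epsilon_0$ for all $x\in\mathfrak S_n$, $z\in\mathfrak S_{n+2}$. An additive functional is a sequence $\mathsf f=\{f_n\}$ of measurable $f_n:\mathfrak S_n\times\mathfrak S_{n+1}\to\mathbb R$; $S_N=\sum_{n=1}^Nf_n(X_n,X_{n+1})$. $\mathsf f$ is uniformly bounded if $\sup_n\sup_{x,y}|f_n(x,y)|<\infty$,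 and a.s. uniformly bounded if $\sup_n\mathrm{ess\,sup}|f_n(X_n,X_{n+1})|<\infty$. $\mathsf f$ is center-tight if there are constants $m_N$ such that for every $\epsilon>0$ there is $M$ with $\mathbb P[|S_N-m_N|>M]<\epsilon$ for all $N$. $G_{alg}(\mathsf X,\mathsf f)$ (algebraic range) is the intersection of all closed subgroups $G\le\mathbb R$ for which there are $c_n\in\mathbb R$ with $\mathbb P[f_n(X_n,X_{n+1})-c_n\in G]=1$ for all $n\ge1$. $G_{ess}(\mathsf X,\mathsf f)$ (essential range) is $\bigcap\{G_{alg}(\mathsf X,\mathsf g):\mathsf g$ an additive functional on $\mathsf X$ with $\mathsf f-\mathsf g$ center-tight$\}$. $\mathsf f$ is irreducible if $G_{ess}(\mathsf X,\mathsf f)=G_{alg}(\mathsf X,\mathsf f)$. *)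

theory Defs
  imports "HOL-Probability.Probability"
begin

text \<open>
  The state spaces form a sequence \<open>S\<close> of metric spaces, the \<open>n\<close>-th one with carrier
  \<open>mspace (S n)\<close> and its own metric. The carriers are arbitrary subsets of one type \<open>'a\<close>, which is
  no restriction, as the type is a free variable. Time starts at 1: all sequences are indexed
  by \<open>nat\<close>, and their entries at index 0 are irrelevant.
\<close>

definition borel_of_metric :: "'a metric \<Rightarrow> 'a measure" where
  "borel_of_metric m = sigma (mspace m) {U. openin (mtopology_of m) U}"

definition polish_metric :: "'a metric \<Rightarrow> bool" where
  "polish_metric m \<longleftrightarrow> mcomplete_of m \<and> separable_space (mtopology_of m)"

definition past_algebra ::
  "(nat \<Rightarrow> 'a metric) \<Rightarrow> 'w measure \<Rightarrow> (nat \<Rightarrow> 'w \<Rightarrow> 'a) \<Rightarrow> nat \<Rightarrow> 'w measure" where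
  "past_algebra S P X n =
     vimage_algebra (space P) (\<lambda>\<omega>. \<lambda>i\<in>{1..n}. X i \<omega>) (\<Pi>\<^sub>M i\<in>{1..n}. borel_of_metric (S i))"

text \<open>
  The chain is realised by random variables \<open>X n\<close> on an arbitrary probability space \<open>P\<close>; its
  initial distribution is the law of \<open>X 1\<close>. \<open>K n\<close> is the transition kernel
  from \<open>S n\<close> to \<open>S (n + 1)\<close>.
\<close>

locale markov_chain = prob_space P
  for S :: "nat \<Rightarrow> 'a metric"
    and P :: "'w measure"
    and X :: "nat \<Rightarrow> 'w \<Rightarrow> 'a"
    and K :: "nat \<Rightarrow> 'a \<Rightarrow> 'a measure" +
  assumes polish: "\<And>n. n \<ge> 1 \<Longrightarrow> polish_metric (S n)"
    and state: "\<And>n. n \<ge> 1 \<Longrightarrow> X n \<in> P \<rightarrow>\<^sub>M borel_of_metric (S n)"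
    and kernel: "\<And>n. n \<ge> 1 \<Longrightarrow>
      K n \<in> borel_of_metric (S n) \<rightarrow>\<^sub>M prob_algebra (borel_of_metric (S (n + 1)))"
    and markov: "\<And>n E. n \<ge> 1 \<Longrightarrow> E \<in> sets (borel_of_metric (S (n + 1))) \<Longrightarrow>
      AE \<omega> in P. real_cond_exp P (past_algebra S P X n) (\<lambda>\<omega>'. indicator E (X (n + 1) \<omega>')) \<omega>
                  = measure (K n (X n \<omega>)) E"

definition uniformly_elliptic ::
  "(nat \<Rightarrow> 'a metric) \<Rightarrow> (nat \<Rightarrow> 'a \<Rightarrow> 'a measure) \<Rightarrow> bool" where
  "uniformly_elliptic S K \<longleftrightarrow>
    (\<exists>(\<epsilon>\<^sub>0::real) (\<mu> :: nat \<Rightarrow> 'a measure) (p :: nat \<Rightarrow> 'a \<Rightarrow> 'a \<Rightarrow> real).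
       0 < \<epsilon>\<^sub>0 \<and> \<epsilon>\<^sub>0 < 1 \<and>
       (\<forall>n\<ge>1. prob_space (\<mu> n) \<and> sets (\<mu> n) = sets (borel_of_metric (S n))) \<and>
       (\<forall>n\<ge>1. case_prod (p n)
          \<in> borel_measurable (borel_of_metric (S n) \<Otimes>\<^sub>M borel_of_metric (S (n + 1)))) \<and>
       (\<forall>n\<ge>1. \<forall>x\<in>mspace (S n). K n x = density (\<mu> (n + 1)) (\<lambda>y. ennreal (p n x y))) \<and>
       (\<forall>n\<ge>1. \<forall>x\<in>mspace (S n). \<forall>y\<in>mspace (S (n + 1)). 0 \<le> p n x y \<and> p n x y \<le> 1 / \<epsilon>\<^sub>0) \<and>
       (\<forall>n\<ge>1. \<forall>x\<in>mspace (S n). \<forall>z\<in>mspace (S (n + 2)).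
          (\<integral>y. p n x y * p (n + 1) y z \<partial>\<mu> (n + 1)) > \<epsilon>\<^sub>0))"

definition additive_functional ::
  "(nat \<Rightarrow> 'a metric) \<Rightarrow> (nat \<Rightarrow> 'a \<Rightarrow> 'a \<Rightarrow> real) \<Rightarrow> bool" where
  "additive_functional S f \<longleftrightarrow>
    (\<forall>n\<ge>1. case_prod (f n)
       \<in> borel_measurable (borel_of_metric (S n) \<Otimes>\<^sub>M borel_of_metric (S (n + 1))))"

definition partial_sum ::
  "(nat \<Rightarrow> 'w \<Rightarrow> 'a) \<Rightarrow> (nat \<Rightarrow> 'a \<Rightarrow> 'a \<Rightarrow> real) \<Rightarrow> nat \<Rightarrow> 'w \<Rightarrow> real" where
  "partial_sum X f N \<omega> = (\<Sum>n=1..N. f n (X n \<omega>) (X (n + 1) \<omega>))"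

definition uniformly_bounded ::
  "(nat \<Rightarrow> 'a metric) \<Rightarrow> (nat \<Rightarrow> 'a \<Rightarrow> 'a \<Rightarrow> real) \<Rightarrow> bool" where
  "uniformly_bounded S f \<longleftrightarrow>
    (SUP n\<in>{1..}. SUP (x, y)\<in>mspace (S n) \<times> mspace (S (n + 1)). ereal \<bar>f n x y\<bar>) < \<infinity>"

definition as_uniformly_bounded ::
  "'w measure \<Rightarrow> (nat \<Rightarrow> 'w \<Rightarrow> 'a) \<Rightarrow> (nat \<Rightarrow> 'a \<Rightarrow> 'a \<Rightarrow> real) \<Rightarrow> bool" where
  "as_uniformly_bounded P X f \<longleftrightarrow>
    (SUP n\<in>{1..}. esssup P (\<lambda>\<omega>. ereal \<bar>f n (X n \<omega>) (X (n + 1) \<omega>)\<bar>)) < \<infinity>"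

definition center_tight ::
  "'w measure \<Rightarrow> (nat \<Rightarrow> 'w \<Rightarrow> 'a) \<Rightarrow> (nat \<Rightarrow> 'a \<Rightarrow> 'a \<Rightarrow> real) \<Rightarrow> bool" where
  "center_tight P X f \<longleftrightarrow>
    (\<exists>m :: nat \<Rightarrow> real. \<forall>\<epsilon>>0. \<exists>M :: real. \<forall>N\<ge>1.
       \<P>(\<omega> in P. \<bar>partial_sum X f N \<omega> - m N\<bar> > M) < \<epsilon>)"

definition closed_subgroup :: "real set \<Rightarrow> bool" where
  "closed_subgroup G \<longleftrightarrow>
    closed G \<and> 0 \<in> G \<and> (\<forall>x\<in>G. \<forall>y\<in>G. x + y \<in> G) \<and> (\<forall>x\<in>G. - x \<in> G)"

definition G_alg ::
  "'w measure \<Rightarrow> (nat \<Rightarrow> 'w \<Rightarrow> 'a) \<Rightarrow> (nat \<Rightarrow> 'a \<Rightarrow> 'a \<Rightarrow> real) \<Rightarrow> real set" where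
  "G_alg P X f =
    \<Inter> {G. closed_subgroup G \<and>
        (\<exists>c :: nat \<Rightarrow> real. \<forall>n\<ge>1. \<P>(\<omega> in P. f n (X n \<omega>) (X (n + 1) \<omega>) - c n \<in> G) = 1)}"

definition G_ess ::
  "(nat \<Rightarrow> 'a metric) \<Rightarrow> 'w measure \<Rightarrow> (nat \<Rightarrow> 'w \<Rightarrow> 'a) \<Rightarrow> (nat \<Rightarrow> 'a \<Rightarrow> 'a \<Rightarrow> real)
    \<Rightarrow> real set" where
  "G_ess S P X f =
    \<Inter> {G_alg P X g | g. additive_functional S g \<and>
        center_tight P X (\<lambda>n x y. f n x y - g n x y)}"

definition irreducible_functional ::
  "(nat \<Rightarrow> 'a metric) \<Rightarrow> 'w measure \<Rightarrow> (nat \<Rightarrow> 'w \<Rightarrow> 'a) \<Rightarrow> (nat \<Rightarrow> 'a \<Rightarrow> 'a \<Rightarrow> real)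
    \<Rightarrow> bool" where
  "irreducible_functional S P X f \<longleftrightarrow> G_ess S P X f = G_alg P X f"

end

theory Submission
  imports Defs
begin

text \<open>
  The co-range of \<open>f\<close> is the set of all \<open>\<xi>\<close> for which \<open>exp (\<i> \<xi> f)\<close> is a multiplicative coboundary times constants,
  up to an error that is square summable in time. It is a group. If \<open>f - g\<close> is center-tight and \<open>g\<close>
  takes values in translates of \<open>t\<int>\<close>, then \<open>2\<pi> / t\<close> is in the co-range: tightness bounds the
  characteristic functions of the sums of \<open>f - g\<close> from below at small frequencies, and these generate
  all frequencies. Conversely, taking logarithms, \<open>\<xi> > 0\<close> in the co-range of a bounded \<open>f\<close> yields a bounded \<open>g\<close> with values in
  \<open>(2\<pi> / \<xi>)\<int>\<close> such that \<open>f - g\<close> is a bounded coboundary plus constants plus a square summable functional,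
  which is center-tight because the variance of sums is controlled by ellipticity; moreover \<open>g = 0\<close> if \<open>\<xi>\<close> is
  small compared to the bound of \<open>f\<close>. As a subgroup of the reals, the co-range contains arbitrarily small positive
  elements (then \<open>g = 0\<close> works), or is trivial (then \<open>g = f\<close> works), or is generated by some \<open>\<xi> > 0\<close>
  (then the \<open>g\<close> above works).
\<close>

section \<open>Elliptic chains and their transition kernels\<close>

text \<open>The co-range is dual to the essential range. A competitor of \<open>f\<close> with
  values in translates of \<open>s\<int>\<close> puts \<open>2\<pi> / s\<close> into the co-range;
  if \<open>\<xi>\<close> generates the co-range, then \<open>2\<pi> / s\<close> is a multiple of
  \<open>\<xi>\<close>, that is, \<open>(2\<pi> / \<xi>)\<int>\<close> is contained in
  \<open>s\<int>\<close>. So minimality of the group is divisibility of frequencies, and a single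
  \<open>g\<close> attains the intersection that defines the essential range. The obstacle is the
  horizon. Characteristic functions give phases on each interval \<open>[0, N)\<close> separately,
  with nothing to relate them, while \<open>g\<close> needs one coboundary for all times. The remedy
  is to read the phase at time \<open>n\<close> off \<open>f\<close> itself, by averaging
  \<open>exp (\<i> \<xi> f)\<close> over the paths from \<open>x\<close> to a fixed state two steps
  later. Any admissible phases nearly determine the result up to a constant, so error bounds that
  are uniform in the horizon carry over to it. Two steps are the natural unit, because a single
  density \<open>p n\<close> may vanish while two successive ones connect all states with weight
  above \<open>\<epsilon>\<close>. Hence the comparisons of times \<open>n\<close> and
  \<open>n + 2\<close>.\<close>

lemma borel_measurable_Arg [measurable]: "Arg \<in> borel_measurable borel"
proof -
  have 1: "(\<lambda>z. indicator (- \<real>\<^sub>\<le>\<^sub>0) z *\<^sub>R Arg z) \<in> borel_measurable borel"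
    by (rule borel_measurable_continuous_on_indicator[OF _ continuous_on_Arg])
       (simp add: borel_open open_Compl closed_nonpos_Reals_complex)
  \<comment> \<open>\<open>Arg\<close> is continuous off the nonpositive reals; on them it is
    constantly \<pi>, except for the value 0 at the origin.\<close>
  have "Arg z = (if z = 0 then 0 else if z \<in> - \<real>\<^sub>\<le>\<^sub>0 then indicator (- \<real>\<^sub>\<le>\<^sub>0) z *\<^sub>R Arg z else pi)" for z :: complex
    using complex_eq_iff[of z 0] Arg_eq_pi[of z]
    by (cases "z = 0") (auto simp: complex_nonpos_Reals_iff Arg_zero)
  moreover have "(\<lambda>z::complex. (if z = 0 then 0 else if z \<in> - \<real>\<^sub>\<le>\<^sub>0 then indicator (- \<real>\<^sub>\<le>\<^sub>0) z *\<^sub>R Arg z else pi)) \<in> borel_measurable borel"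
    using 1 by (intro measurable_If) (auto simp: borel_open open_Compl closed_nonpos_Reals_complex
        simp flip: Compl_eq)
  ultimately show ?thesis by (simp cong: measurable_cong)
qed

lemma borel_measurable_cis [measurable]: "cis \<in> borel_measurable borel"
  by (intro borel_measurable_continuous_onI continuous_intros)

lemma (in finite_measure) integrable_bounded:
  fixes f :: "'a \<Rightarrow> 'b::{banach, second_countable_topology}"
  assumes "f \<in> borel_measurable M" "\<And>x. x \<in> space M \<Longrightarrow> norm (f x) \<le> C"
  shows "integrable M f"
  using assms by (intro integrable_const_bound[of _ C]) (auto intro!: AE_I2)

text \<open>
  Times are shifted to start at 0. The densities \<open>p n\<close> are bounded everywhere, not only on the state
  spaces: clipping them to \<open>[0, 1 / \<epsilon>]\<close> achieves this without changing the kernels.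
\<close>

locale elliptic_chain = prob_space P
  for P :: "'w measure" +
  fixes B :: "nat \<Rightarrow> 'a measure" and F :: "nat \<Rightarrow> 'w measure" and X :: "nat \<Rightarrow> 'w \<Rightarrow> 'a"
    and \<mu> :: "nat \<Rightarrow> 'a measure" and p :: "nat \<Rightarrow> 'a \<Rightarrow> 'a \<Rightarrow> real" and \<epsilon> :: real
  assumes subalg: "subalgebra P (F n)"
    and adapted: "i \<le> n \<Longrightarrow> X i \<in> F n \<rightarrow>\<^sub>M B i"
    and prob_mu: "prob_space (\<mu> n)"
    and sets_mu [measurable_cong, simp]: "sets (\<mu> n) = sets (B n)"
    and p_measurable: "(\<lambda>(x, y). p n x y) \<in> borel_measurable (B n \<Otimes>\<^sub>M B (Suc n))"
    and eps_pos: "0 < \<epsilon>"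
    and p_nonneg [simp]: "0 \<le> p n x y"
    and p_le: "p n x y \<le> 1 / \<epsilon>"
    and p_prob: "x \<in> space (B n) \<Longrightarrow> (\<integral>\<^sup>+ y. ennreal (p n x y) \<partial>\<mu> (Suc n)) = 1"
    and two_step: "x \<in> space (B n) \<Longrightarrow> z \<in> space (B (Suc (Suc n))) \<Longrightarrow>
      \<epsilon> < (\<integral>y. p n x y * p (Suc n) y z \<partial>\<mu> (Suc n))"
    and transition: "A \<in> sets (F n) \<Longrightarrow> E \<in> sets (B (Suc n)) \<Longrightarrow>
      emeasure P (A \<inter> X (Suc n) -` E) =
        (\<integral>\<^sup>+\<omega>. (\<integral>\<^sup>+y. ennreal (p n (X n \<omega>) y) * indicator E y \<partial>\<mu> (Suc n)) * indicator A \<omega> \<partial>P)"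
begin

sublocale mu: prob_space "\<mu> n" for n
  by (rule prob_mu)

lemma space_mu [simp]: "space (\<mu> n) = space (B n)"
  by (rule sets_eq_imp_space_eq) simp

lemma emeasure_mu_space [simp]: "emeasure (\<mu> n) (space (B n)) = 1"
  using mu.emeasure_space_1[of n] by simp

lemma space_F [simp]: "space (F n) = space P"
  using subalg[of n] by (auto simp: subalgebra_def)

lemma measurable_p [measurable (raw)]:
  "f \<in> M \<rightarrow>\<^sub>M B n \<Longrightarrow> g \<in> M \<rightarrow>\<^sub>M B (Suc n) \<Longrightarrow> (\<lambda>x. p n (f x) (g x)) \<in> borel_measurable M"
  using measurable_compose[OF measurable_Pair p_measurable[of n], of f M g] by simp

lemma measurable_X [measurable]: "X n \<in> P \<rightarrow>\<^sub>M B n"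
  using adapted[of n n] subalg[of n] by (auto intro: measurable_from_subalg)

lemma X_space [simp]: "\<omega> \<in> space P \<Longrightarrow> X n \<omega> \<in> space (B n)"
  using measurable_space[OF measurable_X] .

lemma measurable_of_F: "f \<in> F n \<rightarrow>\<^sub>M N \<Longrightarrow> f \<in> P \<rightarrow>\<^sub>M N"
  using subalg by (rule measurable_from_subalg)

lemma p_integrable: "x \<in> space (B n) \<Longrightarrow> integrable (\<mu> (Suc n)) (p n x)"
  by (intro mu.integrable_bounded[of _ _ "1 / \<epsilon>"]) (auto simp: p_le)

lemma p_integral [simp]: "x \<in> space (B n) \<Longrightarrow> (\<integral>y. p n x y \<partial>\<mu> (Suc n)) = 1"
  by (subst integral_eq_nn_integral) (auto simp: p_prob)

section \<open>Integration against the transition kernel\<close>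

lemma measurable_pair_X: "(\<lambda>\<omega>. (\<omega>, X (Suc n) \<omega>)) \<in> P \<rightarrow>\<^sub>M F n \<Otimes>\<^sub>M B (Suc n)"
proof -
  have "(\<lambda>\<omega>. \<omega>) \<in> P \<rightarrow>\<^sub>M F n"
    using subalg[of n] by (auto simp: measurable_def subalgebra_def)
  then show ?thesis by measurable
qed

text \<open>Rectangles determine the joint law, and on them the claim is the assumption
  \<open>transition\<close>. The sample point \<open>\<omega>\<close>, with the sigma-algebra
  \<open>F n\<close>, stands for the whole past, so test functions may depend on anything known at
  time \<open>n\<close>.\<close>

lemma joint_law:
  "distr P (F n \<Otimes>\<^sub>M B (Suc n)) (\<lambda>\<omega>. (\<omega>, X (Suc n) \<omega>)) =
    density (restr_to_subalg P (F n) \<Otimes>\<^sub>M \<mu> (Suc n)) (\<lambda>(\<omega>, y). ennreal (p n (X n \<omega>) y))"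
  (is "?L = ?R")
proof -
  let ?PF = "restr_to_subalg P (F n)"
  have sPF [measurable_cong]: "sets ?PF = sets (F n)" by (rule sets_restr_to_subalg[OF subalg])
  interpret PF: prob_space ?PF by (rule prob_space_restr_to_subalg[OF subalg prob_space_axioms])
  note [measurable] = adapted[of n n, simplified]
  note [measurable] = measurable_pair_X[of n]
  have eq: "emeasure ?L (A \<times> E) = emeasure ?R (A \<times> E)" if A: "A \<in> sets (F n)" and E: "E \<in> sets (B (Suc n))" for A E
  proof -
    note [measurable] = A E
    have "emeasure ?L (A \<times> E) = emeasure P (A \<inter> X (Suc n) -` E)"
      using sets.sets_into_space[OF A]
      by (subst emeasure_distr) (auto intro!: arg_cong[where f = "emeasure P"])
    also have "\<dots> = (\<integral>\<^sup>+\<omega>. (\<integral>\<^sup>+y. ennreal (p n (X n \<omega>) y) * indicator E y \<partial>\<mu> (Suc n)) * indicator A \<omega> \<partial>?PF)"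
      unfolding transition[OF A E]
      by (rule nn_integral_subalgebra2[OF subalg, symmetric]) measurable
    also have "\<dots> = (\<integral>\<^sup>+\<omega>. \<integral>\<^sup>+y. ennreal (p n (X n \<omega>) y) * indicator (A \<times> E) (\<omega>, y) \<partial>\<mu> (Suc n) \<partial>?PF)"
      by (intro nn_integral_cong) (auto simp: indicator_def intro!: nn_integral_cong)
    also have "\<dots> = emeasure ?R (A \<times> E)"
      by (subst emeasure_density, measurable, subst mu.nn_integral_fst[symmetric]) (auto intro!: nn_integral_cong)
    finally show ?thesis .
  qed
  show ?thesis
  proof (rule measure_eqI_generator_eq[where \<Omega> = "space P \<times> space (B (Suc n))"
        and E = "{A \<times> E |A E. A \<in> sets (F n) \<and> E \<in> sets (B (Suc n))}"
        and A = "\<lambda>_. space P \<times> space (B (Suc n))"])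
    show "Int_stable {A \<times> E |A E. A \<in> sets (F n) \<and> E \<in> sets (B (Suc n))}"
      by (rule Int_stable_pair_measure_generator)
    show "{A \<times> E |A E. A \<in> sets (F n) \<and> E \<in> sets (B (Suc n))} \<subseteq> Pow (space P \<times> space (B (Suc n)))"
      using pair_measure_closed[of "F n" "B (Suc n)"] by simp
    show "sets ?L = sigma_sets (space P \<times> space (B (Suc n))) {A \<times> E |A E. A \<in> sets (F n) \<and> E \<in> sets (B (Suc n))}"
      by (simp add: sets_pair_measure)
    have "sets ?R = sets (F n \<Otimes>\<^sub>M B (Suc n))"
      by (simp, intro sets_pair_measure_cong) (simp_all add: sPF)
    then show "sets ?R = sigma_sets (space P \<times> space (B (Suc n))) {A \<times> E |A E. A \<in> sets (F n) \<and> E \<in> sets (B (Suc n))}"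
      by (simp add: sets_pair_measure)
    show "range (\<lambda>_::nat. space P \<times> space (B (Suc n))) \<subseteq> {A \<times> E |A E. A \<in> sets (F n) \<and> E \<in> sets (B (Suc n))}"
      by (auto intro!: exI sets.top) (metis sets.top space_F)
    show "emeasure ?L (space P \<times> space (B (Suc n))) \<noteq> \<infinity>" for i :: nat
      using sets.top[of "F n"] by (subst emeasure_distr) (auto simp: emeasure_eq_measure)
  qed (use eq in auto)
qed

lemma nn_kernel:
  assumes [measurable]: "(\<lambda>(\<omega>, y). \<Psi> \<omega> y) \<in> borel_measurable (F n \<Otimes>\<^sub>M B (Suc n))"
  shows "(\<integral>\<^sup>+\<omega>. \<Psi> \<omega> (X (Suc n) \<omega>) \<partial>P) = (\<integral>\<^sup>+\<omega>. \<integral>\<^sup>+y. ennreal (p n (X n \<omega>) y) * \<Psi> \<omega> y \<partial>\<mu> (Suc n) \<partial>P)"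
proof -
  let ?PF = "restr_to_subalg P (F n)"
  have sPF [measurable_cong]: "sets ?PF = sets (F n)" by (rule sets_restr_to_subalg[OF subalg])
  note [measurable] = adapted[of n n, simplified]
  note [measurable] = measurable_pair_X[of n]
  have "(\<integral>\<^sup>+\<omega>. \<Psi> \<omega> (X (Suc n) \<omega>) \<partial>P) =
      (\<integral>\<^sup>+z. (case z of (\<omega>, y) \<Rightarrow> \<Psi> \<omega> y) \<partial>distr P (F n \<Otimes>\<^sub>M B (Suc n)) (\<lambda>\<omega>. (\<omega>, X (Suc n) \<omega>)))"
    by (subst nn_integral_distr) auto
  also have "\<dots> = (\<integral>\<^sup>+z. (case z of (\<omega>, y) \<Rightarrow> ennreal (p n (X n \<omega>) y)) * (case z of (\<omega>, y) \<Rightarrow> \<Psi> \<omega> y) \<partial>(?PF \<Otimes>\<^sub>M \<mu> (Suc n)))"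
    unfolding joint_law by (rule nn_integral_density) measurable
  also have "\<dots> = (\<integral>\<^sup>+\<omega>. \<integral>\<^sup>+y. ennreal (p n (X n \<omega>) y) * \<Psi> \<omega> y \<partial>\<mu> (Suc n) \<partial>?PF)"
    by (subst mu.nn_integral_fst[symmetric]) auto
  also have "\<dots> = (\<integral>\<^sup>+\<omega>. \<integral>\<^sup>+y. ennreal (p n (X n \<omega>) y) * \<Psi> \<omega> y \<partial>\<mu> (Suc n) \<partial>P)"
    by (rule nn_integral_subalgebra2[OF subalg]) measurable
  finally show ?thesis .
qed

lemma kernel:
  fixes \<Psi> :: "'w \<Rightarrow> 'a \<Rightarrow> 'b::{banach, second_countable_topology}"
  assumes [measurable]: "(\<lambda>(\<omega>, y). \<Psi> \<omega> y) \<in> borel_measurable (F n \<Otimes>\<^sub>M B (Suc n))"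
    and bdd: "\<And>\<omega> y. \<omega> \<in> space P \<Longrightarrow> y \<in> space (B (Suc n)) \<Longrightarrow> norm (\<Psi> \<omega> y) \<le> C"
  shows "(\<integral>\<omega>. \<Psi> \<omega> (X (Suc n) \<omega>) \<partial>P) = (\<integral>\<omega>. \<integral>y. p n (X n \<omega>) y *\<^sub>R \<Psi> \<omega> y \<partial>\<mu> (Suc n) \<partial>P)"
proof -
  let ?PF = "restr_to_subalg P (F n)"
  have sPF [measurable_cong]: "sets ?PF = sets (F n)" by (rule sets_restr_to_subalg[OF subalg])
  interpret PF: prob_space ?PF by (rule prob_space_restr_to_subalg[OF subalg prob_space_axioms])
  interpret Q: pair_prob_space ?PF "\<mu> (Suc n)" ..
  note [measurable] = adapted[of n n, simplified]
  note [measurable] = measurable_pair_X[of n]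
  have "(\<integral>\<omega>. \<Psi> \<omega> (X (Suc n) \<omega>) \<partial>P) =
      (\<integral>z. (case z of (\<omega>, y) \<Rightarrow> \<Psi> \<omega> y) \<partial>distr P (F n \<Otimes>\<^sub>M B (Suc n)) (\<lambda>\<omega>. (\<omega>, X (Suc n) \<omega>)))"
    by (subst integral_distr) auto
  also have "\<dots> = (\<integral>z. (case z of (\<omega>, y) \<Rightarrow> \<Psi> \<omega> y) \<partial>density (?PF \<Otimes>\<^sub>M \<mu> (Suc n)) (\<lambda>z. ennreal (case z of (\<omega>, y) \<Rightarrow> p n (X n \<omega>) y)))"
    unfolding joint_law by (simp add: case_prod_beta')
  also have "\<dots> = (\<integral>z. (case z of (\<omega>, y) \<Rightarrow> p n (X n \<omega>) y) *\<^sub>R (case z of (\<omega>, y) \<Rightarrow> \<Psi> \<omega> y) \<partial>(?PF \<Otimes>\<^sub>M \<mu> (Suc n)))"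
    by (rule integral_density) (measurable, auto)
  also have "\<dots> = (\<integral>\<omega>. \<integral>y. p n (X n \<omega>) y *\<^sub>R \<Psi> \<omega> y \<partial>\<mu> (Suc n) \<partial>?PF)"
  proof (subst Q.integral_fst'[symmetric])
    have "norm (p n (X n \<omega>) y *\<^sub>R \<Psi> \<omega> y) \<le> (1 / \<epsilon>) * C" if "\<omega> \<in> space P" "y \<in> space (B (Suc n))" for \<omega> y
      unfolding norm_scaleR using bdd[OF that] eps_pos by (intro mult_mono) (auto simp: p_le)
    then show "integrable (?PF \<Otimes>\<^sub>M \<mu> (Suc n)) (\<lambda>z. (case z of (\<omega>, y) \<Rightarrow> p n (X n \<omega>) y) *\<^sub>R (case z of (\<omega>, y) \<Rightarrow> \<Psi> \<omega> y))"
      by (intro Q.integrable_bounded[where C = "(1 / \<epsilon>) * C"]) (auto simp: space_pair_measure space_restr_to_subalg)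
  qed auto
  also have "\<dots> = (\<integral>\<omega>. \<integral>y. p n (X n \<omega>) y *\<^sub>R \<Psi> \<omega> y \<partial>\<mu> (Suc n) \<partial>P)"
    by (rule integral_subalgebra2[OF subalg]) measurable
  finally show ?thesis .
qed

text \<open>The marginal density is an average of the densities \<open>p n x\<close>, each at most
  \<open>1 / \<epsilon>\<close>. The time is \<open>Suc n\<close> because nothing relates the
  initial law to \<open>\<mu> 0\<close>.\<close>

lemma nn_law_le:
  assumes [measurable]: "\<phi> \<in> borel_measurable (B (Suc n))"
  shows "(\<integral>\<^sup>+\<omega>. \<phi> (X (Suc n) \<omega>) \<partial>P) \<le> ennreal (1 / \<epsilon>) * (\<integral>\<^sup>+y. \<phi> y \<partial>\<mu> (Suc n))"
proof -
  have "(\<integral>\<^sup>+\<omega>. \<phi> (X (Suc n) \<omega>) \<partial>P) = (\<integral>\<^sup>+\<omega>. \<integral>\<^sup>+y. ennreal (p n (X n \<omega>) y) * \<phi> y \<partial>\<mu> (Suc n) \<partial>P)"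
    by (rule nn_kernel) measurable
  also have "\<dots> \<le> (\<integral>\<^sup>+\<omega>. \<integral>\<^sup>+y. ennreal (1 / \<epsilon>) * \<phi> y \<partial>\<mu> (Suc n) \<partial>P)"
    by (intro nn_integral_mono mult_right_mono ennreal_leI p_le) auto
  also have "\<dots> = ennreal (1 / \<epsilon>) * (\<integral>\<^sup>+y. \<phi> y \<partial>\<mu> (Suc n))"
    by (subst nn_integral_cmult) (auto simp: emeasure_space_1)
  finally show ?thesis .
qed

end

text \<open>Lets any convenient constant \<open>s\<close> stand in for the mean: the value of a
  function at an independent state, a phase predicted by a coboundary, or 0.\<close>

lemma (in prob_space) variance_minimal:
  fixes Y :: "'a \<Rightarrow> 'b::euclidean_space"
  assumes [measurable]: "Y \<in> borel_measurable M" and bdd: "\<And>\<omega>. \<omega> \<in> space M \<Longrightarrow> norm (Y \<omega>) \<le> C"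
  shows "(\<integral>\<omega>. (norm (Y \<omega> - (\<integral>\<omega>'. Y \<omega>' \<partial>M)))\<^sup>2 \<partial>M) \<le> (\<integral>\<omega>. (norm (Y \<omega> - s))\<^sup>2 \<partial>M)"
proof -
  define m where "m = (\<integral>\<omega>. Y \<omega> \<partial>M)"
  have iY: "integrable M Y" by (rule integrable_bounded[OF _ bdd]) auto
  have sq: "integrable M (\<lambda>\<omega>. (norm (Y \<omega> - t))\<^sup>2)" for t
  proof (rule integrable_bounded)
    fix \<omega> assume "\<omega> \<in> space M"
    then have "norm (Y \<omega> - t) \<le> C + norm t" using bdd norm_triangle_ineq4[of "Y \<omega>" t] by fastforce
    then show "norm ((norm (Y \<omega> - t))\<^sup>2) \<le> (C + norm t)\<^sup>2" by (simp add: power_mono)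
  qed simp
  have "(\<integral>\<omega>. (norm (Y \<omega> - s))\<^sup>2 \<partial>M) = (\<integral>\<omega>. (norm (Y \<omega> - m))\<^sup>2 + 2 * ((Y \<omega> - m) \<bullet> (m - s)) + (norm (m - s))\<^sup>2 \<partial>M)"
    by (intro Bochner_Integration.integral_cong) (auto simp: power2_norm_eq_inner inner_diff inner_commute algebra_simps)
  also have "\<dots> = (\<integral>\<omega>. (norm (Y \<omega> - m))\<^sup>2 \<partial>M) + 2 * (((\<integral>\<omega>. Y \<omega> \<partial>M) - m) \<bullet> (m - s)) + (norm (m - s))\<^sup>2"
    using iY sq[of m] by (simp add: prob_space)
  finally show ?thesis by (simp add: m_def)
qed

context elliptic_chain
begin

lemma nn_kernel_pair:
  assumes [measurable]: "(\<lambda>(x, y). \<phi> x y) \<in> borel_measurable (B n \<Otimes>\<^sub>M B (Suc n))"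
  shows "(\<integral>\<^sup>+\<omega>. \<phi> (X n \<omega>) (X (Suc n) \<omega>) \<partial>P) = (\<integral>\<^sup>+\<omega>. \<integral>\<^sup>+y. ennreal (p n (X n \<omega>) y) * \<phi> (X n \<omega>) y \<partial>\<mu> (Suc n) \<partial>P)"
proof (rule nn_kernel)
  note [measurable] = adapted[of n n, simplified]
  have "(\<lambda>(x, y). \<phi> x y) \<circ> (\<lambda>(\<omega>, y). (X n \<omega>, y)) \<in> borel_measurable (F n \<Otimes>\<^sub>M B (Suc n))"
    by (intro measurable_comp[where N = "B n \<Otimes>\<^sub>M B (Suc n)"]) measurable
  then show "(\<lambda>(\<omega>, y). \<phi> (X n \<omega>) y) \<in> borel_measurable (F n \<Otimes>\<^sub>M B (Suc n))"
    by (simp add: comp_def case_prod_beta')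
qed

text \<open>Taking out what is known at time \<open>n\<close>. With \<open>G\<close> measurable for
  \<open>F n\<close> this is the orthogonality of martingale differences to the past.\<close>

lemma kernel_mult:
  fixes \<phi> :: "'a \<Rightarrow> 'a \<Rightarrow> 'b::{real_normed_field, banach, second_countable_topology}"
  assumes [measurable]: "(\<lambda>(x, y). \<phi> x y) \<in> borel_measurable (B n \<Otimes>\<^sub>M B (Suc n))" "G \<in> borel_measurable (F n)"
    and bdd: "\<And>x y. x \<in> space (B n) \<Longrightarrow> y \<in> space (B (Suc n)) \<Longrightarrow> norm (\<phi> x y) \<le> C"
      "\<And>\<omega>. \<omega> \<in> space P \<Longrightarrow> norm (G \<omega>) \<le> C'"
  shows "(\<integral>\<omega>. G \<omega> * \<phi> (X n \<omega>) (X (Suc n) \<omega>) \<partial>P) = (\<integral>\<omega>. G \<omega> * (\<integral>y. p n (X n \<omega>) y *\<^sub>R \<phi> (X n \<omega>) y \<partial>\<mu> (Suc n)) \<partial>P)"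
proof -
  note [measurable] = adapted[of n n, simplified]
  have "(\<lambda>(x, y). \<phi> x y) \<circ> (\<lambda>(\<omega>, y). (X n \<omega>, y)) \<in> borel_measurable (F n \<Otimes>\<^sub>M B (Suc n))"
    by (intro measurable_comp[where N = "B n \<Otimes>\<^sub>M B (Suc n)"]) measurable
  then have [measurable]: "(\<lambda>(\<omega>, y). \<phi> (X n \<omega>) y) \<in> borel_measurable (F n \<Otimes>\<^sub>M B (Suc n))"
    by (simp add: comp_def case_prod_beta')
  have "(\<integral>\<omega>. G \<omega> * \<phi> (X n \<omega>) (X (Suc n) \<omega>) \<partial>P) = (\<integral>\<omega>. \<integral>y. p n (X n \<omega>) y *\<^sub>R (G \<omega> * \<phi> (X n \<omega>) y) \<partial>\<mu> (Suc n) \<partial>P)"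
  proof (rule kernel[where C = "C' * C"])
    show "norm (G \<omega> * \<phi> (X n \<omega>) y) \<le> C' * C" if "\<omega> \<in> space P" "y \<in> space (B (Suc n))" for \<omega> y
      unfolding norm_mult using that order_trans[OF norm_ge_zero bdd(2)[OF that(1)]]
      by (intro mult_mono bdd) auto
  qed measurable
  also have "\<dots> = (\<integral>\<omega>. G \<omega> * (\<integral>y. p n (X n \<omega>) y *\<^sub>R \<phi> (X n \<omega>) y \<partial>\<mu> (Suc n)) \<partial>P)"
    by (simp flip: mult_scaleR_right)
  finally show ?thesis .
qed

lemma
  fixes \<phi> :: "'a \<Rightarrow> 'b::{banach, second_countable_topology}"
  assumes x: "x \<in> space (B n)" and [measurable]: "\<phi> \<in> borel_measurable (B (Suc n))"
    and bdd: "\<And>y. y \<in> space (B (Suc n)) \<Longrightarrow> norm (\<phi> y) \<le> R"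
  shows kernel_integrable: "integrable (\<mu> (Suc n)) (\<lambda>y. p n x y *\<^sub>R \<phi> y)"
    and kernel_norm_le: "norm (\<integral>y. p n x y *\<^sub>R \<phi> y \<partial>\<mu> (Suc n)) \<le> R"
proof -
  note [measurable] = x
  have le: "norm (p n x y *\<^sub>R \<phi> y) \<le> p n x y * R" if "y \<in> space (B (Suc n))" for y
    using bdd[OF that] by (auto intro!: mult_left_mono)
  have i: "integrable (\<mu> (Suc n)) (\<lambda>y. p n x y * R)"
    using p_integrable[OF x] by simp
  show *: "integrable (\<mu> (Suc n)) (\<lambda>y. p n x y *\<^sub>R \<phi> y)"
    using le by (intro Bochner_Integration.integrable_bound[OF i]) (auto intro!: AE_I2 order_trans[OF _ abs_ge_self])
  have "norm (\<integral>y. p n x y *\<^sub>R \<phi> y \<partial>\<mu> (Suc n)) \<le> (\<integral>y. p n x y * R \<partial>\<mu> (Suc n))"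
    by (rule order_trans[OF integral_norm_bound integral_mono[OF integrable_norm[OF *] i]]) (use le in auto)
  also have "\<dots> = R" using x by simp
  finally show "norm (\<integral>y. p n x y *\<^sub>R \<phi> y \<partial>\<mu> (Suc n)) \<le> R" .
qed

text \<open>
  Backward recursions \<open>u n = E (\<Phi> n (X n) (X (n + 1)) (u (n + 1)) | X n)\<close> with horizon \<open>N\<close>; they produce the
  martingales behind both the variance bound and the lower bound for the characteristic function.
\<close>

lemma backward_solution:
  fixes \<Phi> :: "nat \<Rightarrow> 'a \<Rightarrow> 'a \<Rightarrow> 'b \<Rightarrow> 'b::{banach, second_countable_topology}"
  assumes meas: "\<And>n u. u \<in> borel_measurable (B (Suc n)) \<Longrightarrow> (\<lambda>(x, y). \<Phi> n x y (u y)) \<in> borel_measurable (B n \<Otimes>\<^sub>M B (Suc n))"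
    and terminal: "\<And>n x y. N \<le> n \<Longrightarrow> \<Phi> n x y c = c"
    and c: "\<And>n. norm c \<le> R n"
    and bdd: "\<And>n x y s. x \<in> space (B n) \<Longrightarrow> y \<in> space (B (Suc n)) \<Longrightarrow> norm s \<le> R (Suc n) \<Longrightarrow> norm (\<Phi> n x y s) \<le> R n"
  obtains u where "\<And>n. u n \<in> borel_measurable (B n)" "\<And>n x. N \<le> n \<Longrightarrow> u n x = c"
    "\<And>n x. x \<in> space (B n) \<Longrightarrow> norm (u n x) \<le> R n"
    "\<And>n x. x \<in> space (B n) \<Longrightarrow> u n x = (\<integral>y. p n x y *\<^sub>R \<Phi> n x y (u (Suc n) y) \<partial>\<mu> (Suc n))"
proof -
  \<comment> \<open>The recursion runs on the number \<open>k\<close> of steps left to the horizon,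
    simultaneously for all times \<open>n\<close>; this turns a backward recursion into a primitive
    one.\<close>
  define v where "v = rec_nat (\<lambda>(n::nat) (x::'a). c) (\<lambda>k w n x. \<integral>y. p n x y *\<^sub>R \<Phi> n x y (w (Suc n) y) \<partial>\<mu> (Suc n))"
  have v0: "v 0 n x = c" for n x by (simp add: v_def)
  have vS: "v (Suc k) n x = (\<integral>y. p n x y *\<^sub>R \<Phi> n x y (v k (Suc n) y) \<partial>\<mu> (Suc n))" for k n x by (simp add: v_def)
  have vm: "v k n \<in> borel_measurable (B n)" for k n
  proof (induction k arbitrary: n)
    case (Suc k)
    note [measurable] = meas[OF Suc]
    show ?case unfolding vS by measurable
  qed (simp add: v_def)
  have vb: "norm (v k n x) \<le> R n" if "x \<in> space (B n)" for k n x
    using that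
  proof (induction k arbitrary: n x)
    case (Suc k)
    note [measurable] = meas[OF vm[of k "Suc n"]] Suc.prems
    show ?case unfolding vS using Suc by (intro kernel_norm_le bdd) auto
  qed (simp add: v0 c)
  \<comment> \<open>Truncated subtraction makes \<open>u n\<close> the terminal value
    \<open>c\<close> at all times from \<open>N\<close> on.\<close>
  define u where "u n = v (N - n) n" for n
  show ?thesis
  proof (rule that[of u])
    show "u n x = (\<integral>y. p n x y *\<^sub>R \<Phi> n x y (u (Suc n) y) \<partial>\<mu> (Suc n))" if x: "x \<in> space (B n)" for n x
    proof (cases "n < N")
      case True
      then show ?thesis by (simp add: u_def vS Suc_diff_Suc[symmetric])
    next
      case False
      then show ?thesis using x by (simp add: u_def v0 terminal integral_scaleR_left p_integrable)
    qed
  qed (auto simp: u_def vm vb v0)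
qed

text \<open>
  Ellipticity dominates \<open>\<mu> (n + 2)\<close> by the two-step kernel, so an independent copy of \<open>X (n + 2)\<close> can be
  replaced by \<open>X (n + 2)\<close> itself at the price of a factor \<open>1 / \<epsilon>\<close>.
\<close>

lemma two_step_poincare:
  fixes \<phi> \<psi> :: "'a \<Rightarrow> real"
  assumes [measurable]: "\<phi> \<in> borel_measurable (B n)" "\<psi> \<in> borel_measurable (B (Suc (Suc n)))"
    and bdd: "\<And>x. x \<in> space (B n) \<Longrightarrow> \<bar>\<phi> x\<bar> \<le> C" "\<And>x. x \<in> space (B (Suc (Suc n))) \<Longrightarrow> \<bar>\<psi> x\<bar> \<le> C"
  shows "(\<integral>\<omega>. (\<phi> (X n \<omega>) - (\<integral>\<omega>'. \<phi> (X n \<omega>') \<partial>P))\<^sup>2 \<partial>P) \<le> (1 / \<epsilon>) * (\<integral>\<omega>. (\<phi> (X n \<omega>) - \<psi> (X (Suc (Suc n)) \<omega>))\<^sup>2 \<partial>P)"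
    (is "?V \<le> (1 / \<epsilon>) * ?W")
proof -
  interpret Q: pair_prob_space P "\<mu> (Suc (Suc n))" ..
  note [measurable] = adapted[of n n, simplified] adapted[of n "Suc n", simplified]
  let ?d = "\<lambda>x z. ennreal ((\<phi> x - \<psi> z)\<^sup>2)"
  have sqb: "norm ((\<phi> x - \<psi> z)\<^sup>2) \<le> (2 * C)\<^sup>2" if "x \<in> space (B n)" "z \<in> space (B (Suc (Suc n)))" for x z
    using power_mono[of "\<bar>\<phi> x - \<psi> z\<bar>" "2 * C" 2] bdd(1)[OF that(1)] bdd(2)[OF that(2)] by fastforce
  \<comment> \<open>Each value \<open>\<psi> z\<close> competes with the mean of
    \<open>\<phi> (X n)\<close>, so the variance is at most the mean square distance to
    \<open>\<psi> z\<close>, averaged over an independent \<open>z\<close> with law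
    \<open>\<mu> (Suc (Suc n))\<close>.\<close>
  have "ennreal ?V = (\<integral>\<^sup>+z. ennreal ?V \<partial>\<mu> (Suc (Suc n)))"
    by simp
  also have "\<dots> \<le> (\<integral>\<^sup>+z. \<integral>\<^sup>+\<omega>. ?d (X n \<omega>) z \<partial>P \<partial>\<mu> (Suc (Suc n)))"
  proof (rule nn_integral_mono)
    fix z assume z: "z \<in> space (\<mu> (Suc (Suc n)))"
    have "?V \<le> (\<integral>\<omega>. (\<phi> (X n \<omega>) - \<psi> z)\<^sup>2 \<partial>P)"
      using variance_minimal[of "\<lambda>\<omega>. \<phi> (X n \<omega>)" C "\<psi> z"] bdd by simp
    also have "ennreal \<dots> = (\<integral>\<^sup>+\<omega>. ?d (X n \<omega>) z \<partial>P)"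
      using z by (intro nn_integral_eq_integral[symmetric] integrable_bounded[OF _ sqb]) auto
    finally show "ennreal ?V \<le> (\<integral>\<^sup>+\<omega>. ?d (X n \<omega>) z \<partial>P)" by (simp add: ennreal_leI)
  qed
  also have "\<dots> = (\<integral>\<^sup>+\<omega>. \<integral>\<^sup>+z. ?d (X n \<omega>) z \<partial>\<mu> (Suc (Suc n)) \<partial>P)"
    by (rule Q.Fubini') measurable
  finally have "ennreal \<epsilon> * ennreal ?V \<le> ennreal \<epsilon> * (\<integral>\<^sup>+\<omega>. \<integral>\<^sup>+z. ?d (X n \<omega>) z \<partial>\<mu> (Suc (Suc n)) \<partial>P)"
    by (rule mult_left_mono) simp
  also have "\<dots> = (\<integral>\<^sup>+\<omega>. \<integral>\<^sup>+z. ennreal \<epsilon> * ?d (X n \<omega>) z \<partial>\<mu> (Suc (Suc n)) \<partial>P)"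
    by (simp add: nn_integral_cmult)
  \<comment> \<open>\<open>\<epsilon>\<close> gives way to the two-step density, written as an
    integral over the intermediate state \<open>w\<close>. The factors are nested so that
    \<open>nn_kernel\<close> can undo one transition at a time.\<close>
  also have "\<dots> \<le> (\<integral>\<^sup>+\<omega>. \<integral>\<^sup>+z. \<integral>\<^sup>+w. ennreal (p n (X n \<omega>) w) * (ennreal (p (Suc n) w z) * ?d (X n \<omega>) z) \<partial>\<mu> (Suc n) \<partial>\<mu> (Suc (Suc n)) \<partial>P)"
  proof (intro nn_integral_mono)
    fix \<omega> z assume "\<omega> \<in> space P" and "z \<in> space (\<mu> (Suc (Suc n)))"
    then have xz [measurable]: "X n \<omega> \<in> space (B n)" "z \<in> space (B (Suc (Suc n)))" by auto
    have le: "norm (p n (X n \<omega>) w * p (Suc n) w z) \<le> (1 / \<epsilon>) * (1 / \<epsilon>)" for w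
      using eps_pos by (simp add: mult_mono p_le abs_mult del: times_divide_eq_left times_divide_eq_right)
    have "ennreal \<epsilon> \<le> ennreal (\<integral>w. p n (X n \<omega>) w * p (Suc n) w z \<partial>\<mu> (Suc n))"
      using two_step[OF xz] by (intro ennreal_leI) auto
    also have "\<dots> = (\<integral>\<^sup>+w. ennreal (p n (X n \<omega>) w) * ennreal (p (Suc n) w z) \<partial>\<mu> (Suc n))"
      unfolding ennreal_mult[OF p_nonneg p_nonneg, symmetric]
      by (intro nn_integral_eq_integral[symmetric] mu.integrable_bounded[OF _ le]) auto
    finally have "ennreal \<epsilon> * ?d (X n \<omega>) z \<le> (\<integral>\<^sup>+w. ennreal (p n (X n \<omega>) w) * ennreal (p (Suc n) w z) \<partial>\<mu> (Suc n)) * ?d (X n \<omega>) z"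
      by (rule mult_right_mono) simp
    also have "\<dots> = (\<integral>\<^sup>+w. ennreal (p n (X n \<omega>) w) * (ennreal (p (Suc n) w z) * ?d (X n \<omega>) z) \<partial>\<mu> (Suc n))"
      by (subst nn_integral_multc[symmetric]) (auto simp: mult.assoc)
    finally show "ennreal \<epsilon> * ?d (X n \<omega>) z \<le> \<dots>" .
  qed
  also have "\<dots> = (\<integral>\<^sup>+\<omega>. \<integral>\<^sup>+w. \<integral>\<^sup>+z. ennreal (p n (X n \<omega>) w) * (ennreal (p (Suc n) w z) * ?d (X n \<omega>) z) \<partial>\<mu> (Suc (Suc n)) \<partial>\<mu> (Suc n) \<partial>P)"
  proof (rule nn_integral_cong)
    fix \<omega> assume "\<omega> \<in> space P"
    then have [measurable]: "X n \<omega> \<in> space (B n)" by simp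
    interpret R: pair_prob_space "\<mu> (Suc n)" "\<mu> (Suc (Suc n))" ..
    show "(\<integral>\<^sup>+z. \<integral>\<^sup>+w. ennreal (p n (X n \<omega>) w) * (ennreal (p (Suc n) w z) * ?d (X n \<omega>) z) \<partial>\<mu> (Suc n) \<partial>\<mu> (Suc (Suc n))) =
        (\<integral>\<^sup>+w. \<integral>\<^sup>+z. ennreal (p n (X n \<omega>) w) * (ennreal (p (Suc n) w z) * ?d (X n \<omega>) z) \<partial>\<mu> (Suc (Suc n)) \<partial>\<mu> (Suc n))"
      by (rule R.Fubini') measurable
  qed
  also have "\<dots> = (\<integral>\<^sup>+\<omega>. \<integral>\<^sup>+w. ennreal (p n (X n \<omega>) w) * (\<integral>\<^sup>+z. ennreal (p (Suc n) w z) * ?d (X n \<omega>) z \<partial>\<mu> (Suc (Suc n))) \<partial>\<mu> (Suc n) \<partial>P)"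
  proof (intro nn_integral_cong)
    fix \<omega> w assume "\<omega> \<in> space P" "w \<in> space (\<mu> (Suc n))"
    then have [measurable]: "X n \<omega> \<in> space (B n)" "w \<in> space (B (Suc n))" by auto
    show "(\<integral>\<^sup>+z. ennreal (p n (X n \<omega>) w) * (ennreal (p (Suc n) w z) * ?d (X n \<omega>) z) \<partial>\<mu> (Suc (Suc n))) =
       ennreal (p n (X n \<omega>) w) * (\<integral>\<^sup>+z. ennreal (p (Suc n) w z) * ?d (X n \<omega>) z \<partial>\<mu> (Suc (Suc n)))"
      by (rule nn_integral_cmult) measurable
  qed
  also have "\<dots> = (\<integral>\<^sup>+\<omega>. (\<integral>\<^sup>+z. ennreal (p (Suc n) (X (Suc n) \<omega>) z) * ?d (X n \<omega>) z \<partial>\<mu> (Suc (Suc n))) \<partial>P)"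
    by (rule nn_kernel[symmetric]) measurable
  also have "\<dots> = (\<integral>\<^sup>+\<omega>. ?d (X n \<omega>) (X (Suc (Suc n)) \<omega>) \<partial>P)"
    by (rule nn_kernel[symmetric]) measurable
  also have "\<dots> = ennreal ?W"
    by (intro nn_integral_eq_integral integrable_bounded[OF _ sqb]) auto
  finally have "\<epsilon> * ?V \<le> ?W"
    using eps_pos by (simp add: ennreal_mult[symmetric] ennreal_le_iff)
  then show ?thesis using eps_pos by (simp add: field_simps)
qed

end

section \<open>Variance of additive functionals\<close>

lemma measurable_comp_pair:
  "(\<lambda>(x, y). h x y) \<in> M1 \<Otimes>\<^sub>M M2 \<rightarrow>\<^sub>M N \<Longrightarrow> f \<in> M \<rightarrow>\<^sub>M M1 \<Longrightarrow> g \<in> M \<rightarrow>\<^sub>M M2 \<Longrightarrow> (\<lambda>x. h (f x) (g x)) \<in> M \<rightarrow>\<^sub>M N"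
  using measurable_compose[of "\<lambda>x. (f x, g x)" M "M1 \<Otimes>\<^sub>M M2" "\<lambda>(x, y). h x y"] by simp

section \<open>Bounded measurable functions\<close>

definition bounded_measurable :: "'w measure \<Rightarrow> ('w \<Rightarrow> 'b::real_normed_vector) \<Rightarrow> bool" where
  "bounded_measurable M f \<longleftrightarrow> f \<in> borel_measurable M \<and> (\<exists>C. \<forall>\<omega>\<in>space M. norm (f \<omega>) \<le> C)"

lemma bounded_measurableI:
  "f \<in> borel_measurable M \<Longrightarrow> (\<And>\<omega>. \<omega> \<in> space M \<Longrightarrow> norm (f \<omega>) \<le> C) \<Longrightarrow> bounded_measurable M f"
  by (auto simp: bounded_measurable_def)

lemma bounded_measurable_const [intro, simp]: "bounded_measurable M (\<lambda>_. c)"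
  by (rule bounded_measurableI[of _ _ "norm c"]) auto

lemma bounded_measurable_add [intro]:
  fixes f g :: "'w \<Rightarrow> 'b::{real_normed_vector, second_countable_topology}"
  assumes "bounded_measurable M f" "bounded_measurable M g"
  shows "bounded_measurable M (\<lambda>\<omega>. f \<omega> + g \<omega>)"
proof -
  from assms obtain C D where [measurable]: "f \<in> borel_measurable M" "g \<in> borel_measurable M"
    and "\<forall>\<omega>\<in>space M. norm (f \<omega>) \<le> C" "\<forall>\<omega>\<in>space M. norm (g \<omega>) \<le> D" by (auto simp: bounded_measurable_def)
  then show ?thesis by (intro bounded_measurableI[of _ _ "C + D"]) (auto intro: norm_triangle_le add_mono)
qed

lemma bounded_measurable_mult [intro]:
  fixes f g :: "'w \<Rightarrow> 'b::{real_normed_field, second_countable_topology}"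
  assumes "bounded_measurable M f" "bounded_measurable M g"
  shows "bounded_measurable M (\<lambda>\<omega>. f \<omega> * g \<omega>)"
proof -
  from assms obtain C D where [measurable]: "f \<in> borel_measurable M" "g \<in> borel_measurable M"
    and b: "\<forall>\<omega>\<in>space M. norm (f \<omega>) \<le> C" "\<forall>\<omega>\<in>space M. norm (g \<omega>) \<le> D" by (auto simp: bounded_measurable_def)
  have "norm (f \<omega> * g \<omega>) \<le> C * D" if "\<omega> \<in> space M" for \<omega>
    unfolding norm_mult using b that order_trans[OF norm_ge_zero, of "f \<omega>" C] by (intro mult_mono) auto
  then show ?thesis by (intro bounded_measurableI[of _ _ "C * D"]) auto
qed

lemma bounded_measurable_diff [intro]:
  fixes f g :: "'w \<Rightarrow> 'b::{real_normed_field, second_countable_topology}"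
  assumes "bounded_measurable M f" "bounded_measurable M g"
  shows "bounded_measurable M (\<lambda>\<omega>. f \<omega> - g \<omega>)"
  using bounded_measurable_add[OF assms(1) bounded_measurable_mult[OF bounded_measurable_const[of M "-1"] assms(2)]] by simp

lemma bounded_measurable_power2 [intro]:
  fixes f :: "'w \<Rightarrow> 'b::{real_normed_field, second_countable_topology}"
  shows "bounded_measurable M f \<Longrightarrow> bounded_measurable M (\<lambda>\<omega>. (f \<omega>)\<^sup>2)"
  unfolding power2_eq_square by (rule bounded_measurable_mult)

lemma bounded_measurable_norm [intro]:
  fixes f :: "'w \<Rightarrow> 'b::{real_normed_vector, second_countable_topology}"
  shows "bounded_measurable M f \<Longrightarrow> bounded_measurable M (\<lambda>\<omega>. norm (f \<omega>))"
  by (auto simp: bounded_measurable_def)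

lemma bounded_measurable_cnj [intro]: "bounded_measurable M f \<Longrightarrow> bounded_measurable M (\<lambda>\<omega>. cnj (f \<omega>))"
  by (auto simp: bounded_measurable_def intro: borel_measurable_continuous_onI continuous_intros
      intro!: measurable_compose[of f M borel cnj borel])

lemma bounded_measurable_sum [intro]:
  fixes f :: "'i \<Rightarrow> 'w \<Rightarrow> 'b::{real_normed_vector, second_countable_topology}"
  assumes "\<And>i. i \<in> I \<Longrightarrow> bounded_measurable M (f i)"
  shows "bounded_measurable M (\<lambda>\<omega>. \<Sum>i\<in>I. f i \<omega>)"
  using assms by (induction I rule: infinite_finite_induct) auto

lemmas bounded_measurable_intros = bounded_measurable_const bounded_measurable_add bounded_measurable_diff
  bounded_measurable_mult bounded_measurable_power2 bounded_measurable_norm bounded_measurable_cnj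

lemma (in finite_measure) integrable_bounded_measurable [intro]:
  fixes f :: "'a \<Rightarrow> 'b::{banach, second_countable_topology}"
  shows "bounded_measurable M f \<Longrightarrow> integrable M f"
  by (auto simp: bounded_measurable_def intro: integrable_bounded)

context elliptic_chain
begin

text \<open>
  With \<open>b n = E (\<Sum>k\<ge>n. h k | X n)\<close> for centred \<open>h\<close>, the increments \<open>D n = h n + b (n + 1) - b n\<close> are martingale
  differences, so the variance is \<open>V = E (b 0)\<^sup>2 + \<Sum> E (D n)\<^sup>2 = \<Sum> E (h n)\<^sup>2 + 2 \<Sum> E (h n * b (n + 1))\<close>. By the two-step
  Poincare inequality \<open>\<Sum> E (b n)\<^sup>2\<close> is bounded by a multiple of \<open>V + \<Sum> E (h n)\<^sup>2\<close>, and the product term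
  is absorbed.
\<close>

theorem variance_partial_sum:
  fixes h :: "nat \<Rightarrow> 'a \<Rightarrow> 'a \<Rightarrow> real"
  assumes meas: "\<And>n. (\<lambda>(x, y). h n x y) \<in> borel_measurable (B n \<Otimes>\<^sub>M B (Suc n))"
    and bdd: "\<And>n x y. x \<in> space (B n) \<Longrightarrow> y \<in> space (B (Suc n)) \<Longrightarrow> \<bar>h n x y\<bar> \<le> C"
  defines "T \<equiv> \<lambda>N \<omega>. \<Sum>n<N. h n (X n \<omega>) (X (Suc n) \<omega>)"
  shows "(\<integral>\<omega>. (T N \<omega> - (\<integral>\<omega>'. T N \<omega>' \<partial>P))\<^sup>2 \<partial>P) \<le> (3 + 32 / \<epsilon>) * (\<Sum>n<N. \<integral>\<omega>. (h n (X n \<omega>) (X (Suc n) \<omega>))\<^sup>2 \<partial>P)"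
proof -
  note [measurable (raw)] = measurable_comp_pair[OF meas]
  define h' where "h' n \<omega> = h n (X n \<omega>) (X (Suc n) \<omega>)" for n \<omega>
  have bh': "bounded_measurable P (h' n)" for n
    unfolding h'_def by (rule bounded_measurableI[of _ _ C]) (auto simp: bdd)
  define e where "e n = (\<integral>\<omega>. h' n \<omega> \<partial>P)" for n
  obtain \<omega>0 where \<omega>0: "\<omega>0 \<in> space P" using not_empty by blast
  have C0: "0 \<le> C" using bdd[OF X_space[OF \<omega>0, of 0] X_space[OF \<omega>0, of "Suc 0"]] by simp
  have e_le: "\<bar>e n\<bar> \<le> C" for n
  proof -
    have "norm (e n) \<le> (\<integral>\<omega>. norm (h' n \<omega>) \<partial>P)" unfolding e_def by (rule integral_norm_bound)
    also have "\<dots> \<le> (\<integral>\<omega>. C \<partial>P)" by (intro integral_mono integrable_bounded_measurable bounded_measurable_norm bh') (auto simp: h'_def bdd)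
    finally show ?thesis by (simp add: prob_space)
  qed
  \<comment> \<open>Centred, and zero from the horizon on, so that its conditional future sums
    \<open>b\<close> vanish there.\<close>
  define hc where "hc n x y = (if n < N then h n x y - e n else 0)" for n x y
  have hc_meas [measurable]: "(\<lambda>(x, y). hc n x y) \<in> borel_measurable (B n \<Otimes>\<^sub>M B (Suc n))" for n
    unfolding hc_def by measurable
  note [measurable (raw)] = measurable_comp_pair[OF hc_meas]
  have hc_le: "\<bar>hc n x y\<bar> \<le> 2 * C" if "x \<in> space (B n)" "y \<in> space (B (Suc n))" for n x y
    using bdd[OF that] e_le[of n] C0 by (auto simp: hc_def)
  obtain b where b_meas [measurable]: "\<And>n. b n \<in> borel_measurable (B n)" and b_end: "\<And>n x. N \<le> n \<Longrightarrow> b n x = 0"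
    and b_le: "\<And>n x. x \<in> space (B n) \<Longrightarrow> norm (b n x) \<le> real (N - n) * (2 * C)"
    and b_eq: "\<And>n x. x \<in> space (B n) \<Longrightarrow> b n x = (\<integral>y. p n x y *\<^sub>R (hc n x y + b (Suc n) y) \<partial>\<mu> (Suc n))"
  \<comment> \<open>This bound grows with the number of remaining steps. It only secures
    integrability and does not enter the final constant.\<close>
  proof (rule backward_solution[of "\<lambda>n x y s. hc n x y + s" N 0 "\<lambda>n. real (N - n) * (2 * C)"])
    fix n x y and s :: real
    assume a: "x \<in> space (B n)" "y \<in> space (B (Suc n))" "norm s \<le> real (N - Suc n) * (2 * C)"
    show "norm (hc n x y + s) \<le> real (N - n) * (2 * C)"
    proof (cases "n < N")
      case True
      have "norm (hc n x y + s) \<le> 2 * C + real (N - Suc n) * (2 * C)" using hc_le[OF a(1,2)] a(3) by simp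
      also have "\<dots> = real (Suc (N - Suc n)) * (2 * C)" by (simp only: of_nat_Suc) (simp add: algebra_simps)
      finally show ?thesis using True by (simp add: Suc_diff_Suc)
    qed (use a(3) in \<open>simp add: hc_def\<close>)
  qed (use C0 in \<open>auto simp: hc_def\<close>)
  define H where "H n \<omega> = hc n (X n \<omega>) (X (Suc n) \<omega>)" for n \<omega>
  define Y where "Y n \<omega> = b n (X n \<omega>)" for n \<omega>
  have bH: "bounded_measurable P (H n)" for n
    unfolding H_def by (rule bounded_measurableI[of _ _ "2 * C"]) (auto simp: hc_le)
  have bY: "bounded_measurable P (Y n)" for n
    unfolding Y_def by (rule bounded_measurableI[of _ _ "real (N - n) * (2 * C)"]) (use b_le in auto)
  have mart: "(\<integral>\<omega>. G \<omega> * (H n \<omega> + Y (Suc n) \<omega>) \<partial>P) = (\<integral>\<omega>. G \<omega> * Y n \<omega> \<partial>P)"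
    if "G \<in> borel_measurable (F n)" "bounded_measurable P G" for G n
  proof -
    from that(2) obtain C' where C': "\<And>\<omega>. \<omega> \<in> space P \<Longrightarrow> norm (G \<omega>) \<le> C'" by (auto simp: bounded_measurable_def)
    have "(\<integral>\<omega>. G \<omega> * (H n \<omega> + Y (Suc n) \<omega>) \<partial>P) =
      (\<integral>\<omega>. G \<omega> * (\<integral>y. p n (X n \<omega>) y *\<^sub>R (hc n (X n \<omega>) y + b (Suc n) y) \<partial>\<mu> (Suc n)) \<partial>P)"
      unfolding H_def Y_def
    proof (rule kernel_mult[where C = "2 * C + real (N - Suc n) * (2 * C)" and C' = C'])
      show "norm (hc n x y + b (Suc n) y) \<le> 2 * C + real (N - Suc n) * (2 * C)"
        if "x \<in> space (B n)" "y \<in> space (B (Suc n))" for x y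
        using hc_le[OF that] b_le[OF that(2)] by simp
    qed (use that(1) C' in measurable)
    also have "\<dots> = (\<integral>\<omega>. G \<omega> * Y n \<omega> \<partial>P)"
      unfolding Y_def by (intro Bochner_Integration.integral_cong) (auto simp: b_eq)
    finally show ?thesis .
  qed
  have EH: "(\<integral>\<omega>. H n \<omega> \<partial>P) = 0" for n
  proof (cases "n < N")
    case True
    then have "(\<integral>\<omega>. H n \<omega> \<partial>P) = (\<integral>\<omega>. h' n \<omega> - e n \<partial>P)" by (simp add: H_def hc_def h'_def)
    also have "\<dots> = 0" using integrable_bounded_measurable[OF bh'] by (simp add: e_def prob_space)
    finally show ?thesis .
  qed (simp add: H_def hc_def)
  have EY: "(\<integral>\<omega>. Y n \<omega> \<partial>P) = 0" for n
  proof (cases "n \<le> N")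
    case True
    then show ?thesis
    proof (induction rule: inc_induct)
      case (step k)
      then show ?case using mart[of "\<lambda>_. 1" k] EH[of k] bH[of k] bY[of "Suc k"]
        by (simp add: integrable_bounded_measurable)
    qed (simp add: Y_def b_end)
  qed (simp add: Y_def b_end)
  define D where "D n \<omega> = H n \<omega> + Y (Suc n) \<omega> - Y n \<omega>" for n \<omega>
  have bD: "bounded_measurable P (D n)" for n unfolding D_def by (intro bounded_measurable_diff bounded_measurable_add bH bY)
  define s where "s n = (\<integral>\<omega>. (Y n \<omega>)\<^sup>2 \<partial>P)" for n
  define a where "a n = (\<integral>\<omega>. (H n \<omega>)\<^sup>2 \<partial>P)" for n
  define d where "d n = (\<integral>\<omega>. (D n \<omega>)\<^sup>2 \<partial>P)" for n
  define c where "c n = (\<integral>\<omega>. H n \<omega> * Y (Suc n) \<omega> \<partial>P)" for n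
  have nonneg: "0 \<le> s n" "0 \<le> a n" "0 \<le> d n" for n by (simp_all add: s_def a_def d_def)
  note ints = integrable_bounded_measurable bounded_measurable_intros bH bY bD
  have [simp]: "integrable P (\<lambda>\<omega>. (H n \<omega>)\<^sup>2)" "integrable P (\<lambda>\<omega>. (Y n \<omega>)\<^sup>2)" "integrable P (\<lambda>\<omega>. (D n \<omega>)\<^sup>2)"
    "integrable P (\<lambda>\<omega>. H n \<omega> * Y m \<omega>)" "integrable P (\<lambda>\<omega>. Y n \<omega> * (H n \<omega> + Y m \<omega>))"
    "integrable P (\<lambda>\<omega>. (Y n \<omega> - Y m \<omega>)\<^sup>2)" for n m
    by (intro ints bounded_measurable_diff)+
  have YF [measurable]: "Y n \<in> borel_measurable (F n)" for n
    unfolding Y_def by (rule measurable_compose[OF adapted]) auto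
  have d_eq: "d n = a n + 2 * c n + s (Suc n) - s n" for n
  proof -
    have "d n = (\<integral>\<omega>. (H n \<omega>)\<^sup>2 + 2 * (H n \<omega> * Y (Suc n) \<omega>) + (Y (Suc n) \<omega>)\<^sup>2
        - 2 * (Y n \<omega> * (H n \<omega> + Y (Suc n) \<omega>)) + (Y n \<omega>)\<^sup>2 \<partial>P)"
      unfolding d_def D_def by (intro Bochner_Integration.integral_cong) (auto simp: power2_eq_square algebra_simps)
    also have "\<dots> = a n + 2 * c n + s (Suc n) - 2 * (\<integral>\<omega>. Y n \<omega> * (H n \<omega> + Y (Suc n) \<omega>) \<partial>P) + s n"
      unfolding a_def c_def s_def
      by simp
    also have "(\<integral>\<omega>. Y n \<omega> * (H n \<omega> + Y (Suc n) \<omega>) \<partial>P) = s n"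
      unfolding mart[OF YF bY] s_def by (simp add: power2_eq_square)
    finally show ?thesis by simp
  qed
  \<comment> \<open>\<open>W\<close> is the martingale with increments \<open>D\<close>. It starts
    at \<open>Y 0\<close>, and at time \<open>N\<close>, where \<open>Y\<close> vanishes, it is the
    centred sum.\<close>
  define W where "W n \<omega> = (\<Sum>k<n. H k \<omega>) + Y n \<omega>" for n \<omega>
  have bW: "bounded_measurable P (W n)" for n unfolding W_def by (intro bounded_measurable_add bounded_measurable_sum bH bY)
  have [simp]: "integrable P (\<lambda>\<omega>. (W n \<omega>)\<^sup>2)" "integrable P (\<lambda>\<omega>. W n \<omega> * Y n \<omega>)"
    "integrable P (\<lambda>\<omega>. W n \<omega> * (H n \<omega> + Y m \<omega>))" for n m
    by (intro ints bW)+
  have WF [measurable]: "W n \<in> borel_measurable (F n)" for n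
  proof -
    have "H k \<in> borel_measurable (F n)" if "k < n" for k
      unfolding H_def using that by (intro measurable_comp_pair[OF hc_meas] adapted) auto
    then show ?thesis unfolding W_def by (intro borel_measurable_add borel_measurable_sum YF) auto
  qed
  have W_step: "(\<integral>\<omega>. (W (Suc n) \<omega>)\<^sup>2 \<partial>P) = (\<integral>\<omega>. (W n \<omega>)\<^sup>2 \<partial>P) + d n" for n
  proof -
    have "(\<integral>\<omega>. (W (Suc n) \<omega>)\<^sup>2 \<partial>P) = (\<integral>\<omega>. (W n \<omega>)\<^sup>2 + (D n \<omega>)\<^sup>2 + 2 * (W n \<omega> * (H n \<omega> + Y (Suc n) \<omega>)) - 2 * (W n \<omega> * Y n \<omega>) \<partial>P)"
      by (intro Bochner_Integration.integral_cong) (auto simp: W_def D_def power2_eq_square algebra_simps)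
    also have "\<dots> = (\<integral>\<omega>. (W n \<omega>)\<^sup>2 \<partial>P) + d n + 2 * (\<integral>\<omega>. W n \<omega> * (H n \<omega> + Y (Suc n) \<omega>) \<partial>P) - 2 * (\<integral>\<omega>. W n \<omega> * Y n \<omega> \<partial>P)"
      unfolding d_def
      by simp
    finally show ?thesis by (simp add: mart[OF WF bW])
  qed
  have W_eq: "(\<integral>\<omega>. (W n \<omega>)\<^sup>2 \<partial>P) = s 0 + (\<Sum>k<n. d k)" for n
    by (induction n) (simp_all add: W_step, simp add: W_def s_def)
  \<comment> \<open>By definition of \<open>D\<close>,
    \<open>Y n - Y (n + 2) = H n + H (n + 1) - D n - D (n + 1)\<close>; the factor 4 comes from the
    square of a sum of four terms.\<close>
  have s_le: "s n \<le> (4 / \<epsilon>) * (a n + a (Suc n) + d n + d (Suc n))" for n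
  proof -
    have "s n \<le> (1 / \<epsilon>) * (\<integral>\<omega>. (Y n \<omega> - Y (Suc (Suc n)) \<omega>)\<^sup>2 \<partial>P)"
      using two_step_poincare[of "b n" n "b (Suc (Suc n))" "real N * (2 * C)"] EY[of n]
        order_trans[OF b_le[unfolded real_norm_def] mult_right_mono[of "real (N - n)" "real N" "2 * C" for n]] C0
      by (simp add: Y_def s_def)
    also have "(\<integral>\<omega>. (Y n \<omega> - Y (Suc (Suc n)) \<omega>)\<^sup>2 \<partial>P) \<le>
        (\<integral>\<omega>. 4 * ((H n \<omega>)\<^sup>2 + (H (Suc n) \<omega>)\<^sup>2 + (D n \<omega>)\<^sup>2 + (D (Suc n) \<omega>)\<^sup>2) \<partial>P)"
    proof (rule integral_mono)
      have four: "(u + v - w - z)\<^sup>2 \<le> 4 * (u\<^sup>2 + v\<^sup>2 + w\<^sup>2 + z\<^sup>2)" for u v w z :: real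
      proof -
        have "4 * (u\<^sup>2 + v\<^sup>2 + w\<^sup>2 + z\<^sup>2) - (u + v - w - z)\<^sup>2 =
            (u - v)\<^sup>2 + (u + w)\<^sup>2 + (u + z)\<^sup>2 + (v + w)\<^sup>2 + (v + z)\<^sup>2 + (w - z)\<^sup>2"
          by (simp add: power2_eq_square algebra_simps)
        then show ?thesis by (smt (verit) zero_le_power2)
      qed
      show "(Y n \<omega> - Y (Suc (Suc n)) \<omega>)\<^sup>2 \<le> 4 * ((H n \<omega>)\<^sup>2 + (H (Suc n) \<omega>)\<^sup>2 + (D n \<omega>)\<^sup>2 + (D (Suc n) \<omega>)\<^sup>2)" for \<omega>
        using four[of "H n \<omega>" "H (Suc n) \<omega>" "D n \<omega>" "D (Suc n) \<omega>"] by (simp add: D_def)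
    qed simp_all
    also have "\<dots> = 4 * (a n + a (Suc n) + d n + d (Suc n))"
      unfolding a_def d_def
      by simp
    finally show ?thesis using eps_pos by (simp add: divide_right_mono mult_left_mono)
  qed
  have shift: "(\<Sum>n<N. z (Suc n)) \<le> (\<Sum>n<N. z n)" if "z N = 0" "0 \<le> z 0" for z :: "nat \<Rightarrow> real"
    using sum.lessThan_Suc_shift[of z N] that by simp
  have ends: "s N = 0" "a N = 0" "d N = 0"
    by (simp_all add: s_def a_def d_def D_def Y_def H_def b_end hc_def)
  define A where "A = (\<Sum>n<N. a n)"
  define \<Delta> where "\<Delta> = (\<Sum>n<N. d n)"
  define V where "V = s 0 + \<Delta>"
  have "(\<Sum>n<N. s (Suc n)) \<le> (\<Sum>n<N. s n)" using shift ends nonneg by simp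
  also have "\<dots> \<le> (\<Sum>n<N. (4 / \<epsilon>) * (a n + a (Suc n) + d n + d (Suc n)))" by (intro sum_mono s_le)
  also have "\<dots> = (4 / \<epsilon>) * (A + (\<Sum>n<N. a (Suc n)) + \<Delta> + (\<Sum>n<N. d (Suc n)))"
    by (simp add: A_def \<Delta>_def sum.distrib sum_distrib_left[symmetric] del: times_divide_eq_left)
  also have "\<dots> \<le> (4 / \<epsilon>) * (A + A + \<Delta> + \<Delta>)"
    unfolding A_def \<Delta>_def using eps_pos by (intro mult_left_mono add_mono shift ends nonneg order.refl) auto
  finally have sum_s: "(\<Sum>n<N. s (Suc n)) \<le> (8 / \<epsilon>) * (A + \<Delta>)" by (simp add: field_simps)
  \<comment> \<open>The weight \<open>\<epsilon> / 16\<close> reduces the factor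
    \<open>8 / \<epsilon>\<close> of \<open>sum_s\<close> to one half, so that the product terms can
    be absorbed: \<open>\<Delta> \<le> A + (16 / \<epsilon>) * A + (A + \<Delta>) / 2 - s 0\<close>.
    Solving for \<open>\<Delta>\<close> yields the constant
    \<open>3 + 32 / \<epsilon>\<close>.\<close>
  have c_le: "2 * c n \<le> (16 / \<epsilon>) * a n + (\<epsilon> / 16) * s (Suc n)" for n
  proof -
    have "2 * c n = (\<integral>\<omega>. 2 * (H n \<omega> * Y (Suc n) \<omega>) \<partial>P)"
      unfolding c_def by (simp add: ints)
    also have "\<dots> \<le> (\<integral>\<omega>. (16 / \<epsilon>) * (H n \<omega>)\<^sup>2 + (\<epsilon> / 16) * (Y (Suc n) \<omega>)\<^sup>2 \<partial>P)"
    proof (rule integral_mono)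
      have "2 * (u * v) \<le> (16 / \<epsilon>) * u\<^sup>2 + (\<epsilon> / 16) * v\<^sup>2" for u v :: real
      proof -
        have "0 \<le> (\<epsilon> / 16) * (16 / \<epsilon> * u - v)\<^sup>2" using eps_pos by simp
        also have "\<dots> = (16 / \<epsilon>) * u\<^sup>2 + (\<epsilon> / 16) * v\<^sup>2 - 2 * (u * v)"
          using eps_pos by (simp add: power2_eq_square field_simps)
        finally show ?thesis by simp
      qed
      then show "2 * (H n \<omega> * Y (Suc n) \<omega>) \<le> (16 / \<epsilon>) * (H n \<omega>)\<^sup>2 + (\<epsilon> / 16) * (Y (Suc n) \<omega>)\<^sup>2" for \<omega> .
    qed simp_all
    also have "\<dots> = (16 / \<epsilon>) * a n + (\<epsilon> / 16) * s (Suc n)"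
      unfolding a_def s_def
      by simp
    finally show ?thesis .
  qed
  have "\<Delta> = A + (\<Sum>n<N. 2 * c n) - s 0"
  proof -
    have "\<Delta> = A + (\<Sum>n<N. 2 * c n) + (\<Sum>n<N. s (Suc n) - s n)"
      unfolding \<Delta>_def A_def sum.distrib[symmetric] by (intro sum.cong) (auto simp: d_eq)
    then show ?thesis using sum_lessThan_telescope[of s N] ends by simp
  qed
  moreover have "(\<Sum>n<N. 2 * c n) \<le> (16 / \<epsilon>) * A + (\<epsilon> / 16) * (\<Sum>n<N. s (Suc n))"
    unfolding A_def sum_distrib_left sum.distrib[symmetric] by (intro sum_mono c_le)
  moreover have "(\<epsilon> / 16) * (\<Sum>n<N. s (Suc n)) \<le> (A + \<Delta>) / 2"
    using mult_left_mono[OF sum_s, of "\<epsilon> / 16"] eps_pos by simp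
  ultimately have "V \<le> (3 + 32 / \<epsilon>) * A"
    using nonneg(1)[of 0] eps_pos unfolding V_def by (simp add: algebra_simps)
  also have "A \<le> (\<Sum>n<N. \<integral>\<omega>. (h' n \<omega>)\<^sup>2 \<partial>P)"
    unfolding A_def
  proof (rule sum_mono)
    fix n assume "n \<in> {..<N}"
    then have "a n = (\<integral>\<omega>. (norm (h' n \<omega> - (\<integral>\<omega>'. h' n \<omega>' \<partial>P)))\<^sup>2 \<partial>P)"
      by (simp add: a_def H_def hc_def h'_def e_def)
    also have "\<dots> \<le> (\<integral>\<omega>. (norm (h' n \<omega> - 0))\<^sup>2 \<partial>P)"
      by (rule variance_minimal[where C = C]) (auto simp: h'_def bdd)
    finally show "a n \<le> (\<integral>\<omega>. (h' n \<omega>)\<^sup>2 \<partial>P)" by simp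
  qed
  also have "V = (\<integral>\<omega>. (T N \<omega> - (\<integral>\<omega>'. T N \<omega>' \<partial>P))\<^sup>2 \<partial>P)"
  proof -
    have "(\<integral>\<omega>'. T N \<omega>' \<partial>P) = (\<Sum>n<N. e n)"
      unfolding T_def e_def h'_def[symmetric]
      by (rule Bochner_Integration.integral_sum) (intro integrable_bounded_measurable bh')
    then have "T N \<omega> - (\<integral>\<omega>'. T N \<omega>' \<partial>P) = W N \<omega>" for \<omega>
      by (simp add: T_def W_def H_def hc_def Y_def b_end sum_subtractf)
    then show ?thesis using W_eq[of N] by (simp add: V_def \<Delta>_def)
  qed
  finally show ?thesis using eps_pos by (simp add: h'_def mult_left_mono)
qed

end

section \<open>The co-range\<close>

text \<open>Moving \<open>V\<close> radially to the circle of radius \<open>r\<close> costs at most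
  its distance to any point of that circle, so the total distance at most doubles. This includes
  \<open>V = 0\<close>, where the phase is a mere convention but the right-hand side is already
  \<open>2 * r\<close>.\<close>

lemma cis_Arg_close:
  assumes "cmod \<kappa> = 1" "0 \<le> r"
  shows "r * cmod (cis (Arg V) - \<kappa>) \<le> 2 * cmod (V - r *\<^sub>R \<kappa>)"
proof -
  have V: "V = cmod V *\<^sub>R cis (Arg V)" using rcis_cmod_Arg[of V] by (simp add: rcis_def scaleR_conv_of_real)
  have "r * cmod (cis (Arg V) - \<kappa>) = cmod (r *\<^sub>R cis (Arg V) - r *\<^sub>R \<kappa>)"
    using assms by (simp flip: scaleR_diff_right)
  also have "\<dots> \<le> cmod (r *\<^sub>R cis (Arg V) - V) + cmod (V - r *\<^sub>R \<kappa>)"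
    using norm_triangle_ineq[of "r *\<^sub>R cis (Arg V) - V" "V - r *\<^sub>R \<kappa>"] by simp
  also have "r *\<^sub>R cis (Arg V) - V = (r - cmod V) *\<^sub>R cis (Arg V)"
    by (subst (2) V) (simp add: scaleR_diff_left)
  also have "cmod \<dots> = \<bar>cmod V - cmod (r *\<^sub>R \<kappa>)\<bar>" using assms by simp
  also have "\<dots> \<le> cmod (V - r *\<^sub>R \<kappa>)" by (rule norm_triangle_ineq3)
  finally show ?thesis by simp
qed

lemma power2_sum_le: "(a + b)\<^sup>2 \<le> 2 * (a\<^sup>2 + b\<^sup>2)" for a b :: real
  using zero_le_power2[of "a - b"] by (simp add: power2_eq_square algebra_simps)

lemma power2_sum3_le: "(a + b + c)\<^sup>2 \<le> 3 * (a\<^sup>2 + b\<^sup>2 + c\<^sup>2)" for a b c :: real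
  using zero_le_power2[of "a - b"] zero_le_power2[of "a - c"] zero_le_power2[of "b - c"]
  by (simp add: power2_eq_square algebra_simps)

lemma cmod_mult_diff_le:
  assumes "cmod b = 1" "cmod a' = 1"
  shows "cmod (a * b - a' * b') \<le> cmod (a - a') + cmod (b - b')"
proof -
  have "a * b - a' * b' = (a - a') * b + a' * (b - b')" by (simp add: algebra_simps)
  then show ?thesis using norm_triangle_ineq[of "(a - a') * b" "a' * (b - b')"] assms by (simp add: norm_mult)
qed

context elliptic_chain
begin

definition functional :: "(nat \<Rightarrow> 'a \<Rightarrow> 'a \<Rightarrow> real) \<Rightarrow> bool" where
  "functional f \<longleftrightarrow> (\<forall>n. (\<lambda>(x, y). f n x y) \<in> borel_measurable (B n \<Otimes>\<^sub>M B (Suc n)))"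

text \<open>For phases this is the distance of \<open>exp (\<i> \<xi> f)\<close> from
  \<open>c n * w n x / w (Suc n) y\<close>, written without a quotient.\<close>

definition defect :: "(nat \<Rightarrow> 'a \<Rightarrow> 'a \<Rightarrow> real) \<Rightarrow> real \<Rightarrow> (nat \<Rightarrow> complex) \<Rightarrow> (nat \<Rightarrow> 'a \<Rightarrow> complex) \<Rightarrow> nat \<Rightarrow> 'a \<Rightarrow> 'a \<Rightarrow> real" where
  "defect f \<xi> c w n x y = cmod (cis (\<xi> * f n x y) * w (Suc n) y - c n * w n x)"

abbreviation sq_defect :: "(nat \<Rightarrow> 'a \<Rightarrow> 'a \<Rightarrow> real) \<Rightarrow> real \<Rightarrow> (nat \<Rightarrow> complex) \<Rightarrow> (nat \<Rightarrow> 'a \<Rightarrow> complex) \<Rightarrow> nat \<Rightarrow> real" where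
  "sq_defect f \<xi> c w n \<equiv> \<integral>\<omega>. (defect f \<xi> c w n (X n \<omega>) (X (Suc n) \<omega>))\<^sup>2 \<partial>P"

definition phases :: "(nat \<Rightarrow> complex) \<Rightarrow> (nat \<Rightarrow> 'a \<Rightarrow> complex) \<Rightarrow> bool" where
  "phases c w \<longleftrightarrow> (\<forall>n. w n \<in> borel_measurable (B n)) \<and> (\<forall>n x. cmod (w n x) = 1) \<and> (\<forall>n. cmod (c n) = 1)"

text \<open>
  \<open>\<xi>\<close> is in the co-range if \<open>exp (\<i> \<xi> f)\<close> is, up to constants and an error with bounded total square, a
  multiplicative coboundary on every time interval \<open>[0, N)\<close>. The phases may depend on \<open>N\<close>; this makes the set
  visibly a group and easy to enter, and \<open>corange_decomposition\<close> below removes the dependence.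
\<close>

definition corange :: "(nat \<Rightarrow> 'a \<Rightarrow> 'a \<Rightarrow> real) \<Rightarrow> real set" where
  "corange f = {\<xi>. \<exists>C. \<forall>N. \<exists>c w. phases c w \<and>
     (\<Sum>n<N. sq_defect f \<xi> c w n) \<le> C}"

lemma functional_measurable: "functional f \<Longrightarrow> (\<lambda>(x, y). f n x y) \<in> borel_measurable (B n \<Otimes>\<^sub>M B (Suc n))"
  by (simp add: functional_def)

lemma functional_X: "functional f \<Longrightarrow> (\<lambda>\<omega>. f n (X n \<omega>) (X (Suc n) \<omega>)) \<in> borel_measurable P"
  by (intro measurable_comp_pair[OF functional_measurable] measurable_X)

lemma defect_measurable:
  assumes "functional f" "phases c w"
  shows "(\<lambda>(x, y). defect f \<xi> c w n x y) \<in> borel_measurable (B n \<Otimes>\<^sub>M B (Suc n))"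
proof -
  note [measurable] = functional_measurable[OF assms(1), of n]
  have [measurable]: "w n \<in> borel_measurable (B n)" "w (Suc n) \<in> borel_measurable (B (Suc n))"
    using assms(2) by (auto simp: phases_def)
  show ?thesis unfolding defect_def by measurable
qed

lemma defect_nonneg [simp]: "0 \<le> defect f \<xi> c w n x y"
  by (simp add: defect_def)

lemma defect_le: "phases c w \<Longrightarrow> defect f \<xi> c w n x y \<le> 2"
  unfolding defect_def by (rule order_trans[OF norm_triangle_ineq4]) (simp add: phases_def norm_mult)

lemma defect_X_bounded:
  assumes "functional f" "phases c w"
  shows "bounded_measurable P (\<lambda>\<omega>. defect f \<xi> c w n (X n \<omega>) (X (Suc n) \<omega>))"
  by (rule bounded_measurableI[of _ _ 2])
     (use measurable_comp_pair[OF defect_measurable[OF assms] measurable_X measurable_X] defect_le[OF assms(2)] in auto)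

section \<open>Group structure of the co-range\<close>

lemma corange_0: "0 \<in> corange f"
  unfolding corange_def defect_def
  by (auto intro!: exI[of _ 0] exI[of _ "\<lambda>_. 1"] exI[of _ "\<lambda>_ _. 1"] simp: phases_def)

lemma corange_minus:
  assumes "\<xi> \<in> corange f" shows "- \<xi> \<in> corange f"
proof -
  from assms obtain C where C: "\<And>N. \<exists>c w. phases c w \<and>
     (\<Sum>n<N. sq_defect f \<xi> c w n) \<le> C" unfolding corange_def by blast
  have "\<exists>c w. phases c w \<and> (\<Sum>n<N. sq_defect f (- \<xi>) c w n) \<le> C" for N
  proof -
    obtain c w where cw: "phases c w" "(\<Sum>n<N. sq_defect f \<xi> c w n) \<le> C" using C by blast
    let ?c = "\<lambda>n. cnj (c n)" let ?w = "\<lambda>n x. cnj (w n x)"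
    have "defect f (- \<xi>) ?c ?w n x y = defect f \<xi> c w n x y" for n x y
      unfolding defect_def by (subst complex_mod_cnj[symmetric]) (simp add: cis_cnj)
    moreover have "phases ?c ?w"
      using cw(1) by (auto simp: phases_def intro!: measurable_compose[OF _ borel_measurable_continuous_onI[of cnj]] continuous_intros)
    ultimately show ?thesis using cw(2) by (intro exI[of _ ?c] exI[of _ ?w]) simp
  qed
  then show ?thesis unfolding corange_def by blast
qed

lemma corange_add:
  assumes f: "functional f" and "\<xi> \<in> corange f" "\<eta> \<in> corange f"
  shows "\<xi> + \<eta> \<in> corange f"
proof -
  from assms(2) obtain C where C: "\<And>N. \<exists>c w. phases c w \<and>
     (\<Sum>n<N. sq_defect f \<xi> c w n) \<le> C" unfolding corange_def by blast
  from assms(3) obtain D where D: "\<And>N. \<exists>c w. phases c w \<and>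
     (\<Sum>n<N. sq_defect f \<eta> c w n) \<le> D" unfolding corange_def by blast
  have "\<exists>c w. phases c w \<and> (\<Sum>n<N. sq_defect f (\<xi> + \<eta>) c w n) \<le> 2 * (C + D)" for N
  proof -
    obtain c w where cw: "phases c w" "(\<Sum>n<N. sq_defect f \<xi> c w n) \<le> C" using C by blast
    obtain d v where dv: "phases d v" "(\<Sum>n<N. sq_defect f \<eta> d v n) \<le> D" using D by blast
    let ?c = "\<lambda>n. c n * d n" let ?w = "\<lambda>n x. w n x * v n x"
    have ph: "phases ?c ?w"
      using cw(1) dv(1) unfolding phases_def by (auto simp: norm_mult intro!: borel_measurable_times)
    have le: "defect f (\<xi> + \<eta>) ?c ?w n x y \<le> defect f \<xi> c w n x y + defect f \<eta> d v n x y" for n x y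
    proof -
      let ?a = "cis (\<xi> * f n x y) * w (Suc n) y" let ?b = "cis (\<eta> * f n x y) * v (Suc n) y"
      have "cmod (?a * ?b - c n * w n x * (d n * v n x)) \<le> cmod (?a - c n * w n x) + cmod (?b - d n * v n x)"
        by (rule cmod_mult_diff_le) (use cw(1) dv(1) in \<open>auto simp: phases_def norm_mult\<close>)
      then show ?thesis by (simp add: defect_def cis_mult[symmetric] algebra_simps distrib_right)
    qed
    note b = defect_X_bounded[OF f]
    have "(\<Sum>n<N. sq_defect f (\<xi> + \<eta>) ?c ?w n)
      \<le> (\<Sum>n<N. 2 * ((sq_defect f \<xi> c w n) + (sq_defect f \<eta> d v n)))"
    proof (rule sum_mono)
      fix n
      have "(sq_defect f (\<xi> + \<eta>) ?c ?w n) \<le>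
        (\<integral>\<omega>. 2 * ((defect f \<xi> c w n (X n \<omega>) (X (Suc n) \<omega>))\<^sup>2 + (defect f \<eta> d v n (X n \<omega>) (X (Suc n) \<omega>))\<^sup>2) \<partial>P)"
      proof (intro integral_mono integrable_bounded_measurable bounded_measurable_intros b ph cw dv)
        fix \<omega>
        show "(defect f (\<xi> + \<eta>) ?c ?w n (X n \<omega>) (X (Suc n) \<omega>))\<^sup>2 \<le> 2 * ((defect f \<xi> c w n (X n \<omega>) (X (Suc n) \<omega>))\<^sup>2 + (defect f \<eta> d v n (X n \<omega>) (X (Suc n) \<omega>))\<^sup>2)"
          by (rule order_trans[OF power_mono[OF le] power2_sum_le]) simp
      qed
      also have "\<dots> = 2 * ((sq_defect f \<xi> c w n) + (sq_defect f \<eta> d v n))"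
        using b cw(1) dv(1) by (simp add: integrable_bounded_measurable bounded_measurable_power2)
      finally show "(sq_defect f (\<xi> + \<eta>) ?c ?w n) \<le> \<dots>" .
    qed
    also have "\<dots> \<le> 2 * (C + D)" using cw(2) dv(2) by (simp add: sum_distrib_left[symmetric] sum.distrib)
    finally show ?thesis using ph by blast
  qed
  then show ?thesis unfolding corange_def by blast
qed

lemma corange_mult:
  assumes f: "functional f" and \<xi>: "\<xi> \<in> corange f"
  shows "of_int k * \<xi> \<in> corange f"
proof -
  have nat: "of_nat m * \<xi> \<in> corange f" for m
    by (induction m) (use corange_0 corange_add[OF f \<xi>] in \<open>auto simp: distrib_right\<close>)
  show ?thesis
    using nat[of "nat \<bar>k\<bar>"] corange_minus[OF nat[of "nat \<bar>k\<bar>"]]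
    by (cases "0 \<le> k") (auto simp: of_nat_nat)
qed

text \<open>
  For \<open>u n = E (exp (\<i> \<eta> (h n + \<dots> + h (N - 1))) | X n)\<close> the expressions \<open>exp (\<i> \<eta> h n) * u (n + 1) - u n\<close> are
  martingale differences, hence their square sum telescopes to at most 1. The lower bound on the
  characteristic function and \<open>two_step_poincare\<close> for \<open>|u n|\<close> allow to replace \<open>u n\<close> by its phase.
\<close>

lemma corangeI_charfun:
  assumes h: "functional h"
    and char: "\<And>N. 1 / 2 \<le> cmod (\<integral>\<omega>. cis (\<eta> * (\<Sum>n<N. h n (X n \<omega>) (X (Suc n) \<omega>))) \<partial>P)"
  shows "\<eta> \<in> corange h"
proof -
  note h_meas = functional_measurable[OF h]
  note [measurable (raw)] = measurable_comp_pair[OF h_meas]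
  have "\<exists>c w. phases c w \<and> (\<Sum>n<N. sq_defect h \<eta> c w n) \<le> 64 + 256 / \<epsilon>" for N
  proof -
    define e where "e n x y = (if n < N then cis (\<eta> * h n x y) else 1)" for n x y
    have e_norm [simp]: "cmod (e n x y) = 1" for n x y by (simp add: e_def)
    have e_meas [measurable]: "(\<lambda>(x, y). e n x y) \<in> borel_measurable (B n \<Otimes>\<^sub>M B (Suc n))" for n
      unfolding e_def by measurable
    note [measurable (raw)] = measurable_comp_pair[OF e_meas]
    obtain u where u_meas [measurable]: "\<And>n. u n \<in> borel_measurable (B n)" and u_end: "\<And>n x. N \<le> n \<Longrightarrow> u n x = 1"
      and u_le: "\<And>n x. x \<in> space (B n) \<Longrightarrow> cmod (u n x) \<le> 1"
      and u_eq: "\<And>n x. x \<in> space (B n) \<Longrightarrow> u n x = (\<integral>y. p n x y *\<^sub>R (e n x y * u (Suc n) y) \<partial>\<mu> (Suc n))"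
    proof (rule backward_solution[of "\<lambda>n x y s. e n x y * s" N 1 "\<lambda>_. 1"])
      show "(\<lambda>(x, y). e n x y * u y) \<in> borel_measurable (B n \<Otimes>\<^sub>M B (Suc n))" if [measurable]: "u \<in> borel_measurable (B (Suc n))" for n u
        by measurable
      show "e n x y * 1 = 1" if "N \<le> n" for n x y using that by (simp add: e_def)
    qed (auto simp: norm_mult)
    define U where "U n \<omega> = u n (X n \<omega>)" for n \<omega>
    define E where "E n \<omega> = e n (X n \<omega>) (X (Suc n) \<omega>)" for n \<omega>
    have bU: "bounded_measurable P (U n)" for n
      unfolding U_def by (rule bounded_measurableI[of _ _ 1]) (auto simp: u_le)
    have bE: "bounded_measurable P (E n)" for n
      unfolding E_def by (rule bounded_measurableI[of _ _ 1]) auto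
    have UF [measurable]: "U n \<in> borel_measurable (F n)" for n
      unfolding U_def by (rule measurable_compose[OF adapted]) auto
    have mart: "(\<integral>\<omega>. G \<omega> * (E n \<omega> * U (Suc n) \<omega>) \<partial>P) = (\<integral>\<omega>. G \<omega> * U n \<omega> \<partial>P)"
      if "G \<in> borel_measurable (F n)" "bounded_measurable P G" for G n
    proof -
      from that(2) obtain C' where C': "\<And>\<omega>. \<omega> \<in> space P \<Longrightarrow> norm (G \<omega>) \<le> C'" by (auto simp: bounded_measurable_def)
      have "(\<integral>\<omega>. G \<omega> * (E n \<omega> * U (Suc n) \<omega>) \<partial>P) =
        (\<integral>\<omega>. G \<omega> * (\<integral>y. p n (X n \<omega>) y *\<^sub>R (e n (X n \<omega>) y * u (Suc n) y) \<partial>\<mu> (Suc n)) \<partial>P)"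
        unfolding E_def U_def
        by (rule kernel_mult[where C = 1 and C' = C']) (use that(1) C' u_le in \<open>auto simp: norm_mult\<close>)
      also have "\<dots> = (\<integral>\<omega>. G \<omega> * U n \<omega> \<partial>P)"
        unfolding U_def by (intro Bochner_Integration.integral_cong) (auto simp: u_eq)
      finally show ?thesis .
    qed
    define T where "T n \<omega> = (\<Prod>k<n. E k \<omega>)" for n \<omega>
    have T_norm [simp]: "cmod (T n \<omega>) = 1" for n \<omega>
      unfolding T_def E_def by (induction n) (auto simp: norm_mult)
    have TF [measurable]: "T n \<in> borel_measurable (F n)" for n
    proof -
      have "E k \<in> borel_measurable (F n)" if "k < n" for k
        unfolding E_def using that by (intro measurable_comp_pair[OF e_meas] adapted) auto
      then show ?thesis unfolding T_def by (intro borel_measurable_prod) auto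
    qed
    have bT: "bounded_measurable P (T n)" for n
      by (rule bounded_measurableI[of _ _ 1], rule measurable_of_F[OF TF]) simp
    \<comment> \<open>The mean of \<open>T n * U n\<close> does not depend on \<open>n\<close>, and
      at \<open>n = N\<close> it is the characteristic function. As \<open>T n\<close> has modulus
      1, the lower bound passes to the mean \<open>r n\<close> of \<open>|U n|\<close>.\<close>
    have TU: "(\<integral>\<omega>. T n \<omega> * U n \<omega> \<partial>P) = (\<integral>\<omega>. T N \<omega> \<partial>P)" if "n \<le> N" for n
      using that
    proof (induction rule: inc_induct)
      case (step n)
      have "(\<integral>\<omega>. T (Suc n) \<omega> * U (Suc n) \<omega> \<partial>P) = (\<integral>\<omega>. T n \<omega> * (E n \<omega> * U (Suc n) \<omega>) \<partial>P)"
        by (simp add: T_def mult.assoc)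
      then show ?case using step.IH mart[OF TF bT, of n] by simp
    qed (simp add: U_def u_end)
    have T_eq: "T N \<omega> = cis (\<eta> * (\<Sum>n<N. h n (X n \<omega>) (X (Suc n) \<omega>)))" for \<omega>
    proof -
      have "T n \<omega> = cis (\<eta> * (\<Sum>k<n. h k (X k \<omega>) (X (Suc k) \<omega>)))" if "n \<le> N" for n
        using that by (induction n) (auto simp: T_def E_def e_def cis_mult distrib_left)
      then show ?thesis by simp
    qed
    define r where "r n = (\<integral>\<omega>. cmod (U n \<omega>) \<partial>P)" for n
    have r_ge: "1 / 2 \<le> r n" if "n < N" for n
    proof -
      have "1 / 2 \<le> cmod (\<integral>\<omega>. T n \<omega> * U n \<omega> \<partial>P)"
        using char[of N] TU[of n] that by (simp add: T_eq)
      also have "\<dots> \<le> (\<integral>\<omega>. cmod (T n \<omega> * U n \<omega>) \<partial>P)" by (rule integral_norm_bound)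
      finally show ?thesis by (simp add: norm_mult r_def)
    qed
    define d where "d n = (\<integral>\<omega>. (cmod (E n \<omega> * U (Suc n) \<omega> - U n \<omega>))\<^sup>2 \<partial>P)" for n
    define q where "q n = (\<integral>\<omega>. (cmod (U n \<omega>))\<^sup>2 \<partial>P)" for n
    have d_eq: "d n = q (Suc n) - q n" for n
    proof -
      have pt: "(cmod (E n \<omega> * U (Suc n) \<omega> - U n \<omega>))\<^sup>2 =
          (cmod (U (Suc n) \<omega>))\<^sup>2 + (cmod (U n \<omega>))\<^sup>2 - 2 * Re (cnj (U n \<omega>) * (E n \<omega> * U (Suc n) \<omega>))" for \<omega>
      proof -
        have "(cmod (a - b))\<^sup>2 = (cmod a)\<^sup>2 + (cmod b)\<^sup>2 - 2 * Re (cnj b * a)" for a b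
          unfolding cmod_power2 by (simp add: power2_eq_square algebra_simps)
        from this[of "E n \<omega> * U (Suc n) \<omega>" "U n \<omega>"] show ?thesis by (simp add: norm_mult E_def)
      qed
      define Z where "Z \<omega> = cnj (U n \<omega>) * (E n \<omega> * U (Suc n) \<omega>)" for \<omega>
      have i: "integrable P Z"
        unfolding Z_def by (intro integrable_bounded_measurable bounded_measurable_mult bounded_measurable_cnj bU bE)
      have cF: "(\<lambda>\<omega>. cnj (U n \<omega>)) \<in> borel_measurable (F n)"
        by (rule measurable_compose[OF UF borel_measurable_continuous_onI]) (intro continuous_intros)
      have "d n = q (Suc n) + q n - 2 * (\<integral>\<omega>. Re (Z \<omega>) \<partial>P)"
        unfolding d_def pt q_def Z_def[symmetric] using i
        by (simp add: integrable_bounded_measurable bounded_measurable_power2 bounded_measurable_norm bU)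
      also have "(\<integral>\<omega>. Re (Z \<omega>) \<partial>P) = Re (\<integral>\<omega>. Z \<omega> \<partial>P)"
        using i by (rule integral_Re)
      also have "(\<integral>\<omega>. Z \<omega> \<partial>P) = (\<integral>\<omega>. cnj (U n \<omega>) * (E n \<omega> * U (Suc n) \<omega>) \<partial>P)"
        by (simp only: Z_def)
      also have "(\<integral>\<omega>. cnj (U n \<omega>) * (E n \<omega> * U (Suc n) \<omega>) \<partial>P) = (\<integral>\<omega>. cnj (U n \<omega>) * U n \<omega> \<partial>P)"
        by (rule mart[OF cF bounded_measurable_cnj[OF bU]])
      also have "\<dots> = (\<integral>\<omega>. complex_of_real ((cmod (U n \<omega>))\<^sup>2) \<partial>P)"
        by (simp only: complex_norm_square mult.commute)
      also have "\<dots> = complex_of_real (q n)" unfolding q_def by (rule integral_complex_of_real)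
      finally show ?thesis by simp
    qed
    have d_nonneg: "0 \<le> d n" for n by (simp add: d_def)
    have sum_d: "(\<Sum>n<M. d n) \<le> 1" for M
    proof -
      have "q M \<le> (\<integral>\<omega>. 1 \<partial>P)"
        unfolding q_def by (intro integral_mono integrable_bounded_measurable bounded_measurable_power2 bounded_measurable_norm bU)
           (auto simp: U_def u_le power_le_one)
      moreover have "0 \<le> q 0" by (simp add: q_def)
      ultimately show ?thesis by (simp add: d_eq sum_lessThan_telescope prob_space)
    qed
    define v where "v n = (\<integral>\<omega>. (cmod (U n \<omega>) - r n)\<^sup>2 \<partial>P)" for n
    have v_le: "v n \<le> (2 / \<epsilon>) * (d n + d (Suc n))" for n
    proof -
      have "v n \<le> (1 / \<epsilon>) * (\<integral>\<omega>. (cmod (U n \<omega>) - cmod (U (Suc (Suc n)) \<omega>))\<^sup>2 \<partial>P)"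
        using two_step_poincare[of "\<lambda>x. cmod (u n x)" n "\<lambda>x. cmod (u (Suc (Suc n)) x)" 1]
        by (simp add: v_def r_def U_def u_le)
      also have "(\<integral>\<omega>. (cmod (U n \<omega>) - cmod (U (Suc (Suc n)) \<omega>))\<^sup>2 \<partial>P) \<le>
        (\<integral>\<omega>. 2 * ((cmod (E n \<omega> * U (Suc n) \<omega> - U n \<omega>))\<^sup>2 + (cmod (E (Suc n) \<omega> * U (Suc (Suc n)) \<omega> - U (Suc n) \<omega>))\<^sup>2) \<partial>P)"
      proof (intro integral_mono integrable_bounded_measurable bounded_measurable_intros bU bE)
        fix \<omega>
        have "\<bar>cmod (U k \<omega>) - cmod (U (Suc k) \<omega>)\<bar> \<le> cmod (E k \<omega> * U (Suc k) \<omega> - U k \<omega>)" for k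
          using norm_triangle_ineq3[of "E k \<omega> * U (Suc k) \<omega>" "U k \<omega>"] by (simp add: norm_mult E_def abs_minus_commute)
        from this[of n] this[of "Suc n"]
        have "\<bar>cmod (U n \<omega>) - cmod (U (Suc (Suc n)) \<omega>)\<bar> \<le> cmod (E n \<omega> * U (Suc n) \<omega> - U n \<omega>) + cmod (E (Suc n) \<omega> * U (Suc (Suc n)) \<omega> - U (Suc n) \<omega>)"
          by linarith
        then have "(cmod (U n \<omega>) - cmod (U (Suc (Suc n)) \<omega>))\<^sup>2 \<le> (cmod (E n \<omega> * U (Suc n) \<omega> - U n \<omega>) + cmod (E (Suc n) \<omega> * U (Suc (Suc n)) \<omega> - U (Suc n) \<omega>))\<^sup>2"
          by (metis abs_ge_zero power2_abs power_mono)
        then show "(cmod (U n \<omega>) - cmod (U (Suc (Suc n)) \<omega>))\<^sup>2 \<le> 2 * ((cmod (E n \<omega> * U (Suc n) \<omega> - U n \<omega>))\<^sup>2 + (cmod (E (Suc n) \<omega> * U (Suc (Suc n)) \<omega> - U (Suc n) \<omega>))\<^sup>2)"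
          by (rule order_trans[OF _ power2_sum_le])
      qed
      also have "\<dots> = 2 * (d n + d (Suc n))"
        unfolding d_def
        by (simp add: integrable_bounded_measurable bounded_measurable_intros bU bE)
      finally show ?thesis using eps_pos by (simp add: divide_right_mono mult_left_mono)
    qed
    \<comment> \<open>The recursion for \<open>u\<close> holds without a multiplicative constant, so
      the phases of \<open>u\<close> go with constants equal to 1.\<close>
    define c where "c n = (1::complex)" for n :: nat
    define w where "w n x = cis (Arg (u n x))" for n x
    have ph: "phases c w" unfolding phases_def c_def w_def by auto
    have def_le: "(sq_defect h \<eta> c w n) \<le> 64 * d n + 64 * v n" if n: "n < N" for n
    proof -
      have "(sq_defect h \<eta> c w n) \<le>
        (\<integral>\<omega>. 64 * (cmod (E n \<omega> * U (Suc n) \<omega> - U n \<omega>))\<^sup>2 + 64 * (cmod (U n \<omega>) - r n)\<^sup>2 \<partial>P)"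
      proof (intro integral_mono integrable_bounded_measurable bounded_measurable_intros bU bE defect_X_bounded[OF h ph])
        fix \<omega>
        define \<delta> where "\<delta> = defect h \<eta> c w n (X n \<omega>) (X (Suc n) \<omega>)"
        define z where "z = cmod (E n \<omega> * U (Suc n) \<omega> - U n \<omega>)"
        have E1: "cmod (E n \<omega>) = 1" by (simp add: E_def)
        have \<delta>: "\<delta> = cmod (E n \<omega> * cis (Arg (U (Suc n) \<omega>)) - cis (Arg (U n \<omega>)))"
          using n by (simp add: \<delta>_def defect_def c_def w_def E_def e_def U_def)
        have "\<delta> \<le> 2" unfolding \<delta> by (rule order_trans[OF norm_triangle_ineq4]) (simp add: norm_mult E1)
        have \<delta>0: "0 \<le> \<delta>" by (simp add: \<delta>_def)
        show "\<delta>\<^sup>2 \<le> 64 * z\<^sup>2 + 64 * (cmod (U n \<omega>) - r n)\<^sup>2"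
        \<comment> \<open>The phase of \<open>U n\<close> is unstable where \<open>U n\<close> is
          small. Below \<open>1 / 4\<close> the trivial bound \<open>\<delta> \<le> 2\<close> is
          paid for by the deviation of \<open>|U n|\<close> from \<open>r n \<ge> 1 / 2\<close>,
          which is at least \<open>1 / 4\<close>; otherwise dividing by \<open>|U n|\<close> gives
          \<open>\<delta> \<le> 8 * z\<close>. Both cases lead to the factor 64.\<close>
        proof (cases "cmod (U n \<omega>) < 1 / 4")
          case True
          then have "(1 / 4)\<^sup>2 \<le> (cmod (U n \<omega>) - r n)\<^sup>2"
            using r_ge[OF n] by (subst power2_commute, intro power_mono) auto
          then have "1 / 16 \<le> (cmod (U n \<omega>) - r n)\<^sup>2" by (simp add: power_divide)
          moreover have "\<delta>\<^sup>2 \<le> 4" using power_mono[OF \<open>\<delta> \<le> 2\<close> \<delta>0, of 2] by simp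
          moreover have "0 \<le> 64 * z\<^sup>2" by simp
          ultimately show ?thesis by linarith
        next
          case False
          \<comment> \<open>The phase that \<open>U (Suc n)\<close> would have if the martingale
            difference were 0 at \<open>\<omega>\<close>.\<close>
          define \<kappa> where "\<kappa> = cnj (E n \<omega>) * cis (Arg (U n \<omega>))"
          have EE: "E n \<omega> * cnj (E n \<omega>) = 1" using E1 by (simp add: complex_norm_square[symmetric])
          have Ucis: "U n \<omega> = cmod (U n \<omega>) *\<^sub>R cis (Arg (U n \<omega>))"
            using rcis_cmod_Arg[of "U n \<omega>"] by (simp add: rcis_def scaleR_conv_of_real)
          have "cmod \<kappa> = 1" by (simp add: \<kappa>_def norm_mult E1)
          then have "cmod (U n \<omega>) * cmod (cis (Arg (U (Suc n) \<omega>)) - \<kappa>) \<le> 2 * cmod (U (Suc n) \<omega> - cmod (U n \<omega>) *\<^sub>R \<kappa>)"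
            by (rule cis_Arg_close) simp
          also have "cmod (cis (Arg (U (Suc n) \<omega>)) - \<kappa>) = cmod (E n \<omega> * (cis (Arg (U (Suc n) \<omega>)) - \<kappa>))"
            by (simp add: norm_mult E1)
          also have "E n \<omega> * (cis (Arg (U (Suc n) \<omega>)) - \<kappa>) = E n \<omega> * cis (Arg (U (Suc n) \<omega>)) - cis (Arg (U n \<omega>))"
            using EE by (simp add: \<kappa>_def right_diff_distrib mult.assoc[symmetric])
          also have "cmod (U (Suc n) \<omega> - cmod (U n \<omega>) *\<^sub>R \<kappa>) = cmod (E n \<omega> * (U (Suc n) \<omega> - cmod (U n \<omega>) *\<^sub>R \<kappa>))"
            by (simp add: norm_mult E1)
          also have "E n \<omega> * (U (Suc n) \<omega> - cmod (U n \<omega>) *\<^sub>R \<kappa>) = E n \<omega> * U (Suc n) \<omega> - U n \<omega>"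
          proof -
            have "E n \<omega> * (cmod (U n \<omega>) *\<^sub>R \<kappa>) = cmod (U n \<omega>) *\<^sub>R ((E n \<omega> * cnj (E n \<omega>)) * cis (Arg (U n \<omega>)))"
              by (simp only: \<kappa>_def mult_scaleR_right mult.assoc)
            also have "\<dots> = U n \<omega>" unfolding EE mult_1 by (rule Ucis[symmetric])
            finally show ?thesis by (simp only: right_diff_distrib)
          qed
          finally have "cmod (U n \<omega>) * \<delta> \<le> 2 * z" by (simp add: \<delta> z_def)
          moreover have "(1 / 4) * \<delta> \<le> cmod (U n \<omega>) * \<delta>" using False \<delta>0 by (intro mult_right_mono) auto
          ultimately have "\<delta> \<le> 8 * z" by simp
          then have "\<delta>\<^sup>2 \<le> (8 * z)\<^sup>2" using \<delta>0 by (rule power_mono)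
          also have "\<dots> \<le> 64 * z\<^sup>2 + 64 * (cmod (U n \<omega>) - r n)\<^sup>2" by (simp add: power_mult_distrib)
          finally show ?thesis .
        qed
      qed
      also have "\<dots> = 64 * d n + 64 * v n"
        unfolding d_def v_def
        by (simp add: integrable_bounded_measurable bounded_measurable_intros bU bE)
      finally show ?thesis .
    qed
    have "(\<Sum>n<N. sq_defect h \<eta> c w n) \<le> (\<Sum>n<N. 64 * d n + 64 * ((2 / \<epsilon>) * (d n + d (Suc n))))"
    proof (rule sum_mono)
      fix n assume "n \<in> {..<N}"
      then show "(sq_defect h \<eta> c w n) \<le> 64 * d n + 64 * ((2 / \<epsilon>) * (d n + d (Suc n)))"
        using def_le[of n] v_le[of n] unfolding lessThan_iff by linarith
    qed
    also have "\<dots> = 64 * (\<Sum>n<N. d n) + (128 / \<epsilon>) * ((\<Sum>n<N. d n) + (\<Sum>n<N. d (Suc n)))"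
      by (simp add: sum.distrib sum_distrib_left[symmetric] sum_divide_distrib[symmetric])
    also have "\<dots> \<le> 64 * 1 + (128 / \<epsilon>) * (1 + 1)"
    proof -
      have "(\<Sum>n<N. d (Suc n)) \<le> 1"
        using sum.lessThan_Suc_shift[of d N] sum_d[of "Suc N"] d_nonneg[of 0] by simp
      then show ?thesis using sum_d[of N] eps_pos by (intro add_mono mult_left_mono) auto
    qed
    finally show ?thesis using ph by auto
  qed
  then show ?thesis unfolding corange_def by blast
qed

end

section \<open>Phases independent of the horizon\<close>

lemma cmod_unit_mult_cnj: "cmod z = 1 \<Longrightarrow> z * cnj z = 1" "cmod z = 1 \<Longrightarrow> cnj z * z = 1"
  by (simp_all add: complex_norm_square[symmetric] mult.commute[of "cnj z"])

lemma weighted_Cauchy_Schwarz: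
  fixes k g :: "'a \<Rightarrow> real"
  assumes i: "integrable M k" "integrable M (\<lambda>x. k x * g x)" "integrable M (\<lambda>x. k x * (g x)\<^sup>2)"
    and k: "\<And>x. 0 \<le> k x" and pos: "0 < (\<integral>x. k x \<partial>M)"
  shows "(\<integral>x. k x * g x \<partial>M)\<^sup>2 \<le> (\<integral>x. k x \<partial>M) * (\<integral>x. k x * (g x)\<^sup>2 \<partial>M)"
proof -
  define a where "a = (\<integral>x. k x \<partial>M)"
  define b where "b = (\<integral>x. k x * g x \<partial>M)"
  define c where "c = (\<integral>x. k x * (g x)\<^sup>2 \<partial>M)"
  have "0 \<le> (\<integral>x. k x * (a * g x - b)\<^sup>2 \<partial>M)" using k by simp
  also have "\<dots> = (\<integral>x. a\<^sup>2 * (k x * (g x)\<^sup>2) - 2 * a * b * (k x * g x) + b\<^sup>2 * k x \<partial>M)"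
    by (intro Bochner_Integration.integral_cong) (auto simp: power2_eq_square algebra_simps)
  also have "\<dots> = a\<^sup>2 * c - 2 * a * b * b + b\<^sup>2 * a"
    using i by (simp add: a_def b_def c_def)
  also have "\<dots> = a * (a * c - b\<^sup>2)" by (simp add: power2_eq_square algebra_simps)
  finally have "0 \<le> a * c - b\<^sup>2" using pos by (simp add: zero_le_mult_iff a_def[symmetric])
  then show ?thesis by (simp add: a_def b_def c_def)
qed

section \<open>Averages over two-step bridges\<close>

context elliptic_chain
begin

text \<open>
  If \<open>exp (\<i> \<xi> f)\<close> is close to a multiplicative coboundary of phases \<open>w\<close>, then the phase of \<open>bridge f \<xi> n x z\<close> is
  close to \<open>w n x\<close> times a factor depending on \<open>z\<close> only. In contrast to \<open>w\<close> it does not depend on the horizon.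
\<close>

definition bridge :: "(nat \<Rightarrow> 'a \<Rightarrow> 'a \<Rightarrow> real) \<Rightarrow> real \<Rightarrow> nat \<Rightarrow> 'a \<Rightarrow> 'a \<Rightarrow> complex" where
  "bridge f \<xi> n x z = (\<integral>w. (p n x w * p (Suc n) w z) *\<^sub>R cis (\<xi> * f n x w + \<xi> * f (Suc n) w z) \<partial>\<mu> (Suc n))"

lemma bridge_measurable:
  assumes "functional f"
  shows "(\<lambda>(x, z). bridge f \<xi> n x z) \<in> borel_measurable (B n \<Otimes>\<^sub>M B (Suc (Suc n)))"
proof -
  note [measurable (raw)] = measurable_comp_pair[OF functional_measurable[OF assms]]
  show ?thesis unfolding bridge_def by measurable
qed

lemma pp_le: "p n x w * p (Suc n) w z \<le> p n x w * (1 / \<epsilon>)"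
  by (intro mult_left_mono p_le) simp

lemma pp_mult_integrable:
  fixes \<phi> :: "'a \<Rightarrow> 'b::{banach, second_countable_topology}"
  assumes x: "x \<in> space (B n)" and z: "z \<in> space (B (Suc (Suc n)))" and [measurable]: "\<phi> \<in> borel_measurable (B (Suc n))"
    and bdd: "\<And>w. w \<in> space (B (Suc n)) \<Longrightarrow> norm (\<phi> w) \<le> R"
  shows "integrable (\<mu> (Suc n)) (\<lambda>w. (p n x w * p (Suc n) w z) *\<^sub>R \<phi> w)"
proof -
  note [measurable] = x z
  have "norm (p (Suc n) w z *\<^sub>R \<phi> w) \<le> (1 / \<epsilon>) * R" if "w \<in> space (B (Suc n))" for w
    unfolding norm_scaleR using bdd[OF that] eps_pos by (intro mult_mono) (auto simp: p_le)
  then have "integrable (\<mu> (Suc n)) (\<lambda>w. p n x w *\<^sub>R (p (Suc n) w z *\<^sub>R \<phi> w))"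
    by (intro kernel_integrable[OF x]) auto
  then show ?thesis by simp
qed

lemma pp_integrable:
  assumes "x \<in> space (B n)" "z \<in> space (B (Suc (Suc n)))"
  shows "integrable (\<mu> (Suc n)) (\<lambda>w. p n x w * p (Suc n) w z)"
  using pp_mult_integrable[OF assms, of "\<lambda>_. 1::real" 1] by simp

lemma pp_integral_le:
  assumes "x \<in> space (B n)" "z \<in> space (B (Suc (Suc n)))"
  shows "(\<integral>w. p n x w * p (Suc n) w z \<partial>\<mu> (Suc n)) \<le> 1 / \<epsilon>"
proof -
  have "(\<integral>w. p n x w * p (Suc n) w z \<partial>\<mu> (Suc n)) \<le> (\<integral>w. p n x w * (1 / \<epsilon>) \<partial>\<mu> (Suc n))"
    using assms by (intro integral_mono pp_integrable pp_le integrable_mult_left p_integrable)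
  also have "\<dots> = 1 / \<epsilon>" using assms by (simp del: times_divide_eq_right)
  finally show ?thesis .
qed

text \<open>The subtracted product is the phase predicted by an exact coboundary: multiplied along
  \<open>x\<close>, \<open>v\<close>, \<open>z\<close>, the phases at the intermediate state
  \<open>v\<close> cancel.\<close>

definition bridge_defect :: "(nat \<Rightarrow> 'a \<Rightarrow> 'a \<Rightarrow> real) \<Rightarrow> real \<Rightarrow> (nat \<Rightarrow> complex) \<Rightarrow> (nat \<Rightarrow> 'a \<Rightarrow> complex) \<Rightarrow> nat \<Rightarrow> 'a \<Rightarrow> 'a \<Rightarrow> real" where
  "bridge_defect f \<xi> c w n x z = cmod (cis (Arg (bridge f \<xi> n x z)) - c n * c (Suc n) * w n x * cnj (w (Suc (Suc n)) z))"

lemma defect_sq_le: "phases c w \<Longrightarrow> (defect f \<xi> c w n x y)\<^sup>2 \<le> 4"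
  using power_mono[OF defect_le[of c w f \<xi> n x y] defect_nonneg, of 2] by simp

lemma bridge_defect_measurable:
  assumes f: "functional f" and cw: "phases c w"
  shows "(\<lambda>(x, z). bridge_defect f \<xi> c w n x z) \<in> borel_measurable (B n \<Otimes>\<^sub>M B (Suc (Suc n)))"
proof -
  note [measurable] = bridge_measurable[OF f]
  have [measurable]: "\<And>n. w n \<in> borel_measurable (B n)" using cw by (auto simp: phases_def)
  have [measurable]: "cnj \<in> borel_measurable borel" by (intro borel_measurable_continuous_onI continuous_intros)
  show ?thesis unfolding bridge_defect_def by measurable
qed

text \<open>On each path \<open>x\<close>, \<open>v\<close>, \<open>z\<close> the exponential misses
  the predicted phase by at most the sum of the defects of its two steps. Averaging over
  \<open>v\<close>, passing to the phase of the average and the Cauchy-Schwarz inequality for the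
  bridge weights give the bound, as the total weight \<open>r\<close> is at least
  \<open>\<epsilon>\<close>.\<close>

lemma bridge_defect_le:
  assumes f: "functional f" and cw: "phases c w"
    and x: "x \<in> space (B n)" and z: "z \<in> space (B (Suc (Suc n)))"
  shows "(bridge_defect f \<xi> c w n x z)\<^sup>2 \<le> (8 / \<epsilon> ^ 3) *
    (\<integral>v. (p n x v * p (Suc n) v z) * ((defect f \<xi> c w n x v)\<^sup>2 + (defect f \<xi> c w (Suc n) v z)\<^sup>2) \<partial>\<mu> (Suc n))"
proof -
  note [measurable] = x z
  note [measurable (raw)] = measurable_comp_pair[OF functional_measurable[OF f]]
    measurable_comp_pair[OF defect_measurable[OF f cw]]
  define k where "k v = p n x v * p (Suc n) v z" for v
  define g where "g v = defect f \<xi> c w n x v + defect f \<xi> c w (Suc n) v z" for v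
  define G where "G v = (defect f \<xi> c w n x v)\<^sup>2 + (defect f \<xi> c w (Suc n) v z)\<^sup>2" for v
  define \<kappa> where "\<kappa> = c n * c (Suc n) * w n x * cnj (w (Suc (Suc n)) z)"
  define r where "r = (\<integral>v. k v \<partial>\<mu> (Suc n))"
  have unit: "cmod (c m) = 1" "cmod (w m y) = 1" for m y using cw by (auto simp: phases_def)
  have k0: "0 \<le> k v" for v by (simp add: k_def)
  have r_ge: "\<epsilon> \<le> r" using two_step[OF x z] by (simp add: r_def k_def)
  have r_le: "r \<le> 1 / \<epsilon>" using pp_integral_le[OF x z] by (simp add: r_def k_def)
  have d2: "0 \<le> defect f \<xi> c w m y v" "defect f \<xi> c w m y v \<le> 2" for m y v
    using defect_le[OF cw] by simp_all
  have gm [measurable]: "g \<in> borel_measurable (B (Suc n))" "G \<in> borel_measurable (B (Suc n))"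
    unfolding g_def G_def by measurable
  have g0: "0 \<le> g v" and g4: "g v \<le> 4" for v using d2[of n x v] d2[of "Suc n" v z] by (auto simp: g_def)
  have gG: "(g v)\<^sup>2 \<le> 2 * G v" for v unfolding g_def G_def by (rule power2_sum_le)
  have G0: "0 \<le> G v" for v by (simp add: G_def)
  have G8: "G v \<le> 8" for v
    using defect_sq_le[OF cw, of f \<xi> n x v] defect_sq_le[OF cw, of f \<xi> "Suc n" v z] by (simp add: G_def)
  have ig: "integrable (\<mu> (Suc n)) (\<lambda>v. k v * g v)"
    using pp_mult_integrable[OF x z gm(1), of 4] g0 g4 by (simp add: k_def)
  have ig2: "integrable (\<mu> (Suc n)) (\<lambda>v. k v * (g v)\<^sup>2)"
    using pp_mult_integrable[OF x z, of "\<lambda>v. (g v)\<^sup>2" "4\<^sup>2"] power_mono[OF g4 g0, of _ 2] by (simp add: k_def)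
  have iG: "integrable (\<mu> (Suc n)) (\<lambda>v. k v * G v)"
    using pp_mult_integrable[OF x z gm(2), of 8] G0 G8 by (simp add: k_def)
  have ik: "integrable (\<mu> (Suc n)) k" using pp_integrable[OF x z] by (simp add: k_def[abs_def])
  have \<kappa>1: "cmod \<kappa> = 1" by (simp add: \<kappa>_def norm_mult unit)
  define C where "C v = cis (\<xi> * f n x v + \<xi> * f (Suc n) v z)" for v
  have Cm [measurable]: "C \<in> borel_measurable (B (Suc n))" unfolding C_def by measurable
  have iC: "integrable (\<mu> (Suc n)) (\<lambda>v. k v *\<^sub>R C v)"
    unfolding k_def by (rule pp_mult_integrable[OF x z Cm, of 1]) (simp add: C_def)
  have Cg: "cmod (C v - \<kappa>) \<le> g v" for v
  proof -
    have "C v - \<kappa> = (C v * w (Suc (Suc n)) z - c n * c (Suc n) * w n x) * cnj (w (Suc (Suc n)) z)"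
      using cmod_unit_mult_cnj(1)[OF unit(2)[of "Suc (Suc n)" z]] by (simp add: \<kappa>_def left_diff_distrib mult.assoc)
    then have "cmod (C v - \<kappa>) = cmod (C v * w (Suc (Suc n)) z - c n * c (Suc n) * w n x)"
      by (simp add: norm_mult unit)
    also have "C v * w (Suc (Suc n)) z - c n * c (Suc n) * w n x =
        cis (\<xi> * f n x v) * (cis (\<xi> * f (Suc n) v z) * w (Suc (Suc n)) z - c (Suc n) * w (Suc n) v)
        + c (Suc n) * (cis (\<xi> * f n x v) * w (Suc n) v - c n * w n x)"
      by (simp add: C_def cis_mult[symmetric] algebra_simps)
    also have "cmod \<dots> \<le> g v"
      by (rule order_trans[OF norm_triangle_ineq]) (simp add: norm_mult unit g_def defect_def)
    finally show ?thesis .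
  qed
  have "r * bridge_defect f \<xi> c w n x z \<le> 2 * cmod (bridge f \<xi> n x z - r *\<^sub>R \<kappa>)"
    unfolding bridge_defect_def \<kappa>_def[symmetric] using \<kappa>1 r_ge eps_pos by (intro cis_Arg_close) auto
  also have "bridge f \<xi> n x z - r *\<^sub>R \<kappa> = (\<integral>v. k v *\<^sub>R (C v - \<kappa>) \<partial>\<mu> (Suc n))"
    using iC ik by (simp add: scaleR_diff_right bridge_def r_def k_def[symmetric] C_def[symmetric])
  also have "cmod \<dots> \<le> (\<integral>v. k v * g v \<partial>\<mu> (Suc n))"
  proof (rule order_trans[OF integral_norm_bound])
    have "integrable (\<mu> (Suc n)) (\<lambda>v. k v *\<^sub>R (C v - \<kappa>))" using iC ik by (simp add: scaleR_diff_right)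
    then show "(\<integral>v. cmod (k v *\<^sub>R (C v - \<kappa>)) \<partial>\<mu> (Suc n)) \<le> (\<integral>v. k v * g v \<partial>\<mu> (Suc n))"
      using ig by (intro integral_mono integrable_norm) (auto simp: k0 abs_of_nonneg Cg intro!: mult_left_mono)
  qed
  finally have "r * bridge_defect f \<xi> c w n x z \<le> 2 * (\<integral>v. k v * g v \<partial>\<mu> (Suc n))" by simp
  then have "(r * bridge_defect f \<xi> c w n x z)\<^sup>2 \<le> (2 * (\<integral>v. k v * g v \<partial>\<mu> (Suc n)))\<^sup>2"
    using r_ge eps_pos by (intro power_mono) (auto simp: bridge_defect_def)
  also have "\<dots> = 4 * (\<integral>v. k v * g v \<partial>\<mu> (Suc n))\<^sup>2" by (simp add: power_mult_distrib)
  also have "\<dots> \<le> 4 * (r * (\<integral>v. k v * (g v)\<^sup>2 \<partial>\<mu> (Suc n)))"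
    unfolding r_def using weighted_Cauchy_Schwarz[OF ik ig ig2 k0] r_ge eps_pos by (simp add: r_def)
  also have "(\<integral>v. k v * (g v)\<^sup>2 \<partial>\<mu> (Suc n)) \<le> (\<integral>v. 2 * (k v * G v) \<partial>\<mu> (Suc n))"
  proof (rule integral_mono[OF ig2])
    show "integrable (\<mu> (Suc n)) (\<lambda>v. 2 * (k v * G v))" using iG by simp
    show "k v * (g v)\<^sup>2 \<le> 2 * (k v * G v)" for v
      using mult_left_mono[OF gG[of v] k0[of v]] by (simp add: mult.left_commute)
  qed
  also have "\<dots> = 2 * (\<integral>v. k v * G v \<partial>\<mu> (Suc n))" by simp
  finally have "(r * bridge_defect f \<xi> c w n x z)\<^sup>2 \<le> 8 * r * (\<integral>v. k v * G v \<partial>\<mu> (Suc n))"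
    using r_ge eps_pos by (simp add: mult_left_mono)
  moreover have J0: "0 \<le> (\<integral>v. k v * G v \<partial>\<mu> (Suc n))" using k0 G0 by simp
  ultimately have "r * (bridge_defect f \<xi> c w n x z)\<^sup>2 \<le> 8 * (\<integral>v. k v * G v \<partial>\<mu> (Suc n))"
    using r_ge eps_pos by (simp add: power_mult_distrib power2_eq_square[of r] mult.assoc mult.left_commute[of 8])
  then have "\<epsilon> * (bridge_defect f \<xi> c w n x z)\<^sup>2 \<le> 8 * (\<integral>v. k v * G v \<partial>\<mu> (Suc n))"
    using mult_right_mono[OF r_ge, of "(bridge_defect f \<xi> c w n x z)\<^sup>2"] by simp
  then have "(bridge_defect f \<xi> c w n x z)\<^sup>2 \<le> (8 / \<epsilon>) * (\<integral>v. k v * G v \<partial>\<mu> (Suc n))"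
    using eps_pos by (simp add: field_simps)
  also have "\<dots> \<le> (8 / \<epsilon> ^ 3) * (\<integral>v. k v * G v \<partial>\<mu> (Suc n))"
  proof (rule mult_right_mono[OF _ J0])
    \<comment> \<open>The total weight lies between \<open>\<epsilon>\<close> and
      \<open>1 / \<epsilon>\<close>, which forces \<open>\<epsilon> \<le> 1\<close>.\<close>
    have "\<epsilon> * \<epsilon> \<le> \<epsilon> * (1 / \<epsilon>)" using order_trans[OF r_ge r_le] eps_pos by (intro mult_left_mono) auto
    then have "\<epsilon> * \<epsilon> \<le> 1" using eps_pos by simp
    then show "8 / \<epsilon> \<le> 8 / \<epsilon> ^ 3" using eps_pos by (simp add: field_simps power3_eq_cube)
  qed
  finally show ?thesis by (simp add: k_def G_def)
qed

text \<open>The two ends are drawn independently, so the bridge is not a path of the chain, but each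
  defect involves only one of its steps. For the first step, the density of the second is bounded by
  \<open>1 / \<epsilon>\<close>. For the second step, the first is integrated into the law of
  \<open>X (Suc n)\<close>, and the law of the end point is dominated by \<open>\<mu>\<close> with
  the same factor.\<close>

lemma bridge_defect_mean:
  assumes f: "functional f" and cw: "phases c w"
  shows "(\<integral>\<^sup>+\<omega>'. \<integral>\<^sup>+\<omega>. ennreal ((bridge_defect f \<xi> c w n (X n \<omega>) (X (Suc (Suc n)) \<omega>'))\<^sup>2) \<partial>P \<partial>P) \<le>
    ennreal ((8 / \<epsilon> ^ 4) * ((sq_defect f \<xi> c w n) +
       (sq_defect f \<xi> c w (Suc n))))"
proof -
  note [measurable (raw)] = measurable_comp_pair[OF functional_measurable[OF f]]
    measurable_comp_pair[OF defect_measurable[OF f cw]] measurable_comp_pair[OF bridge_defect_measurable[OF f cw]]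
  note [measurable] = adapted[of "Suc n" "Suc n", simplified] adapted[of n n, simplified]
  interpret PP: pair_prob_space P "\<mu> (Suc (Suc n))" ..
  define D where "D m x y = ennreal ((defect f \<xi> c w m x y)\<^sup>2)" for m x y
  have [measurable]: "(\<lambda>(x, y). D m x y) \<in> borel_measurable (B m \<Otimes>\<^sub>M B (Suc m))" for m unfolding D_def by measurable
  note [measurable (raw)] = measurable_comp_pair[OF this]
  have D_int: "(\<integral>\<^sup>+\<omega>. D m (X m \<omega>) (X (Suc m) \<omega>) \<partial>P) = ennreal (sq_defect f \<xi> c w m)" for m
    unfolding D_def
    by (intro nn_integral_eq_integral integrable_bounded_measurable bounded_measurable_power2 defect_X_bounded f cw) auto
  have comb: "ennreal a * (ennreal b * ennreal s + ennreal b * ennreal t) = ennreal (a * (b * s + b * t))"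
    if "0 \<le> a" "0 \<le> b" "0 \<le> s" "0 \<le> t" for a b s t
    using that by (simp add: ennreal_mult)
  have pt: "ennreal ((bridge_defect f \<xi> c w n x z)\<^sup>2) \<le> ennreal (8 / \<epsilon> ^ 3) *
     ((\<integral>\<^sup>+v. ennreal (p n x v) * (ennreal (p (Suc n) v z) * D n x v) \<partial>\<mu> (Suc n)) +
      (\<integral>\<^sup>+v. ennreal (p n x v) * (ennreal (p (Suc n) v z) * D (Suc n) v z) \<partial>\<mu> (Suc n)))"
    if x: "x \<in> space (B n)" and z: "z \<in> space (B (Suc (Suc n)))" for x z
  proof -
    note [measurable] = x z
    let ?G = "\<lambda>v. (defect f \<xi> c w n x v)\<^sup>2 + (defect f \<xi> c w (Suc n) v z)\<^sup>2"
    have G8: "norm (?G v) \<le> 8" for v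
      using defect_sq_le[OF cw, of f \<xi> n x v] defect_sq_le[OF cw, of f \<xi> "Suc n" v z] by simp
    have "ennreal ((bridge_defect f \<xi> c w n x z)\<^sup>2) \<le> ennreal (8 / \<epsilon> ^ 3 * (\<integral>v. (p n x v * p (Suc n) v z) * ?G v \<partial>\<mu> (Suc n)))"
      by (intro ennreal_leI bridge_defect_le f cw x z)
    also have "\<dots> = ennreal (8 / \<epsilon> ^ 3) * ennreal (\<integral>v. (p n x v * p (Suc n) v z) * ?G v \<partial>\<mu> (Suc n))"
      using eps_pos by (intro ennreal_mult) auto
    also have "ennreal (\<integral>v. (p n x v * p (Suc n) v z) * ?G v \<partial>\<mu> (Suc n)) = (\<integral>\<^sup>+v. ennreal ((p n x v * p (Suc n) v z) * ?G v) \<partial>\<mu> (Suc n))"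
      using pp_mult_integrable[OF x z, of ?G 8] G8 by (intro nn_integral_eq_integral[symmetric]) auto
    also have "\<dots> = (\<integral>\<^sup>+v. ennreal (p n x v) * (ennreal (p (Suc n) v z) * D n x v) + ennreal (p n x v) * (ennreal (p (Suc n) v z) * D (Suc n) v z) \<partial>\<mu> (Suc n))"
      by (intro nn_integral_cong) (simp add: D_def ennreal_mult distrib_left mult.assoc)
    also have "\<dots> = (\<integral>\<^sup>+v. ennreal (p n x v) * (ennreal (p (Suc n) v z) * D n x v) \<partial>\<mu> (Suc n)) +
      (\<integral>\<^sup>+v. ennreal (p n x v) * (ennreal (p (Suc n) v z) * D (Suc n) v z) \<partial>\<mu> (Suc n))"
      by (rule nn_integral_add) measurable
    finally show ?thesis .
  qed
  let ?I = "\<lambda>\<omega>' \<omega>. (\<integral>\<^sup>+v. ennreal (p n (X n \<omega>) v) * (ennreal (p (Suc n) v (X (Suc (Suc n)) \<omega>')) * D n (X n \<omega>) v) \<partial>\<mu> (Suc n))"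
  let ?J = "\<lambda>\<omega>' \<omega>. (\<integral>\<^sup>+v. ennreal (p n (X n \<omega>) v) * (ennreal (p (Suc n) v (X (Suc (Suc n)) \<omega>')) * D (Suc n) v (X (Suc (Suc n)) \<omega>')) \<partial>\<mu> (Suc n))"
  have I: "(\<integral>\<^sup>+\<omega>'. \<integral>\<^sup>+\<omega>. ?I \<omega>' \<omega> \<partial>P \<partial>P) \<le> ennreal (1 / \<epsilon>) * (\<integral>\<^sup>+\<omega>. D n (X n \<omega>) (X (Suc n) \<omega>) \<partial>P)"
  proof -
    have "(\<integral>\<^sup>+\<omega>'. \<integral>\<^sup>+\<omega>. ?I \<omega>' \<omega> \<partial>P \<partial>P) \<le> (\<integral>\<^sup>+\<omega>'. \<integral>\<^sup>+\<omega>. \<integral>\<^sup>+v. ennreal (p n (X n \<omega>) v) * (ennreal (1 / \<epsilon>) * D n (X n \<omega>) v) \<partial>\<mu> (Suc n) \<partial>P \<partial>P)"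
      by (intro nn_integral_mono mult_left_mono mult_right_mono ennreal_leI p_le) auto
    also have "\<dots> = (\<integral>\<^sup>+\<omega>. \<integral>\<^sup>+v. ennreal (p n (X n \<omega>) v) * (ennreal (1 / \<epsilon>) * D n (X n \<omega>) v) \<partial>\<mu> (Suc n) \<partial>P)"
      by (simp add: emeasure_space_1)
    also have "\<dots> = (\<integral>\<^sup>+\<omega>. ennreal (1 / \<epsilon>) * D n (X n \<omega>) (X (Suc n) \<omega>) \<partial>P)"
      by (rule nn_kernel_pair[symmetric]) measurable
    also have "\<dots> = ennreal (1 / \<epsilon>) * (\<integral>\<^sup>+\<omega>. D n (X n \<omega>) (X (Suc n) \<omega>) \<partial>P)"
      by (rule nn_integral_cmult) measurable
    finally show ?thesis .
  qed
  have J: "(\<integral>\<^sup>+\<omega>'. \<integral>\<^sup>+\<omega>. ?J \<omega>' \<omega> \<partial>P \<partial>P) \<le> ennreal (1 / \<epsilon>) * (\<integral>\<^sup>+\<omega>. D (Suc n) (X (Suc n) \<omega>) (X (Suc (Suc n)) \<omega>) \<partial>P)"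
  proof -
    have "(\<integral>\<^sup>+\<omega>'. \<integral>\<^sup>+\<omega>. ?J \<omega>' \<omega> \<partial>P \<partial>P) =
      (\<integral>\<^sup>+\<omega>'. \<integral>\<^sup>+\<omega>. ennreal (p (Suc n) (X (Suc n) \<omega>) (X (Suc (Suc n)) \<omega>')) * D (Suc n) (X (Suc n) \<omega>) (X (Suc (Suc n)) \<omega>') \<partial>P \<partial>P)"
    proof (rule nn_integral_cong)
      fix \<omega>' assume "\<omega>' \<in> space P"
      then have [measurable]: "X (Suc (Suc n)) \<omega>' \<in> space (B (Suc (Suc n)))" by simp
      show "(\<integral>\<^sup>+\<omega>. ?J \<omega>' \<omega> \<partial>P) = (\<integral>\<^sup>+\<omega>. ennreal (p (Suc n) (X (Suc n) \<omega>) (X (Suc (Suc n)) \<omega>')) * D (Suc n) (X (Suc n) \<omega>) (X (Suc (Suc n)) \<omega>') \<partial>P)"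
        by (rule nn_kernel_pair[symmetric]) measurable
    qed
    also have "\<dots> \<le> ennreal (1 / \<epsilon>) * (\<integral>\<^sup>+z. \<integral>\<^sup>+\<omega>. ennreal (p (Suc n) (X (Suc n) \<omega>) z) * D (Suc n) (X (Suc n) \<omega>) z \<partial>P \<partial>\<mu> (Suc (Suc n)))"
      by (rule nn_law_le) measurable
    also have "(\<integral>\<^sup>+z. \<integral>\<^sup>+\<omega>. ennreal (p (Suc n) (X (Suc n) \<omega>) z) * D (Suc n) (X (Suc n) \<omega>) z \<partial>P \<partial>\<mu> (Suc (Suc n))) =
        (\<integral>\<^sup>+\<omega>. \<integral>\<^sup>+z. ennreal (p (Suc n) (X (Suc n) \<omega>) z) * D (Suc n) (X (Suc n) \<omega>) z \<partial>\<mu> (Suc (Suc n)) \<partial>P)"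
      by (rule PP.Fubini') measurable
    also have "\<dots> = (\<integral>\<^sup>+\<omega>. D (Suc n) (X (Suc n) \<omega>) (X (Suc (Suc n)) \<omega>) \<partial>P)"
      by (rule nn_kernel_pair[symmetric]) measurable
    finally show ?thesis .
  qed
  have "(\<integral>\<^sup>+\<omega>'. \<integral>\<^sup>+\<omega>. ennreal ((bridge_defect f \<xi> c w n (X n \<omega>) (X (Suc (Suc n)) \<omega>'))\<^sup>2) \<partial>P \<partial>P) \<le>
      (\<integral>\<^sup>+\<omega>'. \<integral>\<^sup>+\<omega>. ennreal (8 / \<epsilon> ^ 3) * (?I \<omega>' \<omega> + ?J \<omega>' \<omega>) \<partial>P \<partial>P)"
    by (intro nn_integral_mono pt) auto
  also have "\<dots> = ennreal (8 / \<epsilon> ^ 3) * ((\<integral>\<^sup>+\<omega>'. \<integral>\<^sup>+\<omega>. ?I \<omega>' \<omega> \<partial>P \<partial>P) + (\<integral>\<^sup>+\<omega>'. \<integral>\<^sup>+\<omega>. ?J \<omega>' \<omega> \<partial>P \<partial>P))"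
    by (simp add: nn_integral_cmult nn_integral_add cong: nn_integral_cong)
  also have "\<dots> \<le> ennreal (8 / \<epsilon> ^ 3) * (ennreal (1 / \<epsilon>) * (\<integral>\<^sup>+\<omega>. D n (X n \<omega>) (X (Suc n) \<omega>) \<partial>P) +
     ennreal (1 / \<epsilon>) * (\<integral>\<^sup>+\<omega>. D (Suc n) (X (Suc n) \<omega>) (X (Suc (Suc n)) \<omega>) \<partial>P))"
    by (intro mult_left_mono add_mono I J) simp
  also have "\<dots> = ennreal ((8 / \<epsilon> ^ 3) * ((1 / \<epsilon>) * (sq_defect f \<xi> c w n) +
     (1 / \<epsilon>) * (sq_defect f \<xi> c w (Suc n))))"
    unfolding D_int using eps_pos
    by (intro comb) (use eps_pos in auto)
  also have "(8 / \<epsilon> ^ 3) * ((1 / \<epsilon>) * s + (1 / \<epsilon>) * t) = (8 / \<epsilon> ^ 4) * (s + t)" for s t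
    using eps_pos by (simp add: field_simps power_eq_if)
  finally show ?thesis .
qed

end

text \<open>The chord is \<open>2 * |sin (t / 2)|\<close>. For \<open>0 \<le> y \<le> 2\<close> the
  cubic Taylor bound gives \<open>sin y \<ge> y - y ^ 3 / 6 \<ge> y / 3\<close>, and half of \<pi>
  is below 2.\<close>

lemma abs_le_cis_minus_one:
  assumes "\<bar>t\<bar> \<le> pi"
  shows "\<bar>t\<bar> \<le> 3 * cmod (cis t - 1)"
proof -
  define y where "y = \<bar>t\<bar> / 2"
  have y: "0 \<le> y" "y \<le> 2" using assms pi_less_4 by (auto simp: y_def)
  have "y ^ 3 = y * y * y" by (simp add: power3_eq_cube)
  also have "\<dots> \<le> 2 * 2 * y" using y mult_mono[of y 2 y 2] by (intro mult_right_mono) auto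
  finally have "y ^ 3 / 6 \<le> (2 / 3) * y" by simp
  moreover have "\<bar>sin y - y\<bar> \<le> y ^ 3 / 6"
  proof -
    have "(\<Sum>m<3. sin_coeff m * y ^ m) = y" by (simp add: numeral_3_eq_3 sin_coeff_def)
    moreover have "fact 3 = (6 :: real)" by (simp add: fact_numeral)
    ultimately show ?thesis
      using Maclaurin_sin_bound[of y 3] y(1) by (simp only: abs_of_nonneg divide_inverse mult.commute)
  qed
  ultimately have "y \<le> 3 * sin y" by linarith
  moreover have "cmod (cis t - 1) = 2 * \<bar>sin (t / 2)\<bar>"
    using dist_exp_i_1[of t] by (simp add: cis_conv_exp)
  moreover have "sin y \<le> \<bar>sin (t / 2)\<bar>" by (cases "0 \<le> t") (auto simp: y_def)
  ultimately show ?thesis by (simp add: y_def)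
qed

text \<open>A narrow sector is a convex cone, so it contains weighted means of its phases. Rotating
  either edge onto the real axis turns this into the sign of an integral of a sine; the positive
  real part keeps the argument away from the cut. Such bounds rule out multiples of
  \<open>2\<pi>\<close> when \<open>\<xi> * f\<close> is small.\<close>

lemma Arg_integral_le:
  fixes g \<beta> :: "'a \<Rightarrow> real"
  assumes g: "integrable M g" "\<And>x. 0 \<le> g x" "0 < (\<integral>x. g x \<partial>M)" and [measurable]: "\<beta> \<in> borel_measurable M"
    and \<beta>: "\<And>x. x \<in> space M \<Longrightarrow> \<bar>\<beta> x\<bar> \<le> b" and b: "0 \<le> b" "b \<le> 1 / 2"
  shows "\<bar>Arg (\<integral>x. g x *\<^sub>R cis (\<beta> x) \<partial>M)\<bar> \<le> b"
proof -
  have [measurable]: "g \<in> borel_measurable M" using g(1) by simp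
  define J where "J = (\<integral>x. g x *\<^sub>R cis (\<beta> x) \<partial>M)"
  have i: "integrable M (\<lambda>x. g x *\<^sub>R cis (\<beta> x))"
    by (rule Bochner_Integration.integrable_bound[OF g(1)]) auto
  have isin: "integrable M (\<lambda>x. g x * sin (\<beta> x + s))" and icos: "integrable M (\<lambda>x. g x * cos (\<beta> x))" for s
    using g(2) by (auto intro!: Bochner_Integration.integrable_bound[OF g(1)] AE_I2 simp: abs_mult mult_left_le)
  have b_pi: "b < pi / 2" using b pi_ge_two by linarith
  have "0 < cos b * (\<integral>x. g x \<partial>M)" using g(3) b b_pi by (intro mult_pos_pos cos_gt_zero_pi) auto
  also have "\<dots> = (\<integral>x. cos b * g x \<partial>M)" by simp
  also have "\<dots> \<le> (\<integral>x. g x * cos (\<beta> x) \<partial>M)"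
  proof (rule integral_mono[OF _ icos])
    fix x assume "x \<in> space M"
    then have "cos b \<le> cos \<bar>\<beta> x\<bar>" using \<beta>[of x] b b_pi by (intro cos_monotone_0_pi_le) auto
    then show "cos b * g x \<le> g x * cos (\<beta> x)" using mult_right_mono[OF _ g(2), of "cos b" "cos (\<beta> x)" x] by (simp add: mult.commute)
  qed (use g in simp)
  also have "\<dots> = Re J" unfolding J_def by (subst integral_Re[OF i, symmetric]) simp
  finally have Re: "0 < Re J" .
  have Im: "cmod J * sin (Arg J + s) = (\<integral>x. g x * sin (\<beta> x + s) \<partial>M)" for s
  proof -
    have "cis s * J = (\<integral>x. cis s * (g x *\<^sub>R cis (\<beta> x)) \<partial>M)"
      unfolding J_def by (rule integral_mult_right_zero[symmetric])
    also have "\<dots> = (\<integral>x. g x *\<^sub>R cis (\<beta> x + s) \<partial>M)" by (simp add: cis_mult add.commute)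
    finally have "Im (cis s * J) = (\<integral>x. Im (g x *\<^sub>R cis (\<beta> x + s)) \<partial>M)"
      by (subst integral_Im) (auto intro!: Bochner_Integration.integrable_bound[OF g(1)])
    moreover have "Im (cis s * J) = cmod J * sin (Arg J + s)"
    proof -
      have "cis s * J = cis s * (cmod J *\<^sub>R cis (Arg J))"
        using rcis_cmod_Arg[of J] by (simp add: rcis_def scaleR_conv_of_real)
      also have "\<dots> = cmod J *\<^sub>R cis (Arg J + s)" by (simp add: cis_mult add.commute)
      finally show ?thesis by simp
    qed
    ultimately show ?thesis by simp
  qed
  have J0: "0 < cmod J" using Re by auto
  have "Arg J \<le> b"
  proof (rule ccontr)
    assume "\<not> Arg J \<le> b"
    moreover have "Arg J < pi" using Arg_le_pi[of J] Arg_eq_pi[of J] Re by (cases "Arg J = pi") auto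
    ultimately have "0 < sin (Arg J + - b)" using b by (intro sin_gt_zero) auto
    then have "0 < (\<integral>x. g x * sin (\<beta> x + - b) \<partial>M)" using J0 Im[of "- b"] by (metis mult_pos_pos)
    moreover have "(\<integral>x. g x * sin (\<beta> x + - b) \<partial>M) \<le> (\<integral>x. 0 \<partial>M)"
    proof (rule integral_mono[OF isin])
      fix x assume "x \<in> space M"
      then have "0 \<le> sin (- (\<beta> x + - b))" using \<beta>[of x] b b_pi by (intro sin_ge_zero) auto
      then have "sin (\<beta> x + - b) \<le> 0" by (simp only: sin_minus)
      then show "g x * sin (\<beta> x + - b) \<le> 0" using g(2)[of x] by (simp add: mult_nonneg_nonpos)
    qed simp
    ultimately show False by simp
  qed
  moreover have "- b \<le> Arg J"
  proof (rule ccontr)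
    assume "\<not> - b \<le> Arg J"
    then have "0 < sin (- (Arg J + b))" using b mpi_less_Arg[of J] by (intro sin_gt_zero) auto
    then have "sin (Arg J + b) < 0" by (simp only: sin_minus)
    then have "(\<integral>x. g x * sin (\<beta> x + b) \<partial>M) < 0" using J0 Im[of b] by (metis mult_pos_neg)
    moreover have "(\<integral>x. 0 \<partial>M) \<le> (\<integral>x. g x * sin (\<beta> x + b) \<partial>M)"
    proof (rule integral_mono[OF _ isin])
      fix x assume "x \<in> space M"
      then have "0 \<le> sin (\<beta> x + b)" using \<beta>[of x] b b_pi by (intro sin_ge_zero) auto
      then show "0 \<le> g x * sin (\<beta> x + b)" using g(2)[of x] by simp
    qed simp
    ultimately show False by simp
  qed
  ultimately show ?thesis by (simp add: J_def)
qed

section \<open>A coboundary for all times, and the decomposition modulo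
  \<open>2\<pi>\<close>\<close>

context elliptic_chain
begin

text \<open>What is left of \<open>exp (\<i> \<xi> f)\<close> after the bridge phases towards
  \<open>z\<close> and \<open>z'\<close> are removed as a coboundary. For an exact multiplicative
  coboundary it would not depend on \<open>x\<close> and \<open>y\<close>.\<close>

definition twist :: "(nat \<Rightarrow> 'a \<Rightarrow> 'a \<Rightarrow> real) \<Rightarrow> real \<Rightarrow> nat \<Rightarrow> 'a \<Rightarrow> 'a \<Rightarrow> 'a \<Rightarrow> 'a \<Rightarrow> complex" where
  "twist f \<xi> n z z' x y = cis (\<xi> * f n x y + Arg (bridge f \<xi> (Suc n) y z') - Arg (bridge f \<xi> n x z))"

text \<open>The constants of a coboundary are free, so the error that counts is the distance to the
  best constant, whose square is the variance.\<close>

definition twist_var :: "(nat \<Rightarrow> 'a \<Rightarrow> 'a \<Rightarrow> real) \<Rightarrow> real \<Rightarrow> nat \<Rightarrow> 'a \<Rightarrow> 'a \<Rightarrow> real" where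
  "twist_var f \<xi> n z z' = (\<integral>\<omega>. (cmod (twist f \<xi> n z z' (X n \<omega>) (X (Suc n) \<omega>) -
     (\<integral>\<omega>'. twist f \<xi> n z z' (X n \<omega>') (X (Suc n) \<omega>') \<partial>P)))\<^sup>2 \<partial>P)"

lemma twist_measurable:
  assumes f: "functional f" and z: "z \<in> space (B (Suc (Suc n)))" "z' \<in> space (B (Suc (Suc (Suc n))))"
  shows "(\<lambda>(x, y). twist f \<xi> n z z' x y) \<in> borel_measurable (B n \<Otimes>\<^sub>M B (Suc n))"
proof -
  note [measurable] = z
  note [measurable (raw)] = measurable_comp_pair[OF functional_measurable[OF f]] measurable_comp_pair[OF bridge_measurable[OF f]]
  show ?thesis unfolding twist_def by measurable
qed

lemma twist_var_measurable:
  assumes f: "functional f"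
  shows "(\<lambda>\<omega>'. twist_var f \<xi> n (X (Suc (Suc n)) \<omega>') (X (Suc (Suc (Suc n))) \<omega>')) \<in> borel_measurable P"
proof -
  note [measurable (raw)] = measurable_comp_pair[OF functional_measurable[OF f]] measurable_comp_pair[OF bridge_measurable[OF f]]
  show ?thesis unfolding twist_var_def twist_def by measurable
qed

text \<open>Each of the three factors of the twist is close to its prediction by \<open>c\<close>
  and \<open>w\<close>. In the product of the predictions everything depending on \<open>x\<close>
  and \<open>y\<close> cancels, and the constant \<open>\<kappa>\<close> that remains bounds the
  variance by minimality.\<close>

lemma twist_var_le:
  assumes f: "functional f" and cw: "phases c w"
    and z: "z \<in> space (B (Suc (Suc n)))" and z': "z' \<in> space (B (Suc (Suc (Suc n))))"
  shows "ennreal (twist_var f \<xi> n z z') \<le> 3 *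
    ((\<integral>\<^sup>+\<omega>. ennreal ((defect f \<xi> c w n (X n \<omega>) (X (Suc n) \<omega>))\<^sup>2) \<partial>P) +
     (\<integral>\<^sup>+\<omega>. ennreal ((bridge_defect f \<xi> c w n (X n \<omega>) z)\<^sup>2) \<partial>P) +
     (\<integral>\<^sup>+\<omega>. ennreal ((bridge_defect f \<xi> c w (Suc n) (X (Suc n) \<omega>) z')\<^sup>2) \<partial>P))"
proof -
  note [measurable] = z z'
  note [measurable (raw)] = measurable_comp_pair[OF defect_measurable[OF f cw]]
    measurable_comp_pair[OF bridge_defect_measurable[OF f cw]] measurable_comp_pair[OF twist_measurable[OF f z z']]
  define \<kappa> where "\<kappa> = c (Suc (Suc n)) * w (Suc (Suc n)) z * cnj (w (Suc (Suc (Suc n))) z')"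
  have unit: "cmod (c m) = 1" "cmod (w m y) = 1" for m y using cw by (auto simp: phases_def)
  let ?t = "\<lambda>\<omega>. twist f \<xi> n z z' (X n \<omega>) (X (Suc n) \<omega>)"
  have t1: "cmod (?t \<omega>) = 1" for \<omega> by (simp add: twist_def)
  have pt: "cmod (?t \<omega> - \<kappa>) \<le> defect f \<xi> c w n (X n \<omega>) (X (Suc n) \<omega>) +
      bridge_defect f \<xi> c w (Suc n) (X (Suc n) \<omega>) z' + bridge_defect f \<xi> c w n (X n \<omega>) z" for \<omega>
  proof -
    define x where "x = X n \<omega>"
    define y where "y = X (Suc n) \<omega>"
    define \<alpha> where "\<alpha> = c n * w n x * cnj (w (Suc n) y)"
    define \<kappa>0 where "\<kappa>0 = c n * c (Suc n) * w n x * cnj (w (Suc (Suc n)) z)"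
    define \<kappa>1 where "\<kappa>1 = c (Suc n) * c (Suc (Suc n)) * w (Suc n) y * cnj (w (Suc (Suc (Suc n))) z')"
    have tw: "?t \<omega> = cis (\<xi> * f n x y) * cis (Arg (bridge f \<xi> (Suc n) y z')) * cnj (cis (Arg (bridge f \<xi> n x z)))"
      by (simp add: twist_def x_def y_def cis_mult cis_cnj)
    have "\<alpha> * \<kappa>1 * cnj \<kappa>0 = (c n * cnj (c n)) * (c (Suc n) * cnj (c (Suc n))) * (w n x * cnj (w n x)) *
        (w (Suc n) y * cnj (w (Suc n) y)) * \<kappa>"
      by (simp add: \<alpha>_def \<kappa>0_def \<kappa>1_def \<kappa>_def mult_ac)
    then have "\<alpha> * \<kappa>1 * cnj \<kappa>0 = \<kappa>" by (simp add: cmod_unit_mult_cnj unit)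
    then have "cmod (?t \<omega> - \<kappa>) = cmod (cis (\<xi> * f n x y) * cis (Arg (bridge f \<xi> (Suc n) y z')) * cnj (cis (Arg (bridge f \<xi> n x z))) - \<alpha> * \<kappa>1 * cnj \<kappa>0)"
      by (simp only: tw)
    also have "\<dots> \<le> cmod (cis (\<xi> * f n x y) * cis (Arg (bridge f \<xi> (Suc n) y z')) - \<alpha> * \<kappa>1) + cmod (cnj (cis (Arg (bridge f \<xi> n x z))) - cnj \<kappa>0)"
      by (rule cmod_mult_diff_le) (simp_all add: \<alpha>_def \<kappa>1_def norm_mult unit)
    also have "cmod (cis (\<xi> * f n x y) * cis (Arg (bridge f \<xi> (Suc n) y z')) - \<alpha> * \<kappa>1) \<le>
        cmod (cis (\<xi> * f n x y) - \<alpha>) + cmod (cis (Arg (bridge f \<xi> (Suc n) y z')) - \<kappa>1)"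
      by (rule cmod_mult_diff_le) (simp_all add: \<alpha>_def norm_mult unit)
    also have "cmod (cis (\<xi> * f n x y) - \<alpha>) = defect f \<xi> c w n x y"
    proof -
      have "cis (\<xi> * f n x y) * w (Suc n) y - c n * w n x = (cis (\<xi> * f n x y) - \<alpha>) * w (Suc n) y"
        using cmod_unit_mult_cnj(2)[OF unit(2)[of "Suc n" y]] by (simp add: \<alpha>_def left_diff_distrib mult.assoc)
      then show ?thesis by (simp add: defect_def norm_mult unit)
    qed
    also have "cmod (cnj (cis (Arg (bridge f \<xi> n x z))) - cnj \<kappa>0) = bridge_defect f \<xi> c w n x z"
      unfolding bridge_defect_def \<kappa>0_def[symmetric] by (metis complex_cnj_diff complex_mod_cnj)
    finally show ?thesis by (simp add: bridge_defect_def \<kappa>1_def x_def y_def)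
  qed
  have "twist_var f \<xi> n z z' \<le> (\<integral>\<omega>. (cmod (?t \<omega> - \<kappa>))\<^sup>2 \<partial>P)"
    unfolding twist_var_def by (rule variance_minimal[where C = 1]) (measurable, simp add: t1)
  also have "ennreal \<dots> = (\<integral>\<^sup>+\<omega>. ennreal ((cmod (?t \<omega> - \<kappa>))\<^sup>2) \<partial>P)"
    by (intro nn_integral_eq_integral[symmetric] integrable_bounded_measurable bounded_measurable_intros bounded_measurableI[of ?t _ 1]) (measurable, auto simp: t1)
  also have "\<dots> \<le> (\<integral>\<^sup>+\<omega>. 3 * (ennreal ((defect f \<xi> c w n (X n \<omega>) (X (Suc n) \<omega>))\<^sup>2) +
     ennreal ((bridge_defect f \<xi> c w n (X n \<omega>) z)\<^sup>2) + ennreal ((bridge_defect f \<xi> c w (Suc n) (X (Suc n) \<omega>) z')\<^sup>2)) \<partial>P)"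
  proof (rule nn_integral_mono)
    fix \<omega>
    let ?a = "defect f \<xi> c w n (X n \<omega>) (X (Suc n) \<omega>)" and ?b = "bridge_defect f \<xi> c w (Suc n) (X (Suc n) \<omega>) z'"
      and ?c = "bridge_defect f \<xi> c w n (X n \<omega>) z"
    have "(cmod (?t \<omega> - \<kappa>))\<^sup>2 \<le> (?a + ?b + ?c)\<^sup>2" using pt[of \<omega>] by (intro power_mono) auto
    also have "\<dots> \<le> 3 * (?a\<^sup>2 + ?b\<^sup>2 + ?c\<^sup>2)" by (rule power2_sum3_le)
    finally have "ennreal ((cmod (?t \<omega> - \<kappa>))\<^sup>2) \<le> ennreal (3 * (?a\<^sup>2 + ?b\<^sup>2 + ?c\<^sup>2))" by (rule ennreal_leI)
    also have "\<dots> = 3 * (ennreal (?a\<^sup>2) + ennreal (?c\<^sup>2) + ennreal (?b\<^sup>2))"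
      by (simp add: ennreal_mult add_ac)
    finally show "ennreal ((cmod (?t \<omega> - \<kappa>))\<^sup>2) \<le> \<dots>" .
  qed
  also have "\<dots> = 3 *
    ((\<integral>\<^sup>+\<omega>. ennreal ((defect f \<xi> c w n (X n \<omega>) (X (Suc n) \<omega>))\<^sup>2) \<partial>P) +
     (\<integral>\<^sup>+\<omega>. ennreal ((bridge_defect f \<xi> c w n (X n \<omega>) z)\<^sup>2) \<partial>P) +
     (\<integral>\<^sup>+\<omega>. ennreal ((bridge_defect f \<xi> c w (Suc n) (X (Suc n) \<omega>) z')\<^sup>2) \<partial>P))"
    by (simp add: nn_integral_cmult nn_integral_add)
  finally show ?thesis by (simp add: ennreal_leI)
qed

text \<open>
  The end points of the bridges are taken from an independent copy of the chain: its expected total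
  error is finite, so some trajectory works for all times simultaneously.
\<close>

lemma summable_twist_var:
  assumes f: "functional f" and \<xi>: "\<xi> \<in> corange f"
  obtains \<omega>' where "\<omega>' \<in> space P" "summable (\<lambda>n. twist_var f \<xi> n (X (Suc (Suc n)) \<omega>') (X (Suc (Suc (Suc n))) \<omega>'))"
proof -
  let ?T = "\<lambda>n \<omega>'. twist_var f \<xi> n (X (Suc (Suc n)) \<omega>') (X (Suc (Suc (Suc n))) \<omega>')"
  note [measurable] = twist_var_measurable[OF f]
  from \<xi> obtain C where C: "\<And>N. \<exists>c w. phases c w \<and>
     (\<Sum>n<N. sq_defect f \<xi> c w n) \<le> C" unfolding corange_def by blast
  define K where "K = 3 * (1 + 32 / \<epsilon> ^ 4) * C"
  \<comment> \<open>The phases \<open>c\<close> and \<open>w\<close> depend on \<open>N\<close> but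
    enter only this estimate; neither \<open>?T\<close> nor \<open>K\<close> involves them, so the
    limit of large \<open>N\<close> is harmless.\<close>
  have bound: "(\<Sum>n<N. \<integral>\<^sup>+\<omega>'. ennreal (?T n \<omega>') \<partial>P) \<le> ennreal K" for N
  proof -
    \<comment> \<open>Two extra steps of horizon, because the twist at time \<open>n\<close>
      involves the defects at times \<open>n\<close>, \<open>n + 1\<close> and
      \<open>n + 2\<close>.\<close>
    obtain c w where cw: "phases c w" and
      sC: "(\<Sum>n<N + 2. sq_defect f \<xi> c w n) \<le> C" using C by blast
    note [measurable (raw)] = measurable_comp_pair[OF defect_measurable[OF f cw]]
      measurable_comp_pair[OF bridge_defect_measurable[OF f cw]]
    define s where "s n = (sq_defect f \<xi> c w n)" for n
    have sC': "sum s {..<N + 2} \<le> C" using sC unfolding s_def .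
    have s0: "0 \<le> s n" for n by (simp add: s_def)
    have s_nn: "(\<integral>\<^sup>+\<omega>. ennreal ((defect f \<xi> c w n (X n \<omega>) (X (Suc n) \<omega>))\<^sup>2) \<partial>P) = ennreal (s n)" for n
      unfolding s_def
      by (intro nn_integral_eq_integral integrable_bounded_measurable bounded_measurable_power2 defect_X_bounded f cw) auto
    have comb: "3 * (ennreal u + ennreal v + ennreal t) = ennreal (3 * (u + v + t))"
      if "0 \<le> u" "0 \<le> v" "0 \<le> t" for u v t
      using that by (simp add: ennreal_mult)
    have one: "(\<integral>\<^sup>+\<omega>'. ennreal (?T n \<omega>') \<partial>P) \<le> ennreal (3 * (s n + (8 / \<epsilon> ^ 4) * (s n + s (Suc n)) + (8 / \<epsilon> ^ 4) * (s (Suc n) + s (Suc (Suc n)))))" for n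
    proof -
      have "(\<integral>\<^sup>+\<omega>'. ennreal (?T n \<omega>') \<partial>P) \<le> (\<integral>\<^sup>+\<omega>'. 3 * (ennreal (s n) +
         (\<integral>\<^sup>+\<omega>. ennreal ((bridge_defect f \<xi> c w n (X n \<omega>) (X (Suc (Suc n)) \<omega>'))\<^sup>2) \<partial>P) +
         (\<integral>\<^sup>+\<omega>. ennreal ((bridge_defect f \<xi> c w (Suc n) (X (Suc n) \<omega>) (X (Suc (Suc (Suc n))) \<omega>'))\<^sup>2) \<partial>P)) \<partial>P)"
        unfolding s_nn[symmetric] by (intro nn_integral_mono twist_var_le f cw) auto
      also have "\<dots> = 3 * (ennreal (s n) +
         (\<integral>\<^sup>+\<omega>'. \<integral>\<^sup>+\<omega>. ennreal ((bridge_defect f \<xi> c w n (X n \<omega>) (X (Suc (Suc n)) \<omega>'))\<^sup>2) \<partial>P \<partial>P) +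
         (\<integral>\<^sup>+\<omega>'. \<integral>\<^sup>+\<omega>. ennreal ((bridge_defect f \<xi> c w (Suc n) (X (Suc n) \<omega>) (X (Suc (Suc (Suc n))) \<omega>'))\<^sup>2) \<partial>P \<partial>P))"
        by (simp add: nn_integral_cmult nn_integral_add emeasure_space_1)
      also have "\<dots> \<le> 3 * (ennreal (s n) + ennreal ((8 / \<epsilon> ^ 4) * (s n + s (Suc n))) + ennreal ((8 / \<epsilon> ^ 4) * (s (Suc n) + s (Suc (Suc n)))))"
        unfolding s_def by (intro mult_left_mono add_mono bridge_defect_mean f cw) auto
      also have "\<dots> = ennreal (3 * (s n + (8 / \<epsilon> ^ 4) * (s n + s (Suc n)) + (8 / \<epsilon> ^ 4) * (s (Suc n) + s (Suc (Suc n)))))"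
        by (rule comb) (use s0 eps_pos in auto)
      finally show ?thesis .
    qed
    have "(\<Sum>n<N. \<integral>\<^sup>+\<omega>'. ennreal (?T n \<omega>') \<partial>P) \<le> (\<Sum>n<N. ennreal (3 * (s n + (8 / \<epsilon> ^ 4) * (s n + s (Suc n)) + (8 / \<epsilon> ^ 4) * (s (Suc n) + s (Suc (Suc n))))))"
      by (intro sum_mono one)
    also have "\<dots> = ennreal (\<Sum>n<N. 3 * (s n + (8 / \<epsilon> ^ 4) * (s n + s (Suc n)) + (8 / \<epsilon> ^ 4) * (s (Suc n) + s (Suc (Suc n)))))"
      using s0 eps_pos by (intro sum_ennreal) auto
    also have "(\<Sum>n<N. 3 * (s n + (8 / \<epsilon> ^ 4) * (s n + s (Suc n)) + (8 / \<epsilon> ^ 4) * (s (Suc n) + s (Suc (Suc n))))) =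
        3 * ((\<Sum>n<N. s n) + (8 / \<epsilon> ^ 4) * ((\<Sum>n<N. s n) + (\<Sum>n<N. s (Suc n))) + (8 / \<epsilon> ^ 4) * ((\<Sum>n<N. s (Suc n)) + (\<Sum>n<N. s (Suc (Suc n)))))"
      by (simp only: sum.distrib flip: sum_distrib_left)
    also have "\<dots> \<le> 3 * (C + (8 / \<epsilon> ^ 4) * (C + C) + (8 / \<epsilon> ^ 4) * (C + C))"
    proof -
      have "sum s {..<N + 2} = s 0 + s 1 + (\<Sum>n<N. s (Suc (Suc n)))"
        by (simp add: sum.lessThan_Suc_shift[of _ "Suc N"] sum.lessThan_Suc_shift[of _ "N"] del: sum.lessThan_Suc)
      then have 2: "(\<Sum>n<N. s (Suc (Suc n))) \<le> C" using sC' s0[of 0] s0[of 1] by linarith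
      have "sum s {..<N + 2} = sum s {..<Suc N} + s (Suc N)" by simp
      also have "sum s {..<Suc N} = s 0 + (\<Sum>n<N. s (Suc n))" by (rule sum.lessThan_Suc_shift)
      finally have 1: "(\<Sum>n<N. s (Suc n)) \<le> C" using sC' s0[of 0] s0[of "Suc N"] by linarith
      have 0: "(\<Sum>n<N. s n) \<le> C" using sC' s0[of N] s0[of "Suc N"] by simp
      show ?thesis using 0 1 2 eps_pos by (intro mult_left_mono add_mono) auto
    qed
    also have "\<dots> = K" by (simp add: K_def field_simps)
    finally show ?thesis by (simp add: ennreal_leI)
  qed
  have "(\<integral>\<^sup>+\<omega>'. (\<Sum>n. ennreal (?T n \<omega>')) \<partial>P) = (\<Sum>n. \<integral>\<^sup>+\<omega>'. ennreal (?T n \<omega>') \<partial>P)"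
    by (rule nn_integral_suminf) measurable
  also have "\<dots> \<le> ennreal K" by (intro suminf_le_const bound summableI)
  finally have "(\<integral>\<^sup>+\<omega>'. (\<Sum>n. ennreal (?T n \<omega>')) \<partial>P) \<noteq> \<infinity>" by (auto simp: top_unique)
  then have "AE \<omega>' in P. (\<Sum>n. ennreal (?T n \<omega>')) \<noteq> \<infinity>"
    by (intro nn_integral_PInf_AE) auto
  then have "AE \<omega>' in P. \<omega>' \<in> space P \<and> (\<Sum>n. ennreal (?T n \<omega>')) \<noteq> \<infinity>" by simp
  then obtain \<omega>' where "\<omega>' \<in> space P" "(\<Sum>n. ennreal (?T n \<omega>')) \<noteq> \<infinity>"
    using eventually_happens'[OF ae_filter_bot] by blast
  then show ?thesis
    by (intro that[of \<omega>'] summable_suminf_not_top) (auto simp: twist_var_def)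
qed

text \<open>\<open>a\<close> is the phase of the bridges that end on one fixed good trajectory,
  \<open>\<gamma>\<close> the phase of the mean of the twist, and \<open>\<theta>\<close> the
  remaining angle. The last clause excludes the multiple of \<open>2\<pi>\<close> for small
  \<open>\<xi> * f\<close>; it is what makes the reduced functional vanish when the co-range has
  small elements.\<close>

theorem corange_decomposition:
  assumes f: "functional f" and \<xi>: "\<xi> \<in> corange f"
  obtains a \<gamma> \<theta> where "\<And>n. a n \<in> borel_measurable (B n)" "\<And>n x. \<bar>a n x\<bar> \<le> pi" "\<And>n. \<bar>\<gamma> n\<bar> \<le> pi"
    "functional \<theta>" "\<And>n x y. \<bar>\<theta> n x y\<bar> \<le> pi"
    "summable (\<lambda>n. \<integral>\<omega>. (\<theta> n (X n \<omega>) (X (Suc n) \<omega>))\<^sup>2 \<partial>P)"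
    "\<And>n x y. \<exists>k::int. \<xi> * f n x y = a n x - a (Suc n) y + \<gamma> n + \<theta> n x y + 2 * pi * of_int k"
    "(\<And>n x y. x \<in> space (B n) \<Longrightarrow> y \<in> space (B (Suc n)) \<Longrightarrow> \<bar>\<xi> * f n x y\<bar> \<le> 1 / 10) \<Longrightarrow>
      (\<And>n x y. x \<in> space (B n) \<Longrightarrow> y \<in> space (B (Suc n)) \<Longrightarrow> \<xi> * f n x y = a n x - a (Suc n) y + \<gamma> n + \<theta> n x y)"
proof -
  obtain \<omega>' where \<omega>': "\<omega>' \<in> space P" and
    summ: "summable (\<lambda>n. twist_var f \<xi> n (X (Suc (Suc n)) \<omega>') (X (Suc (Suc (Suc n))) \<omega>'))"
    by (rule summable_twist_var[OF f \<xi>])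
  define z where "z n = X (Suc (Suc n)) \<omega>'" for n
  have z [measurable]: "z n \<in> space (B (Suc (Suc n)))" for n using \<omega>' by (simp add: z_def)
  note [measurable (raw)] = measurable_comp_pair[OF functional_measurable[OF f]] measurable_comp_pair[OF bridge_measurable[OF f]]
  define a where "a n x = Arg (bridge f \<xi> n x (z n))" for n x
  define t where "t n x y = twist f \<xi> n (z n) (z (Suc n)) x y" for n x y
  have t_eq: "t n x y = cis (\<xi> * f n x y + a (Suc n) y - a n x)" for n x y
    by (simp add: t_def twist_def a_def)
  have t_meas: "(\<lambda>(x, y). t n x y) \<in> borel_measurable (B n \<Otimes>\<^sub>M B (Suc n))" for n
    unfolding t_def by (rule twist_measurable[OF f z z])
  note [measurable (raw)] = measurable_comp_pair[OF t_meas]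
  define c where "c n = (\<integral>\<omega>. t n (X n \<omega>) (X (Suc n) \<omega>) \<partial>P)" for n
  define \<gamma> where "\<gamma> n = Arg (c n)" for n
  define \<theta> where "\<theta> n x y = Arg (t n x y * cis (- \<gamma> n))" for n x y
  have Arg_abs: "\<bar>Arg u\<bar> \<le> pi" for u using mpi_less_Arg[of u] Arg_le_pi[of u] by auto
  have am [measurable]: "a n \<in> borel_measurable (B n)" for n unfolding a_def by measurable
  have \<theta>f: "functional \<theta>" unfolding functional_def \<theta>_def by measurable
  note [measurable (raw)] = measurable_comp_pair[OF functional_measurable[OF \<theta>f]]
  have cis\<theta>: "cis (\<theta> n x y) = t n x y * cis (- \<gamma> n)" for n x y
  proof -
    have "cmod (t n x y * cis (- \<gamma> n)) = 1" by (simp add: t_eq norm_mult)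
    then show ?thesis unfolding \<theta>_def by (subst cis_Arg) (auto simp: sgn_div_norm)
  qed
  have bt: "bounded_measurable P (\<lambda>\<omega>. t n (X n \<omega>) (X (Suc n) \<omega>))" for n
    by (rule bounded_measurableI[of _ _ 1]) (auto simp: t_eq)
  have b\<theta>: "bounded_measurable P (\<lambda>\<omega>. \<theta> n (X n \<omega>) (X (Suc n) \<omega>))" for n
    by (rule bounded_measurableI[of _ _ pi]) (auto simp: \<theta>_def Arg_abs)
  \<comment> \<open>A factor 3 from arc against chord and a factor 2 from replacing
    \<open>c n\<close> by its phase, squared.\<close>
  have \<theta>_le: "(\<theta> n x y)\<^sup>2 \<le> 36 * (cmod (t n x y - c n))\<^sup>2" for n x y
  proof -
    have "\<bar>\<theta> n x y\<bar> \<le> 3 * cmod (cis (\<theta> n x y) - 1)"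
      by (rule abs_le_cis_minus_one) (simp add: \<theta>_def Arg_abs)
    also have "cis (\<theta> n x y) - 1 = (t n x y - cis (\<gamma> n)) * cis (- \<gamma> n)"
      by (simp add: cis\<theta> left_diff_distrib cis_mult)
    also have "cmod \<dots> = 1 * cmod (cis (Arg (c n)) - t n x y)" by (simp add: norm_mult \<gamma>_def norm_minus_commute)
    also have "\<dots> \<le> 2 * cmod (c n - 1 *\<^sub>R t n x y)" by (rule cis_Arg_close) (simp_all add: t_eq)
    finally have "\<bar>\<theta> n x y\<bar> \<le> 6 * cmod (t n x y - c n)" by (simp add: norm_minus_commute)
    then have "\<bar>\<theta> n x y\<bar>\<^sup>2 \<le> (6 * cmod (t n x y - c n))\<^sup>2" by (rule power_mono) simp
    then show ?thesis by (simp add: power_mult_distrib)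
  qed
  have summ\<theta>: "summable (\<lambda>n. \<integral>\<omega>. (\<theta> n (X n \<omega>) (X (Suc n) \<omega>))\<^sup>2 \<partial>P)"
  proof (rule summable_comparison_test')
    show "summable (\<lambda>n. 36 * twist_var f \<xi> n (z n) (z (Suc n)))" using summ by (simp add: z_def)
    show "norm (\<integral>\<omega>. (\<theta> n (X n \<omega>) (X (Suc n) \<omega>))\<^sup>2 \<partial>P) \<le> 36 * twist_var f \<xi> n (z n) (z (Suc n))" for n
    proof -
      have "(\<integral>\<omega>. (\<theta> n (X n \<omega>) (X (Suc n) \<omega>))\<^sup>2 \<partial>P) \<le> (\<integral>\<omega>. 36 * (cmod (t n (X n \<omega>) (X (Suc n) \<omega>) - c n))\<^sup>2 \<partial>P)"
        by (intro integral_mono \<theta>_le integrable_bounded_measurable bounded_measurable_intros b\<theta> bt)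
      also have "\<dots> = 36 * twist_var f \<xi> n (z n) (z (Suc n))"
        by (simp add: twist_var_def t_def[symmetric] c_def[symmetric])
      finally show ?thesis by simp
    qed
  qed
  have dec: "\<exists>k::int. \<xi> * f n x y = a n x - a (Suc n) y + \<gamma> n + \<theta> n x y + 2 * pi * of_int k" for n x y
  proof -
    have "cis (\<theta> n x y) = cis (\<xi> * f n x y + a (Suc n) y - a n x - \<gamma> n)"
      by (simp add: cis\<theta> t_eq cis_mult)
    then have "\<exists>k::int. \<xi> * f n x y + a (Suc n) y - a n x - \<gamma> n = \<theta> n x y + 2 * pi * of_int k"
      by (intro sin_cos_eq_iff[THEN iffD1]) (auto simp: complex_eq_iff)
    then show ?thesis by (auto simp: algebra_simps)
  qed
  show ?thesis
  proof (rule that[of a \<gamma> \<theta>])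
    fix n x y
    assume small: "\<And>n x y. x \<in> space (B n) \<Longrightarrow> y \<in> space (B (Suc n)) \<Longrightarrow> \<bar>\<xi> * f n x y\<bar> \<le> 1 / 10"
      and x: "x \<in> space (B n)" and y: "y \<in> space (B (Suc n))"
    \<comment> \<open>The angles add up as follows: a bridge has two steps of size
      \<open>1 / 10\<close>, the twist is within \<open>1 / 10 + 1 / 5 + 1 / 5 = 1 / 2\<close>, and
      so \<open>2\<pi> * k\<close> is at most
      \<open>1 / 10 + 1 / 5 + 1 / 5 + 1 / 2 + \<pi> = 1 + \<pi>\<close>, which is below
      \<open>2\<pi>\<close>.\<close>
    have a_le: "\<bar>a n x\<bar> \<le> 1 / 5" if x [measurable]: "x \<in> space (B n)" for n x
      unfolding a_def bridge_def
    proof (rule Arg_integral_le)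
      show "integrable (\<mu> (Suc n)) (\<lambda>w. p n x w * p (Suc n) w (z n))" by (rule pp_integrable[OF x z])
      show "0 < (\<integral>w. p n x w * p (Suc n) w (z n) \<partial>\<mu> (Suc n))" using two_step[OF x z] eps_pos by linarith
      show "\<bar>\<xi> * f n x w + \<xi> * f (Suc n) w (z n)\<bar> \<le> 1 / 5" if "w \<in> space (\<mu> (Suc n))" for w
        using small[OF x that[unfolded space_mu]] small[OF that[unfolded space_mu] z] by linarith
    qed auto
    have "c n = (\<integral>\<omega>. 1 *\<^sub>R cis (\<xi> * f n (X n \<omega>) (X (Suc n) \<omega>) + a (Suc n) (X (Suc n) \<omega>) - a n (X n \<omega>)) \<partial>P)"
      by (simp add: c_def t_eq)
    also have "\<bar>Arg \<dots>\<bar> \<le> 1 / 2"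
    proof (rule Arg_integral_le)
      fix \<omega> assume w: "\<omega> \<in> space P"
      show "\<bar>\<xi> * f n (X n \<omega>) (X (Suc n) \<omega>) + a (Suc n) (X (Suc n) \<omega>) - a n (X n \<omega>)\<bar> \<le> 1 / 2"
        using small[OF X_space[OF w, of n] X_space[OF w, of "Suc n"]] a_le[OF X_space[OF w, of n]]
          a_le[OF X_space[OF w, of "Suc n"]] by linarith
    qed (auto simp: prob_space)
    finally have \<gamma>: "\<bar>\<gamma> n\<bar> \<le> 1 / 2" by (simp add: \<gamma>_def)
    obtain k :: int where k: "\<xi> * f n x y = a n x - a (Suc n) y + \<gamma> n + \<theta> n x y + 2 * pi * of_int k" using dec by blast
    have "\<bar>2 * pi * of_int k\<bar> \<le> 1 + pi"
      using k small[OF x y] a_le[OF x] a_le[OF y] \<gamma> Arg_abs[of "t n x y * cis (- \<gamma> n)"]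
      unfolding \<theta>_def by linarith
    also have "\<dots> < 2 * pi * 1" using pi_ge_two by simp
    finally have "\<bar>of_int k :: real\<bar> < 1" by (simp add: abs_mult)
    then have "k = 0" by linarith
    then show "\<xi> * f n x y = a n x - a (Suc n) y + \<gamma> n + \<theta> n x y" using k by simp
  qed (use am dec summ\<theta> \<theta>f in \<open>auto simp: a_def \<gamma>_def \<theta>_def Arg_abs\<close>)
qed

end

section \<open>Reduction to a lattice\<close>

text \<open>Applied to the co-range, whose closedness is not established; therefore the first
  alternative is the existence of small elements rather than equality with the whole line.\<close>

lemma real_subgroup_cases:
  fixes A :: "real set"
  assumes zero: "0 \<in> A" and add: "\<And>x y. x \<in> A \<Longrightarrow> y \<in> A \<Longrightarrow> x + y \<in> A" and minus: "\<And>x. x \<in> A \<Longrightarrow> - x \<in> A"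
  shows "(\<forall>d>0. \<exists>a\<in>A. 0 < a \<and> a < d) \<or> (\<exists>t\<ge>0. A = range (\<lambda>k::int. t * of_int k))"
proof (cases "\<forall>d>0. \<exists>a\<in>A. 0 < a \<and> a < d")
  case False
  then obtain d where d: "0 < d" "\<And>a. a \<in> A \<Longrightarrow> 0 < a \<Longrightarrow> d \<le> a" by force
  have nat: "x * of_nat m \<in> A" if "x \<in> A" for x m
    by (induction m) (use that zero add in \<open>auto simp: distrib_left\<close>)
  have mult: "x * of_int k \<in> A" if "x \<in> A" for x k
    using nat[OF that, of "nat \<bar>k\<bar>"] minus[OF nat[OF that, of "nat \<bar>k\<bar>"]] by (cases "0 \<le> k") auto
  show ?thesis
  proof (cases "\<exists>a\<in>A. 0 < a")
    case False
    have "x = 0" if "x \<in> A" for x using False that minus[OF that] by (cases "x < 0") force+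
    then have "A = range (\<lambda>k::int. 0 * of_int k)" using zero by auto
    then show ?thesis by (intro disjI2 exI[of _ 0] conjI order.refl)
  next
    case True
    define Q where "Q = {a \<in> A. 0 < a}"
    define t where "t = Inf Q"
    have Q: "Q \<noteq> {}" "bdd_below Q" using True by (auto simp: Q_def intro!: bdd_belowI[of _ 0])
    have t_le: "t \<le> a" if "a \<in> Q" for a unfolding t_def using that Q by (intro cInf_lower)
    have "d \<le> t" unfolding t_def using Q d(2) by (intro cInf_greatest) (auto simp: Q_def)
    \<comment> \<open>Distinct elements of \<open>A\<close> are at least \<open>d\<close> apart, so
      an element within \<open>d\<close> of the infimum leaves no room for another one below it, and
      the infimum is attained.\<close>
    obtain a where a: "a \<in> Q" "a < t + d" using cInf_lessD[of Q "t + d"] Q d(1) by (auto simp: t_def)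
    have "a = t"
    proof (rule ccontr)
      assume "a \<noteq> t"
      then have "t < a" using t_le[OF a(1)] by simp
      then obtain b where b: "b \<in> Q" "b < a" using cInf_lessD[of Q a] Q by (auto simp: t_def)
      have "a + - b \<in> A" "0 < a + - b" using a b add[OF _ minus] by (auto simp: Q_def)
      then have "d \<le> a + - b" by (rule d(2))
      then show False using a(2) t_le[OF b(1)] by simp
    qed
    then have t: "t \<in> A" "0 < t" using a by (auto simp: Q_def)
    have "x \<in> range (\<lambda>k::int. t * of_int k)" if x: "x \<in> A" for x
    proof -
      define k where "k = \<lfloor>x / t\<rfloor>"
      define r where "r = x + - (t * of_int k)"
      have "of_int k \<le> x / t" "x / t < of_int k + 1" by (auto simp: k_def)
      then have r: "0 \<le> r" "r < t" using t(2) by (auto simp: r_def field_simps)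
      have "r \<in> A" unfolding r_def by (intro add minus mult t x)
      then have "r = 0" using t_le[of r] r by (force simp: Q_def)
      then show ?thesis by (auto simp: r_def)
    qed
    then have "A = range (\<lambda>k::int. t * of_int k)" using mult[OF t(1)] by blast
    then show ?thesis using t(2) by (intro disjI2 exI[of _ t]) simp
  qed
qed blast

lemma closed_subgroup_cases:
  assumes "closed_subgroup G"
  obtains "G = UNIV" | t where "0 \<le> t" "G = range (\<lambda>k::int. t * of_int k)"
proof -
  have G: "closed G" "0 \<in> G" "\<And>x y. x \<in> G \<Longrightarrow> y \<in> G \<Longrightarrow> x + y \<in> G" "\<And>x. x \<in> G \<Longrightarrow> - x \<in> G"
    using assms unfolding closed_subgroup_def by blast+
  have "(\<forall>d>0. \<exists>a\<in>G. 0 < a \<and> a < d) \<or> (\<exists>t\<ge>0. G = range (\<lambda>k::int. t * of_int k))"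
    using G(2-4) by (rule real_subgroup_cases)
  then show ?thesis
  proof
    assume dense: "\<forall>d>0. \<exists>a\<in>G. 0 < a \<and> a < d"
    have "x \<in> closure G" for x
      unfolding closure_approachable
    proof (intro allI impI)
      fix e :: real assume "0 < e"
      then obtain a where a: "a \<in> G" "0 < a" "a < e" using dense by blast
      have nat: "a * of_nat m \<in> G" for m by (induction m) (use a G in \<open>auto simp: distrib_left\<close>)
      define k where "k = \<lfloor>x / a\<rfloor>"
      have "a * of_int k \<in> G"
        using nat[of "nat \<bar>k\<bar>"] G(4)[OF nat[of "nat \<bar>k\<bar>"]] by (cases "0 \<le> k") auto
      moreover have "dist (a * of_int k) x < e"
      proof -
        have "of_int k \<le> x / a" "x / a < of_int k + 1" by (auto simp: k_def)
        then show ?thesis using a by (simp add: dist_real_def field_simps)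
      qed
      ultimately show "\<exists>y\<in>G. dist y x < e" by blast
    qed
    then have "G = UNIV" using G(1) by (auto simp: closure_closed)
    then show ?thesis by (rule that(1))
  next
    assume "\<exists>t\<ge>0. G = range (\<lambda>k::int. t * of_int k)"
    then show ?thesis using that(2) by blast
  qed
qed

lemma closed_subgroup_multiples: "closed_subgroup (range (\<lambda>k::int. t * of_int k))"
proof -
  have "closed (range (\<lambda>k::int. t * of_int k))"
  proof (cases "t = 0")
    case False
    have "closed ((\<lambda>x. t *\<^sub>R x) ` (\<int> :: real set))" by (intro closed_scaling closed_Ints)
    then show ?thesis by (simp add: Ints_def image_image)
  qed simp
  moreover have "0 = t * of_int 0" "t * of_int j + t * of_int k = t * of_int (j + k)"
    "- (t * of_int j) = t * of_int (- j)" for j k :: int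
    by (simp_all add: distrib_left)
  ultimately show ?thesis
    unfolding closed_subgroup_def by (blast intro: rangeI)
qed

section \<open>Tight functionals and lattices\<close>

context elliptic_chain
begin

text \<open>
  This is \<^const>\<open>center_tight\<close> in shifted time.
\<close>

definition tight :: "(nat \<Rightarrow> 'a \<Rightarrow> 'a \<Rightarrow> real) \<Rightarrow> bool" where
  "tight h \<longleftrightarrow> (\<exists>m :: nat \<Rightarrow> real. \<forall>\<epsilon>>0. \<exists>M :: real. \<forall>N\<ge>1.
     \<P>(\<omega> in P. \<bar>(\<Sum>n<N. h n (X n \<omega>) (X (Suc n) \<omega>)) - m N\<bar> > M) < \<epsilon>)"

lemma functional_diff: "functional f \<Longrightarrow> functional g \<Longrightarrow> functional (\<lambda>n x y. f n x y - g n x y)"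
  unfolding functional_def case_prod_beta by (auto intro: borel_measurable_diff)

lemma tight_imp_corange:
  assumes h: "functional h" and "tight h"
  shows "\<xi> \<in> corange h"
proof -
  define S where "S N \<omega> = (\<Sum>n<N. h n (X n \<omega>) (X (Suc n) \<omega>))" for N \<omega>
  have [measurable]: "S N \<in> borel_measurable P" for N
    unfolding S_def by (intro borel_measurable_sum functional_X h)
  from \<open>tight h\<close> obtain m where m: "\<And>e. 0 < e \<Longrightarrow> \<exists>M. \<forall>N\<ge>1. \<P>(\<omega> in P. \<bar>S N \<omega> - m N\<bar> > M) < e"
    unfolding tight_def S_def by blast
  \<comment> \<open>Off an event of probability below \<open>1 / 8\<close> the exponential is within
    \<open>1 / 4\<close> of 1, and on it within 2, so its mean is within
    \<open>1 / 4 + 2 / 8 = 1 / 2\<close> of 1.\<close>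
  obtain M where M: "\<And>N. 1 \<le> N \<Longrightarrow> \<P>(\<omega> in P. \<bar>S N \<omega> - m N\<bar> > M) < 1 / 8" using m[of "1 / 8"] by auto
  have small: "\<eta> \<in> corange h" if \<eta>: "\<bar>\<eta>\<bar> * \<bar>M\<bar> \<le> 1 / 4" for \<eta>
  proof (rule corangeI_charfun[OF h])
    fix N
    show "1 / 2 \<le> cmod (\<integral>\<omega>. cis (\<eta> * (\<Sum>n<N. h n (X n \<omega>) (X (Suc n) \<omega>))) \<partial>P)"
    proof (cases "N = 0")
      case False
      define E where "E = {\<omega> \<in> space P. \<bar>S N \<omega> - m N\<bar> > M}"
      have [measurable]: "E \<in> sets P" unfolding E_def by measurable
      define D where "D \<omega> = \<eta> * (S N \<omega> - m N)" for \<omega>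
      have [measurable]: "D \<in> borel_measurable P" unfolding D_def by measurable
      have ic: "integrable P (\<lambda>\<omega>. cis (D \<omega>))" "integrable P (\<lambda>\<omega>. cis (D \<omega>) - 1)"
        by (auto intro!: integrable_bounded_measurable bounded_measurable_diff bounded_measurableI[of "\<lambda>\<omega>. cis (D \<omega>)" P 1])
      have ii: "integrable P (\<lambda>\<omega>. 1 / 4 + 2 * indicator E \<omega> :: real)"
        by (intro integrable_bounded_measurable bounded_measurableI[of _ _ 3]) (auto simp: indicator_def)
      have "(\<integral>\<omega>. cmod (cis (D \<omega>) - 1) \<partial>P) \<le> (\<integral>\<omega>. 1 / 4 + 2 * indicator E \<omega> \<partial>P)"
      proof (rule integral_mono)
        fix \<omega> assume \<omega>: "\<omega> \<in> space P"
        show "cmod (cis (D \<omega>) - 1) \<le> 1 / 4 + 2 * indicator E \<omega>"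
        proof (cases "\<omega> \<in> E")
          case True
          then show ?thesis using norm_triangle_ineq4[of "cis (D \<omega>)" 1] by simp
        next
          case F: False
          have "cmod (cis (D \<omega>) - 1) = 2 * \<bar>sin (D \<omega> / 2)\<bar>"
            using dist_exp_i_1[of "D \<omega>"] by (simp add: cis_conv_exp)
          also have "\<dots> \<le> \<bar>D \<omega>\<bar>" using abs_sin_x_le_abs_x[of "D \<omega> / 2"] by simp
          also have "\<dots> = \<bar>\<eta>\<bar> * \<bar>S N \<omega> - m N\<bar>" by (simp add: D_def abs_mult)
          also have "\<dots> \<le> \<bar>\<eta>\<bar> * \<bar>M\<bar>" using F \<omega> by (intro mult_left_mono) (auto simp: E_def)
          finally show ?thesis using \<eta> F by simp
        qed
      qed (use ic ii in auto)
      also have "\<dots> = 1 / 4 + 2 * prob E"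
      proof -
        have "integrable P (indicator E :: 'w \<Rightarrow> real)"
          by (intro integrable_bounded_measurable bounded_measurableI[of _ _ 1]) (auto simp: indicator_def)
        then show ?thesis by (simp add: prob_space)
      qed
      also have "\<dots> \<le> 1 / 2" using M[of N] False by (simp add: E_def)
      finally have "cmod (\<integral>\<omega>. cis (D \<omega>) - 1 \<partial>P) \<le> 1 / 2" by (rule order_trans[OF integral_norm_bound])
      then have "1 / 2 \<le> cmod (\<integral>\<omega>. cis (D \<omega>) \<partial>P)"
        using ic norm_triangle_ineq4[of "\<integral>\<omega>. cis (D \<omega>) \<partial>P" "\<integral>\<omega>. cis (D \<omega>) - 1 \<partial>P"] by (simp add: prob_space)
      \<comment> \<open>The centring contributes only a phase, so undoing it preserves the
        modulus.\<close>
      also have "\<dots> = cmod (cis (\<eta> * m N) * (\<integral>\<omega>. cis (D \<omega>) \<partial>P))" by (simp add: norm_mult)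
      also have "cis (\<eta> * m N) * (\<integral>\<omega>. cis (D \<omega>) \<partial>P) = (\<integral>\<omega>. cis (\<eta> * m N) * cis (D \<omega>) \<partial>P)"
        by (rule integral_mult_right_zero[symmetric])
      also have "\<dots> = (\<integral>\<omega>. cis (\<eta> * S N \<omega>) \<partial>P)"
        by (simp add: cis_mult D_def right_diff_distrib)
      finally show ?thesis by (simp add: S_def)
    qed (simp add: prob_space)
  qed
  \<comment> \<open>\<open>\<xi>\<close> is cut into \<open>k\<close> equal parts, each small enough
    for \<open>small\<close>; adding 1 to the ceiling keeps \<open>k\<close> positive when
    \<open>\<xi>\<close> or \<open>M\<close> is 0.\<close>
  define L where "L = 4 * \<bar>\<xi>\<bar> * \<bar>M\<bar>"
  define k where "k = \<lceil>L\<rceil> + 1"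
  have "0 \<le> L" by (simp add: L_def)
  then have "0 \<le> \<lceil>L\<rceil>" by simp
  then have k: "L \<le> of_int k" "1 \<le> k"
    unfolding k_def using le_of_int_ceiling[of L] by linarith+
  have k0: "(0 :: real) < of_int k" using k(2) by simp
  have "\<bar>\<xi> / of_int k\<bar> * \<bar>M\<bar> = (L / of_int k) / 4"
    unfolding abs_divide abs_of_pos[OF k0] L_def by simp
  also have "\<dots> \<le> 1 / 4" using k(1) k0 by (intro divide_right_mono) (simp_all add: divide_le_eq_1)
  finally have "of_int k * (\<xi> / of_int k) \<in> corange h" by (intro corange_mult[OF h] small)
  also have "of_int k * (\<xi> / of_int k) = \<xi>" using k0 by simp
  finally show ?thesis .
qed

text \<open>At the frequency \<open>2\<pi> / t\<close> the exponential of \<open>g\<close> is almost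
  surely the constant \<open>exp (\<i> \<xi> c n)\<close>. Absorbing it into the constants gives
  \<open>f\<close> the same square defects as \<open>f - g\<close>, which has every frequency in its
  co-range.\<close>

lemma corange_of_lattice_approximation:
  assumes f: "functional f" and g: "functional g" and tight: "tight (\<lambda>n x y. f n x y - g n x y)" and t: "0 < t"
    and lattice: "\<And>n. AE \<omega> in P. g n (X n \<omega>) (X (Suc n) \<omega>) - c n \<in> range (\<lambda>k::int. t * of_int k)"
  shows "2 * pi / t \<in> corange f"
proof -
  define \<xi> where "\<xi> = 2 * pi / t"
  let ?h = "\<lambda>n x y. f n x y - g n x y"
  have h: "functional ?h" by (rule functional_diff[OF f g])
  obtain C where C: "\<And>N. \<exists>d w. phases d w \<and>
     (\<Sum>n<N. sq_defect ?h \<xi> d w n) \<le> C"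
    using tight_imp_corange[OF h tight, of \<xi>] unfolding corange_def by blast
  have "\<exists>d w. phases d w \<and> (\<Sum>n<N. sq_defect f \<xi> d w n) \<le> C" for N
  proof -
    obtain d w where dw: "phases d w" "(\<Sum>n<N. sq_defect ?h \<xi> d w n) \<le> C" using C by blast
    define d' where "d' n = d n * cis (\<xi> * c n)" for n
    have ph: "phases d' w" using dw(1) by (auto simp: phases_def d'_def norm_mult)
    have "(sq_defect f \<xi> d' w n) = (sq_defect ?h \<xi> d w n)" for n
    proof (rule integral_cong_AE)
      show "AE \<omega> in P. (defect f \<xi> d' w n (X n \<omega>) (X (Suc n) \<omega>))\<^sup>2 = (defect ?h \<xi> d w n (X n \<omega>) (X (Suc n) \<omega>))\<^sup>2"
        using lattice[of n]
      proof eventually_elim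
        case (elim \<omega>)
        define x where "x = X n \<omega>"
        define y where "y = X (Suc n) \<omega>"
        from elim obtain k :: int where "g n x y - c n = t * of_int k" unfolding x_def y_def by blast
        then have "g n x y = c n + t * of_int k" by simp
        then have "\<xi> * f n x y = \<xi> * ?h n x y + \<xi> * c n + 2 * pi * of_int k"
          using t by (simp add: \<xi>_def field_simps)
        moreover have "cis (2 * pi * of_int k) = 1" by (rule cis_multiple_2pi) simp
        ultimately have "cis (\<xi> * f n x y) = cis (\<xi> * ?h n x y) * cis (\<xi> * c n)"
          by (simp only: cis_mult[symmetric] mult_1_right)
        then have "cis (\<xi> * f n x y) * w (Suc n) y - d' n * w n x = cis (\<xi> * c n) * (cis (\<xi> * ?h n x y) * w (Suc n) y - d n * w n x)"
          by (simp add: d'_def algebra_simps)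
        then have "defect f \<xi> d' w n x y = defect ?h \<xi> d w n x y" by (simp add: defect_def norm_mult)
        then show ?case by (simp add: x_def y_def)
      qed
    qed (use bounded_measurable_power2[OF defect_X_bounded[OF f ph]] bounded_measurable_power2[OF defect_X_bounded[OF h dw(1)]]
        in \<open>auto simp: bounded_measurable_def\<close>)
    then show ?thesis using dw(2) ph by (intro exI[of _ d'] exI[of _ w]) simp
  qed
  then show ?thesis unfolding corange_def \<xi>_def by blast
qed

text \<open>The coboundary telescopes to at most \<open>2\<pi>\<close>, the sum of
  \<open>\<gamma>\<close> goes into the centring, and the sums of \<open>\<theta>\<close> have
  variance bounded uniformly in \<open>N\<close>, so that the Chebyshev inequality applies.\<close>

lemma tight_coboundary_plus_square_summable:
  assumes a: "\<And>n. a n \<in> borel_measurable (B n)" "\<And>n x. \<bar>a n x\<bar> \<le> pi"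
    and \<theta>: "functional \<theta>" "\<And>n x y. \<bar>\<theta> n x y\<bar> \<le> pi" "summable (\<lambda>n. \<integral>\<omega>. (\<theta> n (X n \<omega>) (X (Suc n) \<omega>))\<^sup>2 \<partial>P)"
    and \<xi>: "0 < \<xi>"
  shows "tight (\<lambda>n x y. (a n x - a (Suc n) y + \<gamma> n + \<theta> n x y) / \<xi>)"
proof -
  define T where "T N \<omega> = (\<Sum>n<N. \<theta> n (X n \<omega>) (X (Suc n) \<omega>))" for N \<omega>
  have bT: "bounded_measurable P (T N)" for N
    unfolding T_def by (intro bounded_measurable_sum bounded_measurableI[of _ _ pi] functional_X \<theta>) (simp add: \<theta>)
  have [measurable]: "T N \<in> borel_measurable P" for N using bT by (auto simp: bounded_measurable_def)
  define s where "s n = (\<integral>\<omega>. (\<theta> n (X n \<omega>) (X (Suc n) \<omega>))\<^sup>2 \<partial>P)" for n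
  define V where "V = (3 + 32 / \<epsilon>) * (\<Sum>n. s n)"
  have V: "(\<integral>\<omega>. (T N \<omega> - expectation (T N))\<^sup>2 \<partial>P) \<le> V" for N
  proof -
    have "(\<integral>\<omega>. (T N \<omega> - expectation (T N))\<^sup>2 \<partial>P) \<le> (3 + 32 / \<epsilon>) * (\<Sum>n<N. s n)"
      unfolding T_def s_def using \<theta>(1)
      by (intro variance_partial_sum[where C = pi]) (auto simp: functional_def \<theta>(2))
    also have "(\<Sum>n<N. s n) \<le> (\<Sum>n. s n)"
      using \<theta>(3) by (intro sum_le_suminf) (auto simp: s_def)
    finally show ?thesis using eps_pos by (simp add: V_def mult_left_mono)
  qed
  have V0: "0 \<le> V" using order_trans[OF Bochner_Integration.integral_nonneg V[of 0]] by simp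
  define m where "m N = ((\<Sum>n<N. \<gamma> n) + expectation (T N)) / \<xi>" for N
  show ?thesis
    unfolding tight_def
  proof (intro exI[of _ m] allI impI)
    fix e :: real assume e: "0 < e"
    \<comment> \<open>Chosen so that \<open>V / L^2 < e\<close>; the summand 1 gives strictness and
      keeps \<open>L\<close> positive when \<open>V = 0\<close>.\<close>
    define L where "L = sqrt (V / e) + 1"
    have L: "0 < L" "V / L\<^sup>2 < e"
    proof -
      show L0: "0 < L" using V0 e by (simp add: L_def add_nonneg_pos)
      have "V / e = (sqrt (V / e))\<^sup>2" using V0 e by simp
      also have "\<dots> < L\<^sup>2" unfolding L_def using V0 e by (intro power_strict_mono) auto
      finally show "V / L\<^sup>2 < e" using e L0 by (simp add: field_simps)
    qed
    let ?R = "\<lambda>N \<omega>. (\<Sum>n<N. (a n (X n \<omega>) - a (Suc n) (X (Suc n) \<omega>) + \<gamma> n + \<theta> n (X n \<omega>) (X (Suc n) \<omega>)) / \<xi>) - m N"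
    show "\<exists>M. \<forall>N\<ge>1. \<P>(\<omega> in P. \<bar>?R N \<omega>\<bar> > M) < e"
    proof (intro exI[of _ "(2 * pi + L) / \<xi>"] allI impI)
      fix N :: nat
      have sum_eq: "?R N \<omega>
          = (a 0 (X 0 \<omega>) - a N (X N \<omega>) + (T N \<omega> - expectation (T N))) / \<xi>" for \<omega>
      proof -
        have "(\<Sum>n<N. a n (X n \<omega>) - a (Suc n) (X (Suc n) \<omega>)) = a 0 (X 0 \<omega>) - a N (X N \<omega>)"
          by (rule sum_lessThan_telescope')
        then show ?thesis
          by (simp add: m_def T_def sum_divide_distrib[symmetric] sum.distrib diff_divide_distrib[symmetric])
      qed
      have sub: "{\<omega> \<in> space P. \<bar>?R N \<omega>\<bar> > (2 * pi + L) / \<xi>}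
          \<subseteq> {\<omega> \<in> space P. L \<le> \<bar>T N \<omega> - expectation (T N)\<bar>}"
      proof safe
        fix \<omega> assume "\<bar>?R N \<omega>\<bar> > (2 * pi + L) / \<xi>"
        then have "2 * pi + L < \<bar>a 0 (X 0 \<omega>) - a N (X N \<omega>) + (T N \<omega> - expectation (T N))\<bar>"
          unfolding sum_eq using \<xi> by (simp add: abs_divide divide_less_cancel)
        then show "L \<le> \<bar>T N \<omega> - expectation (T N)\<bar>" using a(2)[of 0 "X 0 \<omega>"] a(2)[of N "X N \<omega>"] by linarith
      qed
      have "\<P>(\<omega> in P. \<bar>?R N \<omega>\<bar> > (2 * pi + L) / \<xi>)
          \<le> \<P>(\<omega> in P. L \<le> \<bar>T N \<omega> - expectation (T N)\<bar>)"
        by (rule finite_measure_mono[OF sub]) measurable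
      also have "\<dots> \<le> variance (T N) / L\<^sup>2"
        using L(1) by (intro Chebyshev_inequality integrable_bounded_measurable bounded_measurable_power2 bT) auto
      also have "\<dots> \<le> V / L\<^sup>2" using V[of N] by (intro divide_right_mono) auto
      finally show "\<P>(\<omega> in P. \<bar>?R N \<omega>\<bar> > (2 * pi + L) / \<xi>) < e"
        using L(2) by simp
    qed
  qed
qed

text \<open>\<open>g\<close> is \<open>f\<close> minus the bounded remainder of the decomposition,
  divided by \<open>\<xi>\<close>; what is left is the multiple of \<open>2\<pi>\<close>. Tightness
  allows arbitrary centring, so \<open>\<gamma>\<close> may join the remainder, and \<open>g\<close>
  takes values in the lattice itself and not merely in translates.\<close>

lemma lattice_reduction:
  assumes f: "functional f" and bdd: "\<And>n x y. x \<in> space (B n) \<Longrightarrow> y \<in> space (B (Suc n)) \<Longrightarrow> \<bar>f n x y\<bar> \<le> M"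
    and \<xi>: "\<xi> \<in> corange f" "0 < \<xi>"
  obtains g where "functional g" "tight (\<lambda>n x y. f n x y - g n x y)"
    "\<And>n x y. g n x y \<in> range (\<lambda>k::int. 2 * pi / \<xi> * of_int k)"
    "\<And>n x y. x \<in> space (B n) \<Longrightarrow> y \<in> space (B (Suc n)) \<Longrightarrow> \<bar>g n x y\<bar> \<le> M + 4 * pi / \<xi>"
    "\<And>n x y. \<xi> * M \<le> 1 / 10 \<Longrightarrow> x \<in> space (B n) \<Longrightarrow> y \<in> space (B (Suc n)) \<Longrightarrow> g n x y = 0"
proof (rule corange_decomposition[OF f \<xi>(1)])
  fix a \<gamma> \<theta>
  assume a: "\<And>n. a n \<in> borel_measurable (B n)" "\<And>n x. \<bar>a n x\<bar> \<le> pi" and \<gamma>: "\<And>n. \<bar>\<gamma> n\<bar> \<le> pi"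
    and \<theta>: "functional \<theta>" "\<And>n x y. \<bar>\<theta> n x y\<bar> \<le> pi" "summable (\<lambda>n. \<integral>\<omega>. (\<theta> n (X n \<omega>) (X (Suc n) \<omega>))\<^sup>2 \<partial>P)"
    and dec: "\<And>n x y. \<exists>k::int. \<xi> * f n x y = a n x - a (Suc n) y + \<gamma> n + \<theta> n x y + 2 * pi * of_int k"
    and small: "\<And>n x y. (\<And>n x y. x \<in> space (B n) \<Longrightarrow> y \<in> space (B (Suc n)) \<Longrightarrow> \<bar>\<xi> * f n x y\<bar> \<le> 1 / 10) \<Longrightarrow>
      x \<in> space (B n) \<Longrightarrow> y \<in> space (B (Suc n)) \<Longrightarrow> \<xi> * f n x y = a n x - a (Suc n) y + \<gamma> n + \<theta> n x y"
  define R where "R n x y = (a n x - a (Suc n) y + \<gamma> n + \<theta> n x y) / \<xi>" for n x y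
  note [measurable] = a(1) functional_measurable[OF \<theta>(1)]
  have R: "functional R" unfolding functional_def R_def by measurable
  have R_le: "\<bar>R n x y\<bar> \<le> 4 * pi / \<xi>" for n x y
  proof -
    have "\<bar>a n x - a (Suc n) y + \<gamma> n + \<theta> n x y\<bar> \<le> 4 * pi"
      using a(2)[of n x] a(2)[of "Suc n" y] \<gamma>[of n] \<theta>(2)[of n x y] by linarith
    then show ?thesis using \<xi>(2) by (simp add: R_def abs_divide divide_right_mono)
  qed
  show ?thesis
  proof (rule that[of "\<lambda>n x y. f n x y - R n x y"])
    show "functional (\<lambda>n x y. f n x y - R n x y)" by (rule functional_diff[OF f R])
    have "tight R" unfolding R_def by (rule tight_coboundary_plus_square_summable[OF a \<theta> \<xi>(2)])
    then show "tight (\<lambda>n x y. f n x y - (f n x y - R n x y))" by simp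
    fix n x y
    obtain k :: int where "\<xi> * f n x y = a n x - a (Suc n) y + \<gamma> n + \<theta> n x y + 2 * pi * of_int k" using dec by blast
    then have "f n x y - R n x y = 2 * pi / \<xi> * of_int k" using \<xi>(2) by (simp add: R_def field_simps)
    then show "f n x y - R n x y \<in> range (\<lambda>k::int. 2 * pi / \<xi> * of_int k)" by (rule range_eqI)
    assume x: "x \<in> space (B n)" and y: "y \<in> space (B (Suc n))"
    show "\<bar>f n x y - R n x y\<bar> \<le> M + 4 * pi / \<xi>" using bdd[OF x y] R_le[of n x y] by linarith
    assume M: "\<xi> * M \<le> 1 / 10"
    have "\<bar>\<xi> * f n x y\<bar> \<le> 1 / 10" if "x \<in> space (B n)" "y \<in> space (B (Suc n))" for n x y
    proof -
      have "\<bar>\<xi> * f n x y\<bar> = \<xi> * \<bar>f n x y\<bar>" using \<xi>(2) by (simp add: abs_mult)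
      also have "\<dots> \<le> \<xi> * M" using \<xi>(2) by (intro mult_left_mono bdd that) simp
      finally show ?thesis using M by linarith
    qed
    from small[OF this x y] show "f n x y - R n x y = 0" using \<xi>(2) by (simp add: R_def field_simps)
  qed
qed

text \<open>The last clause compares \<open>G\<close> with each single admissible subgroup of each
  competitor. In this form it bounds the algebraic ranges of all competitors from below, and hence
  the essential range.\<close>

theorem minimal_reduction:
  assumes f: "functional f" and bdd: "\<And>n x y. x \<in> space (B n) \<Longrightarrow> y \<in> space (B (Suc n)) \<Longrightarrow> \<bar>f n x y\<bar> \<le> M"
  obtains g G C where "functional g" "tight (\<lambda>n x y. f n x y - g n x y)" "closed_subgroup G"
    "\<And>n x y. x \<in> space (B n) \<Longrightarrow> y \<in> space (B (Suc n)) \<Longrightarrow> g n x y \<in> G"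
    "\<And>n x y. x \<in> space (B n) \<Longrightarrow> y \<in> space (B (Suc n)) \<Longrightarrow> \<bar>g n x y\<bar> \<le> C"
    "\<And>h H c. functional h \<Longrightarrow> tight (\<lambda>n x y. f n x y - h n x y) \<Longrightarrow> closed_subgroup H \<Longrightarrow>
      (\<And>n. AE \<omega> in P. h n (X n \<omega>) (X (Suc n) \<omega>) - c n \<in> H) \<Longrightarrow> G \<subseteq> H"
proof -
  have approx: "H = UNIV \<or> (\<exists>s>0. H = range (\<lambda>k::int. s * of_int k) \<and> 2 * pi / s \<in> corange f) \<or> (\<forall>\<xi>>0. \<xi> \<in> corange f)"
    if h: "functional h" "tight (\<lambda>n x y. f n x y - h n x y)" and H: "closed_subgroup H"
      and AE: "\<And>n. AE \<omega> in P. h n (X n \<omega>) (X (Suc n) \<omega>) - c n \<in> H" for h H c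
  proof (cases rule: closed_subgroup_cases[OF H])
    case (2 s)
    show ?thesis
    proof (cases "s = 0")
      case True
      then have H0: "H = {0}" using 2 by auto
      \<comment> \<open>The trivial group is contained in every lattice, so the lattice
        \<open>(2\<pi> / \<xi>)\<int>\<close> may be used for each \<open>\<xi>\<close>.\<close>
      have "\<xi> \<in> corange f" if "0 < \<xi>" for \<xi>
      proof -
        have "2 * pi / (2 * pi / \<xi>) \<in> corange f"
        proof (rule corange_of_lattice_approximation[OF f h])
          show "AE \<omega> in P. h n (X n \<omega>) (X (Suc n) \<omega>) - c n \<in> range (\<lambda>k::int. 2 * pi / \<xi> * of_int k)" for n
            using AE[of n] unfolding H0 by eventually_elim (auto intro: range_eqI[of _ _ 0])
        qed (use that in simp)
        then show ?thesis using that by simp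
      qed
      then show ?thesis by blast
    next
      case False
      then have "0 < s" using 2 by simp
      then show ?thesis using corange_of_lattice_approximation[OF f h, of s c] AE 2 by blast
    qed
  qed simp
  show ?thesis
  proof (cases "\<forall>d>0. \<exists>a\<in>corange f. 0 < a \<and> a < d")
    case dense: True
    \<comment> \<open>Makes \<open>\<xi> * M\<close> at most \<open>1 / 10\<close>, the threshold
      below which the reduced functional is 0; the summand 1 avoids division by 0.\<close>
    have pos: "0 < 1 / (10 * (\<bar>M\<bar> + 1))" by (simp add: add_nonneg_pos)
    obtain \<xi> where \<xi>: "\<xi> \<in> corange f" "0 < \<xi>" "\<xi> < 1 / (10 * (\<bar>M\<bar> + 1))"
      using dense[rule_format, OF pos] by blast
    have "\<xi> * M \<le> \<xi> * (\<bar>M\<bar> + 1)" using \<xi> by (intro mult_left_mono) auto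
    also have "\<dots> \<le> 1 / 10" using \<xi> by (simp add: field_simps)
    finally have M: "\<xi> * M \<le> 1 / 10" .
    show ?thesis
    proof (rule lattice_reduction[OF f bdd \<xi>(1,2)])
      fix g
      assume g: "functional g" "tight (\<lambda>n x y. f n x y - g n x y)"
        "\<And>n x y. \<xi> * M \<le> 1 / 10 \<Longrightarrow> x \<in> space (B n) \<Longrightarrow> y \<in> space (B (Suc n)) \<Longrightarrow> g n x y = 0"
      show ?thesis
        by (rule that[of g "{0}" 0]) (use g M in \<open>auto simp: closed_subgroup_def\<close>)
    qed
  next
    case False
    moreover have "(\<forall>d>0. \<exists>a\<in>corange f. 0 < a \<and> a < d) \<or> (\<exists>t\<ge>0. corange f = range (\<lambda>k::int. t * of_int k))"
      by (intro real_subgroup_cases corange_0 corange_add[OF f] corange_minus)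
    ultimately obtain t where cyclic: "0 \<le> t" "corange f = range (\<lambda>k::int. t * of_int k)" by blast
    show ?thesis
    proof (cases "t = 0")
      case True
      then have A: "corange f = {0}" using cyclic by auto
      show ?thesis
      proof (rule that[of f UNIV M])
        show "tight (\<lambda>n x y. f n x y - f n x y)"
          unfolding tight_def by (auto intro!: exI[of _ "\<lambda>_. 0"] exI[of _ 1])
        fix h H c
        assume "functional h" "tight (\<lambda>n x y. f n x y - h n x y)" "closed_subgroup H"
          "\<And>n. AE \<omega> in P. h n (X n \<omega>) (X (Suc n) \<omega>) - c n \<in> H"
        \<comment> \<open>Either alternative to \<open>H = UNIV\<close> would put a positive number
          into the trivial co-range.\<close>
        from approx[OF this] show "UNIV \<subseteq> H" unfolding A by (auto simp: gt_ex) (metis less_irrefl zero_less_one)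
      qed (use f bdd in \<open>auto simp: closed_subgroup_def\<close>)
    next
      case False
      then have t: "0 < t" using cyclic by simp
      have tA: "t \<in> corange f" unfolding cyclic(2) by (auto intro: range_eqI[of _ _ 1])
      show ?thesis
      proof (rule lattice_reduction[OF f bdd tA t])
        fix g
        assume g: "functional g" "tight (\<lambda>n x y. f n x y - g n x y)"
          "\<And>n x y. g n x y \<in> range (\<lambda>k::int. 2 * pi / t * of_int k)"
          "\<And>n x y. x \<in> space (B n) \<Longrightarrow> y \<in> space (B (Suc n)) \<Longrightarrow> \<bar>g n x y\<bar> \<le> M + 4 * pi / t"
      show ?thesis
      proof (rule that[of g "range (\<lambda>k::int. 2 * pi / t * of_int k)" "M + 4 * pi / t"])
        fix h H c
        assume "functional h" "tight (\<lambda>n x y. f n x y - h n x y)" "closed_subgroup H"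
          "\<And>n. AE \<omega> in P. h n (X n \<omega>) (X (Suc n) \<omega>) - c n \<in> H"
        from approx[OF this] consider "H = UNIV"
          | s where "0 < s" "H = range (\<lambda>k::int. s * of_int k)" "2 * pi / s \<in> corange f"
          | "\<forall>\<xi>>0. \<xi> \<in> corange f" by blast
        then show "range (\<lambda>k::int. 2 * pi / t * of_int k) \<subseteq> H"
        proof cases
          case (2 s)
          then obtain k :: int where "2 * pi / s = t * of_int k" unfolding cyclic(2) by blast
          then have "2 * pi / t * of_int j = s * of_int (k * j)" for j :: int
            using t 2(1) by (simp add: field_simps)
          then show ?thesis unfolding 2(2) by blast
        next
          case 3
          \<comment> \<open>Half of a generator is not a multiple of it, so a nontrivial cyclic
            co-range cannot contain all positive frequencies.\<close>
          then have "t / 2 \<in> corange f" using t by simp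
          then obtain k :: int where "t / 2 = t * of_int k" unfolding cyclic(2) by blast
          then have "real_of_int (2 * k) = 1" using t by (simp add: field_simps)
          then have "2 * k = 1" by linarith
          then have False by presburger
          then show ?thesis ..
        qed simp
      qed (rule g closed_subgroup_multiples; assumption)+
      qed
    qed
  qed
qed

section \<open>Tightness under null modifications and sums\<close>

lemma tight_cong_AE:
  assumes h: "functional h" "functional h'" and eq: "\<And>n. AE \<omega> in P. h n (X n \<omega>) (X (Suc n) \<omega>) = h' n (X n \<omega>) (X (Suc n) \<omega>)"
    and "tight h"
  shows "tight h'"
proof -
  note [measurable] = functional_X[OF h(1)] functional_X[OF h(2)]
  have "AE \<omega> in P. \<forall>n. h n (X n \<omega>) (X (Suc n) \<omega>) = h' n (X n \<omega>) (X (Suc n) \<omega>)" using eq by (simp add: AE_all_countable)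
  then have "\<P>(\<omega> in P. \<bar>(\<Sum>n<N. h n (X n \<omega>) (X (Suc n) \<omega>)) - m N\<bar> > M) =
      \<P>(\<omega> in P. \<bar>(\<Sum>n<N. h' n (X n \<omega>) (X (Suc n) \<omega>)) - m N\<bar> > M)" for N M and m :: "nat \<Rightarrow> real"
    by (intro measure_eq_AE) (auto elim!: eventually_mono)
  then show ?thesis using \<open>tight h\<close> unfolding tight_def by simp
qed

lemma tight_add:
  assumes h: "functional h" "functional h'" and t: "tight h" "tight h'"
  shows "tight (\<lambda>n x y. h n x y + h' n x y)"
proof -
  define S where "S N \<omega> = (\<Sum>n<N. h n (X n \<omega>) (X (Suc n) \<omega>))" for N \<omega>
  define S' where "S' N \<omega> = (\<Sum>n<N. h' n (X n \<omega>) (X (Suc n) \<omega>))" for N \<omega>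
  note [measurable] = functional_X[OF h(1)] functional_X[OF h(2)]
  have [measurable]: "S N \<in> borel_measurable P" "S' N \<in> borel_measurable P" for N
    unfolding S_def S'_def by measurable
  obtain m where m: "\<And>e. 0 < e \<Longrightarrow> \<exists>M. \<forall>N\<ge>1. \<P>(\<omega> in P. \<bar>S N \<omega> - m N\<bar> > M) < e"
    using t(1) unfolding tight_def S_def by blast
  obtain m' where m': "\<And>e. 0 < e \<Longrightarrow> \<exists>M. \<forall>N\<ge>1. \<P>(\<omega> in P. \<bar>S' N \<omega> - m' N\<bar> > M) < e"
    using t(2) unfolding tight_def S'_def by blast
  have "\<exists>M. \<forall>N\<ge>1. \<P>(\<omega> in P. \<bar>S N \<omega> + S' N \<omega> - (m N + m' N)\<bar> > M) < e" if e: "0 < e" for e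
  proof -
    obtain M where M: "\<And>N. 1 \<le> N \<Longrightarrow> \<P>(\<omega> in P. \<bar>S N \<omega> - m N\<bar> > M) < e / 2" using m[of "e / 2"] e by auto
    obtain M' where M': "\<And>N. 1 \<le> N \<Longrightarrow> \<P>(\<omega> in P. \<bar>S' N \<omega> - m' N\<bar> > M') < e / 2" using m'[of "e / 2"] e by auto
    have "\<P>(\<omega> in P. \<bar>S N \<omega> + S' N \<omega> - (m N + m' N)\<bar> > M + M') < e" if N: "1 \<le> N" for N
    proof -
      have "\<P>(\<omega> in P. \<bar>S N \<omega> + S' N \<omega> - (m N + m' N)\<bar> > M + M') \<le>
          measure P ({\<omega> \<in> space P. \<bar>S N \<omega> - m N\<bar> > M} \<union> {\<omega> \<in> space P. \<bar>S' N \<omega> - m' N\<bar> > M'})"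
        by (rule finite_measure_mono) auto
      also have "\<dots> \<le> \<P>(\<omega> in P. \<bar>S N \<omega> - m N\<bar> > M) + \<P>(\<omega> in P. \<bar>S' N \<omega> - m' N\<bar> > M')"
        by (rule measure_Un_le) measurable
      finally show ?thesis using M[OF N] M'[OF N] by linarith
    qed
    then show ?thesis by blast
  qed
  then show ?thesis
    unfolding tight_def by (intro exI[of _ "\<lambda>N. m N + m' N"]) (simp add: sum.distrib S_def S'_def)
qed

end

section \<open>Transfer to the original chain\<close>

lemma space_borel_of_metric [simp]: "space (borel_of_metric m) = mspace m"
  unfolding borel_of_metric_def
  by (rule space_measure_of) (use openin_subset[of "mtopology_of m"] in auto)

section \<open>The Markov property in integrated form, and the shift of time\<close>

context markov_chain
begin

lemma past_map_measurable: "(\<lambda>\<omega>. \<lambda>i\<in>{1..n}. X i \<omega>) \<in> P \<rightarrow>\<^sub>M (\<Pi>\<^sub>M i\<in>{1..n}. borel_of_metric (S i))"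
  by (rule measurable_restrict) (use state in auto)

lemma subalgebra_past_algebra: "subalgebra P (past_algebra S P X n)"
proof -
  have "sets (past_algebra S P X n) \<subseteq> sets P"
    unfolding past_algebra_def sets_vimage_algebra
    by (intro sets.sigma_sets_subset subsetI) (use measurable_sets[OF past_map_measurable] in blast)
  then show ?thesis by (simp add: subalgebra_def past_algebra_def)
qed

lemma past_algebra_adapted:
  assumes "1 \<le> i" "i \<le> n"
  shows "X i \<in> past_algebra S P X n \<rightarrow>\<^sub>M borel_of_metric (S i)"
proof -
  have 1: "(\<lambda>\<omega>. \<lambda>i\<in>{1..n}. X i \<omega>) \<in> past_algebra S P X n \<rightarrow>\<^sub>M (\<Pi>\<^sub>M i\<in>{1..n}. borel_of_metric (S i))"
    unfolding past_algebra_def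
    by (intro measurable_vimage_algebra1 funcsetI measurable_space[OF past_map_measurable])
  have "(\<lambda>\<omega>. (\<lambda>i\<in>{1..n}. X i \<omega>) i) \<in> past_algebra S P X n \<rightarrow>\<^sub>M borel_of_metric (S i)"
    using assms by (intro measurable_compose[OF 1 measurable_component_singleton]) auto
  then show ?thesis using assms by simp
qed

text \<open>The conditional form of the Markov property, integrated over an event \<open>A\<close>
  of the past. It feeds the assumption \<open>transition\<close> of \<open>elliptic_chain\<close>,
  which speaks of events only.\<close>

lemma transition_probability:
  assumes n: "1 \<le> n" and A: "A \<in> sets (past_algebra S P X n)" and E: "E \<in> sets (borel_of_metric (S (n + 1)))"
  shows "emeasure P (A \<inter> X (n + 1) -` E) = (\<integral>\<^sup>+\<omega>. emeasure (K n (X n \<omega>)) E * indicator A \<omega> \<partial>P)"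
proof -
  interpret sub: finite_measure_subalgebra P "past_algebra S P X n"
    by unfold_locales (rule subalgebra_past_algebra)
  note [measurable] = state[OF n] kernel[OF n] state[of "n + 1", simplified] E[simplified]
  have AP [measurable]: "A \<in> sets P" using A subalgebra_past_algebra by (auto simp: subalgebra_def)
  have Am [measurable]: "(\<lambda>\<omega>. measure (K n (X n \<omega>)) E) \<in> borel_measurable P"
    using measurable_compose[OF measurable_compose[OF state[OF n] kernel[OF n]] measurable_measure_prob_algebra[OF E]] .
  have prob_K: "prob_space (K n (X n \<omega>))" if "\<omega> \<in> space P" for \<omega>
    using measurable_space[OF kernel[OF n] measurable_space[OF state[OF n] that]] by (simp add: space_prob_algebra)
  have K_emeasure: "emeasure (K n (X n \<omega>)) E = ennreal (measure (K n (X n \<omega>)) E)" if "\<omega> \<in> space P" for \<omega>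
  proof -
    interpret k: prob_space "K n (X n \<omega>)" by (rule prob_K[OF that])
    show ?thesis by (rule k.emeasure_eq_measure)
  qed
  have bK: "bounded_measurable P (\<lambda>\<omega>. measure (K n (X n \<omega>)) E)"
    by (rule bounded_measurableI[OF Am, of 1]) (simp add: prob_space.prob_le_1[OF prob_K])
  have bA: "bounded_measurable P (indicator A :: 'w \<Rightarrow> real)"
    by (rule bounded_measurableI[of _ _ 1]) (auto simp: indicator_def)
  have bE: "bounded_measurable P (\<lambda>\<omega>. indicator E (X (n + 1) \<omega>) :: real)"
    by (rule bounded_measurableI[of _ _ 1]) (auto simp: indicator_def)
  have XE: "A \<inter> X (n + 1) -` E = {\<omega> \<in> space P. \<omega> \<in> A \<and> X (n + 1) \<omega> \<in> E}"
    using sets.sets_into_space[OF AP] by auto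
  have "measure P (A \<inter> X (n + 1) -` E) = (\<integral>\<omega>\<in>A. indicator E (X (n + 1) \<omega>) \<partial>P)"
  proof -
    define T where "T = {\<omega> \<in> space P. \<omega> \<in> A \<and> X (n + 1) \<omega> \<in> E}"
    have "T \<inter> space P = T" by (auto simp: T_def)
    then have "measure P T = (\<integral>\<omega>. indicator T \<omega> \<partial>P)" by simp
    also have "\<dots> = (\<integral>\<omega>\<in>A. indicator E (X (n + 1) \<omega>) \<partial>P)"
      unfolding set_lebesgue_integral_def
      by (intro Bochner_Integration.integral_cong) (auto simp: T_def indicator_def)
    finally show ?thesis unfolding XE T_def .
  qed
  also have "\<dots> = (\<integral>\<omega>\<in>A. real_cond_exp P (past_algebra S P X n) (\<lambda>\<omega>'. indicator E (X (n + 1) \<omega>')) \<omega> \<partial>P)"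
    by (rule sub.real_cond_exp_intA[OF integrable_bounded_measurable[OF bE] A])
  also have "\<dots> = (\<integral>\<omega>\<in>A. measure (K n (X n \<omega>)) E \<partial>P)"
    unfolding set_lebesgue_integral_def
    by (rule integral_cong_AE) (measurable, use markov[OF n E] in \<open>auto elim: eventually_mono\<close>)
  also have "ennreal \<dots> = (\<integral>\<^sup>+\<omega>. ennreal (indicator A \<omega> * measure (K n (X n \<omega>)) E) \<partial>P)"
    unfolding set_lebesgue_integral_def real_scaleR_def
    by (intro nn_integral_eq_integral[symmetric] integrable_bounded_measurable bounded_measurable_mult bA bK) auto
  also have "\<dots> = (\<integral>\<^sup>+\<omega>. emeasure (K n (X n \<omega>)) E * indicator A \<omega> \<partial>P)"
    by (intro nn_integral_cong) (auto simp: K_emeasure indicator_def)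
  finally show ?thesis by (simp add: emeasure_eq_measure)
qed

lemma elliptic_chain_shift:
  assumes "uniformly_elliptic S K"
  obtains \<mu> p \<epsilon> where
    "elliptic_chain P (\<lambda>n. borel_of_metric (S (Suc n))) (\<lambda>n. past_algebra S P X (Suc n)) (\<lambda>n. X (Suc n)) \<mu> p \<epsilon>"
  using assms unfolding uniformly_elliptic_def
proof (elim exE conjE)
  fix \<epsilon> :: real and \<mu> :: "nat \<Rightarrow> 'a measure" and p :: "nat \<Rightarrow> 'a \<Rightarrow> 'a \<Rightarrow> real"
  assume eps: "0 < \<epsilon>" "\<epsilon> < 1"
    and mu': "\<forall>n\<ge>1. prob_space (\<mu> n) \<and> sets (\<mu> n) = sets (borel_of_metric (S n))"
    and pm': "\<forall>n\<ge>1. case_prod (p n) \<in> borel_measurable (borel_of_metric (S n) \<Otimes>\<^sub>M borel_of_metric (S (n + 1)))"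
    and pK': "\<forall>n\<ge>1. \<forall>x\<in>mspace (S n). K n x = density (\<mu> (n + 1)) (\<lambda>y. ennreal (p n x y))"
    and pb': "\<forall>n\<ge>1. \<forall>x\<in>mspace (S n). \<forall>y\<in>mspace (S (n + 1)). 0 \<le> p n x y \<and> p n x y \<le> 1 / \<epsilon>"
    and p2': "\<forall>n\<ge>1. \<forall>x\<in>mspace (S n). \<forall>z\<in>mspace (S (n + 2)). (\<integral>y. p n x y * p (n + 1) y z \<partial>\<mu> (n + 1)) > \<epsilon>"
  have mu: "prob_space (\<mu> n)" "sets (\<mu> n) = sets (borel_of_metric (S n))" if "1 \<le> n" for n
    using mu' that by blast+
  note pm = pm'[rule_format] and pK = pK'[rule_format] and pb = pb'[rule_format] and p2 = p2'[rule_format]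
  define q where "q n x y = max 0 (min (1 / \<epsilon>) (p (Suc n) x y))" for n x y
  have q_eq: "q n x y = p (Suc n) x y" if "x \<in> mspace (S (Suc n))" "y \<in> mspace (S (Suc (Suc n)))" for n x y
    using pb[of "Suc n" x y] that by (simp add: q_def)
  have space_mu: "space (\<mu> (Suc n)) = mspace (S (Suc n))" for n
    using sets_eq_imp_space_eq[OF mu(2)[of "Suc n"]] by simp
  have q_meas: "(\<lambda>(x, y). q n x y) \<in> borel_measurable (borel_of_metric (S (Suc n)) \<Otimes>\<^sub>M borel_of_metric (S (Suc (Suc n))))" for n
    using pm[of "Suc n"] unfolding q_def by (simp add: case_prod_beta' borel_measurable_max borel_measurable_min)
  have q_sec: "(\<lambda>y. ennreal (q n x y)) \<in> borel_measurable (\<mu> (Suc (Suc n)))" if "x \<in> mspace (S (Suc n))" for n x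
  proof -
    have "(\<lambda>y. (x, y)) \<in> \<mu> (Suc (Suc n)) \<rightarrow>\<^sub>M borel_of_metric (S (Suc n)) \<Otimes>\<^sub>M borel_of_metric (S (Suc (Suc n)))"
      using that mu(2)[of "Suc (Suc n)"] by (intro measurable_Pair measurable_const) (auto simp: measurable_ident_sets)
    from measurable_compose[OF this q_meas] show ?thesis by (intro measurable_compose[OF _ measurable_ennreal]) simp
  qed
  have K_density: "K (Suc n) x = density (\<mu> (Suc (Suc n))) (\<lambda>y. ennreal (q n x y))" if x: "x \<in> mspace (S (Suc n))" for n x
  proof -
    have pm': "(\<lambda>y. ennreal (p (Suc n) x y)) \<in> borel_measurable (\<mu> (Suc (Suc n)))"
      using q_sec[OF x] by (rule measurable_cong[THEN iffD1, rotated]) (auto simp: space_mu q_eq x)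
    show ?thesis
      using pK[of "Suc n" x] x by (simp, intro density_cong[OF pm' q_sec[OF x]]) (auto simp: space_mu q_eq intro!: AE_I2)
  qed
  have "elliptic_chain P (\<lambda>n. borel_of_metric (S (Suc n))) (\<lambda>n. past_algebra S P X (Suc n)) (\<lambda>n. X (Suc n)) (\<lambda>n. \<mu> (Suc n)) q \<epsilon>"
  proof (rule elliptic_chain.intro[OF prob_space_axioms elliptic_chain_axioms.intro])
    show "subalgebra P (past_algebra S P X (Suc n))" for n by (rule subalgebra_past_algebra)
    show "X (Suc i) \<in> past_algebra S P X (Suc n) \<rightarrow>\<^sub>M borel_of_metric (S (Suc i))" if "i \<le> n" for i n
      using that by (intro past_algebra_adapted) auto
    show "(\<integral>\<^sup>+y. ennreal (q n x y) \<partial>\<mu> (Suc (Suc n))) = 1" if "x \<in> space (borel_of_metric (S (Suc n)))" for n x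
    proof -
      have x: "x \<in> mspace (S (Suc n))" using that by simp
      have "prob_space (K (Suc n) x)"
        using measurable_space[OF kernel[of "Suc n"] that] by (simp add: space_prob_algebra)
      then have "emeasure (K (Suc n) x) (space (K (Suc n) x)) = 1" by (rule prob_space.emeasure_space_1)
      then have "(\<integral>\<^sup>+y. ennreal (q n x y) * indicator (space (\<mu> (Suc (Suc n)))) y \<partial>\<mu> (Suc (Suc n))) = 1"
        unfolding K_density[OF x] using q_sec[OF x] by (simp add: emeasure_density)
      then show ?thesis by (simp cong: nn_integral_cong)
    qed
    show "\<epsilon> < (\<integral>y. q n x y * q (Suc n) y z \<partial>\<mu> (Suc (Suc n)))"
      if "x \<in> space (borel_of_metric (S (Suc n)))" "z \<in> space (borel_of_metric (S (Suc (Suc (Suc n)))))" for n x z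
    proof -
      have "(\<integral>y. q n x y * q (Suc n) y z \<partial>\<mu> (Suc (Suc n))) = (\<integral>y. p (Suc n) x y * p (Suc (Suc n)) y z \<partial>\<mu> (Suc (Suc n)))"
        using that by (intro Bochner_Integration.integral_cong) (auto simp: space_mu q_eq)
      then show ?thesis using p2[of "Suc n" x z] that by simp
    qed
    show "emeasure P (A \<inter> X (Suc (Suc n)) -` E) =
        (\<integral>\<^sup>+\<omega>. (\<integral>\<^sup>+y. ennreal (q n (X (Suc n) \<omega>) y) * indicator E y \<partial>\<mu> (Suc (Suc n))) * indicator A \<omega> \<partial>P)"
      if A: "A \<in> sets (past_algebra S P X (Suc n))" and E: "E \<in> sets (borel_of_metric (S (Suc (Suc n))))" for n A E
    proof -
      have "emeasure P (A \<inter> X (Suc (Suc n)) -` E) = (\<integral>\<^sup>+\<omega>. emeasure (K (Suc n) (X (Suc n) \<omega>)) E * indicator A \<omega> \<partial>P)"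
        using transition_probability[of "Suc n" A E] A E by simp
      also have "\<dots> = (\<integral>\<^sup>+\<omega>. (\<integral>\<^sup>+y. ennreal (q n (X (Suc n) \<omega>) y) * indicator E y \<partial>\<mu> (Suc (Suc n))) * indicator A \<omega> \<partial>P)"
      proof (rule nn_integral_cong)
        fix \<omega> assume "\<omega> \<in> space P"
        then have x: "X (Suc n) \<omega> \<in> mspace (S (Suc n))" using measurable_space[OF state[of "Suc n"]] by simp
        show "emeasure (K (Suc n) (X (Suc n) \<omega>)) E * indicator A \<omega> =
            (\<integral>\<^sup>+y. ennreal (q n (X (Suc n) \<omega>) y) * indicator E y \<partial>\<mu> (Suc (Suc n))) * indicator A \<omega>"
          unfolding K_density[OF x] using q_sec[OF x] E mu(2)[of "Suc (Suc n)"] by (simp add: emeasure_density)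
      qed
      finally show ?thesis .
    qed
    show "prob_space (\<mu> (Suc n))" for n by (rule mu) simp
    show "sets (\<mu> (Suc n)) = sets (borel_of_metric (S (Suc n)))" for n by (rule mu) simp
    show "0 < \<epsilon>" by (rule eps)
    show "0 \<le> q n x y" for n x y by (simp add: q_def)
    show "q n x y \<le> 1 / \<epsilon>" for n x y using eps by (simp add: q_def)
  qed (rule q_meas)
  then show ?thesis by (rule that)
qed

end

theorem theorem3p3:
  fixes S :: "nat \<Rightarrow> 'a metric"
    and P :: "'w measure"
    and X :: "nat \<Rightarrow> 'w \<Rightarrow> 'a"
    and K :: "nat \<Rightarrow> 'a \<Rightarrow> 'a measure"
    and f :: "nat \<Rightarrow> 'a \<Rightarrow> 'a \<Rightarrow> real"
  assumes "markov_chain S P X K"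
    and "uniformly_elliptic S K"
    and "additive_functional S f"
    and "as_uniformly_bounded P X f"
  shows "\<exists>g :: nat \<Rightarrow> 'a \<Rightarrow> 'a \<Rightarrow> real.
           additive_functional S g \<and>
           irreducible_functional S P X g \<and>
           uniformly_bounded S g \<and>
           center_tight P X (\<lambda>n x y. f n x y - g n x y) \<and>
           G_alg P X g = G_ess S P X g \<and>
           G_ess S P X g = G_ess S P X f"
proof -
  interpret markov_chain S P X K by fact
  obtain \<mu> p \<epsilon> where "elliptic_chain P (\<lambda>n. borel_of_metric (S (Suc n))) (\<lambda>n. past_algebra S P X (Suc n)) (\<lambda>n. X (Suc n)) \<mu> p \<epsilon>"
    using elliptic_chain_shift[OF assms(2)] by blast
  then interpret E: elliptic_chain P "\<lambda>n. borel_of_metric (S (Suc n))" "\<lambda>n. past_algebra S P X (Suc n)" "\<lambda>n. X (Suc n)" \<mu> p \<epsilon> .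
  have functional_shift: "E.functional (\<lambda>n. h (Suc n)) \<longleftrightarrow> additive_functional S h" for h
  proof -
    have "(\<forall>n\<ge>1. Q n) \<longleftrightarrow> (\<forall>n. Q (Suc n))" for Q :: "nat \<Rightarrow> bool"
      by (auto simp: Suc_le_eq gr0_conv_Suc)
    then show ?thesis by (simp add: E.functional_def additive_functional_def)
  qed
  have tight_shift: "center_tight P X h \<longleftrightarrow> E.tight (\<lambda>n. h (Suc n))" for h
    by (simp add: center_tight_def E.tight_def partial_sum_def sum.atLeast1_atMost_eq)
  have f: "E.functional (\<lambda>n. f (Suc n))" using assms(3) by (simp add: functional_shift)
  obtain M :: real where M: "0 \<le> M" "\<And>n. AE \<omega> in P. \<bar>f (Suc n) (X (Suc n) \<omega>) (X (Suc (Suc n)) \<omega>)\<bar> \<le> M"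
  proof -
    define s where "s = (SUP n\<in>{1..}. esssup P (\<lambda>\<omega>. ereal \<bar>f n (X n \<omega>) (X (n + 1) \<omega>)\<bar>))"
    have "s < \<infinity>" using assms(4) by (simp add: as_uniformly_bounded_def s_def)
    then have s: "r \<le> max 0 (real_of_ereal s)" if "ereal r \<le> s" for r
      using that by (cases s) auto
    have "AE \<omega> in P. \<bar>f (Suc n) (X (Suc n) \<omega>) (X (Suc (Suc n)) \<omega>)\<bar> \<le> max 0 (real_of_ereal s)" for n
    proof -
      have "esssup P (\<lambda>\<omega>. ereal \<bar>f (Suc n) (X (Suc n) \<omega>) (X (Suc n + 1) \<omega>)\<bar>) \<le> s"
        unfolding s_def by (rule SUP_upper) simp
      with esssup_AE[where M = P and f = "\<lambda>\<omega>. ereal \<bar>f (Suc n) (X (Suc n) \<omega>) (X (Suc n + 1) \<omega>)\<bar>"]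
      have "AE \<omega> in P. ereal \<bar>f (Suc n) (X (Suc n) \<omega>) (X (Suc n + 1) \<omega>)\<bar> \<le> s"
        by (auto elim!: eventually_mono intro: order_trans)
      then show ?thesis by eventually_elim (rule s, simp)
    qed
    then show ?thesis by (intro that[of "max 0 (real_of_ereal s)"]) auto
  qed
  \<comment> \<open>The reduction asks for a bound at all states, not only almost surely along the
    chain. Clipping at the essential bound changes \<open>f\<close> on null events only, so
    \<open>f\<close> and \<open>f'\<close> have the same competitors; \<open>0 \<le> M\<close> makes
    the clipped values lie between \<open>- M\<close> and \<open>M\<close>.\<close>
  define f' where "f' n x y = max (- M) (min M (f (Suc n) x y))" for n x y
  have f': "E.functional f'"
    using f unfolding E.functional_def f'_def case_prod_beta'
    by (auto intro!: borel_measurable_max borel_measurable_min)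
  have f'_bdd: "\<bar>f' n x y\<bar> \<le> M" for n x y using M(1) by (auto simp: f'_def)
  have f'_eq: "AE \<omega> in P. f' n (X (Suc n) \<omega>) (X (Suc (Suc n)) \<omega>) = f (Suc n) (X (Suc n) \<omega>) (X (Suc (Suc n)) \<omega>)" for n
    using M(2)[of n] by eventually_elim (auto simp: f'_def)
  have tight_f': "E.tight (\<lambda>n x y. f (Suc n) x y - h n x y) \<longleftrightarrow> E.tight (\<lambda>n x y. f' n x y - h n x y)"
    if h: "E.functional h" for h
  proof
    show "E.tight (\<lambda>n x y. f' n x y - h n x y)" if "E.tight (\<lambda>n x y. f (Suc n) x y - h n x y)"
    proof (rule E.tight_cong_AE[OF E.functional_diff[OF f h] E.functional_diff[OF f' h] _ that])
      show "AE \<omega> in P. f (Suc n) (X (Suc n) \<omega>) (X (Suc (Suc n)) \<omega>) - h n (X (Suc n) \<omega>) (X (Suc (Suc n)) \<omega>) =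
          f' n (X (Suc n) \<omega>) (X (Suc (Suc n)) \<omega>) - h n (X (Suc n) \<omega>) (X (Suc (Suc n)) \<omega>)" for n
        using f'_eq[of n] by eventually_elim simp
    qed
    show "E.tight (\<lambda>n x y. f (Suc n) x y - h n x y)" if "E.tight (\<lambda>n x y. f' n x y - h n x y)"
    proof (rule E.tight_cong_AE[OF E.functional_diff[OF f' h] E.functional_diff[OF f h] _ that])
      show "AE \<omega> in P. f' n (X (Suc n) \<omega>) (X (Suc (Suc n)) \<omega>) - h n (X (Suc n) \<omega>) (X (Suc (Suc n)) \<omega>) =
          f (Suc n) (X (Suc n) \<omega>) (X (Suc (Suc n)) \<omega>) - h n (X (Suc n) \<omega>) (X (Suc (Suc n)) \<omega>)" for n
        using f'_eq[of n] by eventually_elim simp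
    qed
  qed
  show ?thesis
  proof (rule E.minimal_reduction[OF f' f'_bdd])
    fix g' G C
    assume g': "E.functional g'" "E.tight (\<lambda>n x y. f' n x y - g' n x y)" and G: "closed_subgroup G"
      and g'_G: "\<And>n x y. x \<in> space (borel_of_metric (S (Suc n))) \<Longrightarrow> y \<in> space (borel_of_metric (S (Suc (Suc n)))) \<Longrightarrow> g' n x y \<in> G"
      and g'_bdd: "\<And>n x y. x \<in> space (borel_of_metric (S (Suc n))) \<Longrightarrow> y \<in> space (borel_of_metric (S (Suc (Suc n)))) \<Longrightarrow> \<bar>g' n x y\<bar> \<le> C"
      and minimal: "\<And>h H c. E.functional h \<Longrightarrow> E.tight (\<lambda>n x y. f' n x y - h n x y) \<Longrightarrow> closed_subgroup H \<Longrightarrow>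
        (\<And>n. AE \<omega> in P. h n (X (Suc n) \<omega>) (X (Suc (Suc n)) \<omega>) - c n \<in> H) \<Longrightarrow> G \<subseteq> H"
    \<comment> \<open>Undoes the shift of time; the entry at index 0 is a copy of the one at index 1
      and carries no meaning.\<close>
    define g where "g n = g' (n - 1)" for n
    have g_Suc [simp]: "g (Suc n) = g' n" for n by (simp add: g_def)
    have g: "additive_functional S g" using g' by (simp flip: functional_shift)
    have fg: "center_tight P X (\<lambda>n x y. f n x y - g n x y)"
      using g' tight_f'[OF g'(1)] by (simp add: tight_shift)
    have X_space: "X n \<omega> \<in> mspace (S n)" if "1 \<le> n" "\<omega> \<in> space P" for n \<omega>
      using measurable_space[OF state[OF that(1)] that(2)] by simp
    \<comment> \<open>\<open>G\<close> is a lower bound for the algebraic ranges of all competitors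
      of \<open>f\<close>. As \<open>g\<close> is a competitor with algebraic range inside
      \<open>G\<close>, this determines all three ranges.\<close>
    have G_le: "G \<subseteq> G_alg P X h" if h: "additive_functional S h" "center_tight P X (\<lambda>n x y. f n x y - h n x y)" for h
    proof -
      have h': "E.functional (\<lambda>n. h (Suc n))" using h by (simp add: functional_shift)
      have "G \<subseteq> H" if H: "closed_subgroup H" and c: "\<And>n. 1 \<le> n \<Longrightarrow> \<P>(\<omega> in P. h n (X n \<omega>) (X (n + 1) \<omega>) - c n \<in> H) = 1" for H c
      proof (rule minimal[OF h' _ H])
        show "E.tight (\<lambda>n x y. f' n x y - h (Suc n) x y)" using h(2) tight_f'[OF h'] by (simp add: tight_shift)
        fix n
        note [measurable] = E.functional_X[OF h']
        have [measurable]: "H \<in> sets borel" using H by (auto simp: closed_subgroup_def)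
        have "{\<omega> \<in> space P. h (Suc n) (X (Suc n) \<omega>) (X (Suc (Suc n)) \<omega>) - c (Suc n) \<in> H} \<in> sets P" by measurable
        then show "AE \<omega> in P. h (Suc n) (X (Suc n) \<omega>) (X (Suc (Suc n)) \<omega>) - c (Suc n) \<in> H"
          using c[of "Suc n"] by (subst prob_Collect_eq_1[symmetric]) auto
      qed
      then show ?thesis unfolding G_alg_def by blast
    qed
    have alg_g: "G_alg P X g \<subseteq> G"
    proof -
      have "\<P>(\<omega> in P. g n (X n \<omega>) (X (n + 1) \<omega>) - 0 \<in> G) = 1" if "1 \<le> n" for n
      proof -
        obtain k where "n = Suc k" using \<open>1 \<le> n\<close> by (cases n) auto
        then have "{\<omega> \<in> space P. g n (X n \<omega>) (X (n + 1) \<omega>) - 0 \<in> G} = space P"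
          using g'_G X_space by auto
        then show ?thesis by (simp only: prob_space)
      qed
      then show ?thesis unfolding G_alg_def using G by (intro Inter_lower) (auto intro!: exI[of _ "\<lambda>_. 0"])
    qed
    have ess_f: "G_ess S P X f = G"
    proof
      show "G \<subseteq> G_ess S P X f" unfolding G_ess_def using G_le by blast
      have "G_ess S P X f \<subseteq> G_alg P X g" unfolding G_ess_def using g fg by blast
      then show "G_ess S P X f \<subseteq> G" using alg_g by blast
    qed
    have ess_g: "G_ess S P X g = G"
    proof
      \<comment> \<open>Sums of center-tight functionals are center-tight, so every competitor of
        \<open>g\<close> is a competitor of \<open>f\<close>, and the lower bound \<open>G\<close>
        applies to it.\<close>
      have "center_tight P X h" if h: "h = (\<lambda>n x y. f n x y - k n x y)" and k: "additive_functional S k"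
        "center_tight P X (\<lambda>n x y. g n x y - k n x y)" for h k
      proof -
        have k': "E.functional (\<lambda>n. k (Suc n))" using k by (simp add: functional_shift)
        have "E.tight (\<lambda>n x y. (f (Suc n) x y - g' n x y) + (g' n x y - k (Suc n) x y))"
          using fg k(2) by (intro E.tight_add E.functional_diff f g' k') (simp_all add: tight_shift)
        then show ?thesis by (simp add: tight_shift h)
      qed
      then show "G \<subseteq> G_ess S P X g" unfolding G_ess_def using G_le by blast
      have "center_tight P X (\<lambda>n x y. g n x y - g n x y)"
        by (auto simp: center_tight_def partial_sum_def intro!: exI[of _ "\<lambda>_. 0"] exI[of _ 0])
      then have "G_ess S P X g \<subseteq> G_alg P X g" unfolding G_ess_def using g by blast
      then show "G_ess S P X g \<subseteq> G" using alg_g by blast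
    qed
    have alg: "G_alg P X g = G" using alg_g G_le[OF g fg] by blast
    have "uniformly_bounded S g"
    proof -
      have "(SUP n\<in>{1..}. SUP (x, y)\<in>mspace (S n) \<times> mspace (S (n + 1)). ereal \<bar>g n x y\<bar>) \<le> ereal C"
      proof (intro SUP_least)
        fix n z assume "n \<in> {1::nat..}" "z \<in> mspace (S n) \<times> mspace (S (n + 1))"
        then show "(case z of (x, y) \<Rightarrow> ereal \<bar>g n x y\<bar>) \<le> ereal C" using g'_bdd by (cases n) auto
      qed
      also have "\<dots> < \<infinity>" by simp
      finally show ?thesis by (simp add: uniformly_bounded_def)
    qed
    then show ?thesis
      using g fg alg ess_f ess_g by (intro exI[of _ g]) (simp add: irreducible_functional_def)
  qed
qed

end
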